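(* Let $\sum_i h_i^2(u)\,du_i^2$ be a flat Egoroff metric with potential $\phi$, rotation coefficient matrix $\beta$ and extended frame $F=\begin{pmatrix}E&X\\0&1\end{pmatrix}$, and let $h=(h_1,\dots,h_n)^t$. Let $\alpha\in\mathbb{R}\setminus\{0\}$ and let $\pi$ be a Hermitian projection of $\mathbb{C}^n$ with $\bar\pi=\pi$. Let $\tilde\pi(u)$ be the Hermitian projection of $\mathbb{C}^n$ onto $E(u,\mathrm{i}\alpha)^{-1}(\mathrm{Im}\,\pi)$ and $\eta=E(u,\mathrm{i}\alpha)^tX(u,-\mathrm{i}\alpha)$. Then $$\tilde X=g_{\mathrm{i}\alpha,-\mathrm{i}\alpha,\pi'}\ast X=g_{-\mathrm{i}\alpha,\pi^\perp}\Big(X+\frac{2\mathrm{i}\alpha}{\lambda-\mathrm{i}\alpha}\,E\,\tilde\pi\eta\Big)$$ is a new associated family of flat Lagrangian immersions for $\tilde{\mathrm I}=\sum_i\tilde h_i^2\,du_i^2$, where $$\tilde h=g_{\mathrm{i}\alpha,-\mathrm{i}\alpha,\pi'}\ast h=h-2\alpha\tilde\pi\eta .$$ Moreover, $\tilde{\mathrm I}$ is a new flat Egoroff metric with potential $$\tilde\phi=g_{\mathrm{i}\alpha,-\mathrm{i}\alpha,\pi'}\ast\phi=\phi-2\alpha\,\eta^t\,\tilde\pi\,\eta ,$$ and its rotation coefficient matrix is $\tilde\beta=g_{\mathrm{i}\alpha,-\mathrm{i}\alpha,\pi'}\ast\beta=\beta-2\alpha\tilde\pi_\ast$.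
   Context: $u=(u_1,\dots,u_n)$ ranges over a simply connected domain in $\mathbb{R}^n$ containing $0$. $\delta=\mathrm{diag}(du_1,\dots,du_n)$, $[\delta,\beta]=\delta\beta-\beta\delta$. For a matrix $\xi$, $\xi_\ast$ is $\xi$ with its diagonal entries replaced by $0$. A flat Egoroff metric is a flat metric $\sum_i h_i^2\,du_i^2$ for which there is a potential function $\phi$ with $\partial\phi/\partial u_i=h_i^2$ for all $i$. Its rotation coefficient matrix is $\beta=(\beta_{ij})$ with $\beta_{ij}=(h_i)_{u_j}/h_j$ for $i\ne j$ and $\beta_{ii}=0$ (it is symmetric). Its extended frame is the unique $F(u,\lambda)=\begin{pmatrix}E&X\\0&1\end{pmatrix}$, holomorphic in $\lambda\in\mathbb{C}$, with $F^{-1}dF=\begin{pmatrix}\mathrm{i}\lambda\delta+[\delta,\beta]&\delta h\\0&0\end{pmatrix}$ and $F(0,\lambda)=\mathrm{I}$. Its associated family is $X(\cdot,\lambda)$, with $\lambda$ real: for $\lambda\neq0$ these are flat Lagrangian immersions into $\mathbb{C}^n$ with first fundamental form $\sum_ih_i^2du_i^2$ and second fundamental form $\lambda\sum_i du_i^2\otimes J(\partial X/\partial u_i)$, $J$ being multiplication by $\mathrm{i}$. (An immersion of an $n$-manifold in $\mathbb{C}^n=\mathbb{R}^{2n}$ is Lagrangian if the symplectic form $\mathrm{Im}(\bar Z_1^tZ_2)$ pulls back to $0$, and flat if its induced metric is flat.) A Hermitian projection is a matrix $\pi$ with $\pi^2=\pi=\pi^*$; $\pi^\perp=\mathrm{I}-\pi$;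 $\bar\pi$ is the entrywise conjugate. For $w\in\mathbb{C}\setminus\mathbb{R}$, $g_{w,\pi}(\lambda)=\pi+\frac{\lambda-\bar w}{\lambda-w}\pi^\perp$. $\pi'$ is the Hermitian projection of $\mathbb{C}^{n+1}=\mathbb{C}^n\oplus\mathbb{C}$ onto $\mathrm{Im}\,\pi\oplus0$, and $g_{\mathrm{i}\alpha,-\mathrm{i}\alpha,\pi'}(\lambda)=\begin{pmatrix}g_{\mathrm{i}\alpha,\pi}(\lambda)&0\\0&\frac{\lambda+\mathrm{i}\alpha}{\lambda-\mathrm{i}\alpha}\end{pmatrix}$. The dressing action $\ast$ is defined by factoring $g_{\mathrm{i}\alpha,-\mathrm{i}\alpha,\pi'}F=\tilde F\tilde g$ with $\tilde F(u,\cdot)$ holomorphic on $\mathbb{C}$ and $\tilde g(u,\cdot)$ holomorphic near $\lambda=\infty$ with $\tilde g(u,\infty)=\mathrm{I}$; then $g_{\mathrm{i}\alpha,-\mathrm{i}\alpha,\pi'}\ast F=\tilde F=\begin{pmatrix}\tilde E&\tilde X\\0&1\end{pmatrix}$, $\tilde F^{-1}d\tilde F=\begin{pmatrix}\mathrm{i}\lambda\delta+[\delta,\tilde\beta]&\delta\tilde h\\0&0\end{pmatrix}$, and $g_{\mathrm{i}\alpha,-\mathrm{i}\alpha,\pi'}\ast X$, $\ast h$, $\ast\beta$, $\ast\phi$ denote $\tilde X$, $\tilde h$, $\tilde\beta$ and the corresponding potential $\tilde\phi$.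
   Formalization: The claims that Ĩ is a flat Egoroff metric with rotation coefficients β̃ and that X̃ is a family of flat Lagrangian immersions are made only where all h̃_i are nonzero (an open set containing 0), since h̃_i can vanish; the formula for X̃ is stated for λ ≠ ±iα. *)

theory Defs
  imports "HOL-Analysis.Analysis"
begin

section \<open>Smooth functions, flat metrics\<close>

primrec Ck_on :: "nat \<Rightarrow> ('a::real_normed_vector) set \<Rightarrow> ('a \<Rightarrow> 'b::real_normed_vector) \<Rightarrow> bool" where
  "Ck_on 0 U f \<longleftrightarrow> continuous_on U f"
| "Ck_on (Suc k) U f \<longleftrightarrow>
     f differentiable_on U \<and> (\<forall>v. Ck_on k U (\<lambda>u. frechet_derivative f (at u) v))"

text \<open>The notions below are used for open sets \<open>U\<close> only.\<close>

definition smooth_on :: "('a::real_normed_vector) set \<Rightarrow> ('a \<Rightarrow> 'b::real_normed_vector) \<Rightarrow> bool" where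
  "smooth_on U f \<longleftrightarrow> (\<forall>k. Ck_on k U f)"

definition partial_deriv :: "'n::finite \<Rightarrow> (real^'n \<Rightarrow> 'b::real_normed_vector) \<Rightarrow> real^'n \<Rightarrow> 'b" where
  "partial_deriv i f u = frechet_derivative f (at u) (axis i 1)"

definition riemannian_metric :: "(real^'n::finite) set \<Rightarrow> (real^'n \<Rightarrow> real^'n^'n) \<Rightarrow> bool" where
  "riemannian_metric U g \<longleftrightarrow>
     smooth_on U g \<and>
     (\<forall>u\<in>U. transpose (g u) = g u \<and> (\<forall>v. v \<noteq> 0 \<longrightarrow> v \<bullet> (g u *v v) > 0))"

text \<open>\<open>christoffel g k i j\<close> is \<open>\<Gamma>\<^sup>k\<^sub>i\<^sub>j\<close>, and \<open>riemann g l k i j\<close> is the \<open>\<partial>\<^sub>l\<close>-component of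
  \<open>R(\<partial>\<^sub>i, \<partial>\<^sub>j) \<partial>\<^sub>k\<close>.\<close>

definition christoffel ::
  "(real^'n::finite \<Rightarrow> real^'n^'n) \<Rightarrow> 'n \<Rightarrow> 'n \<Rightarrow> 'n \<Rightarrow> real^'n \<Rightarrow> real" where
  "christoffel g k i j u =
     (1/2) * (\<Sum>l\<in>UNIV. matrix_inv (g u) $ k $ l *
        (partial_deriv i (\<lambda>x. g x $ j $ l) u + partial_deriv j (\<lambda>x. g x $ i $ l) u
          - partial_deriv l (\<lambda>x. g x $ i $ j) u))"

definition riemann ::
  "(real^'n::finite \<Rightarrow> real^'n^'n) \<Rightarrow> 'n \<Rightarrow> 'n \<Rightarrow> 'n \<Rightarrow> 'n \<Rightarrow> real^'n \<Rightarrow> real" where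
  "riemann g l k i j u =
     partial_deriv i (christoffel g l j k) u - partial_deriv j (christoffel g l i k) u
     + (\<Sum>m\<in>UNIV. christoffel g l i m u * christoffel g m j k u
                 - christoffel g l j m u * christoffel g m i k u)"

definition flat_metric :: "(real^'n::finite) set \<Rightarrow> (real^'n \<Rightarrow> real^'n^'n) \<Rightarrow> bool" where
  "flat_metric U g \<longleftrightarrow>
     riemannian_metric U g \<and> (\<forall>u\<in>U. \<forall>l k i j. riemann g l k i j u = 0)"


section \<open>Flat Egoroff metrics\<close>

definition diag_metric :: "(real^'n::finite \<Rightarrow> real^'n) \<Rightarrow> real^'n \<Rightarrow> real^'n^'n" where
  "diag_metric h u = (\<chi> i j. if i = j then (h u $ i)\<^sup>2 else 0)"

definition has_potential ::
  "(real^'n::finite) set \<Rightarrow> (real^'n \<Rightarrow> real^'n) \<Rightarrow> (real^'n \<Rightarrow> real) \<Rightarrow> bool" where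
  "has_potential U h \<phi> \<longleftrightarrow>
     (\<forall>u\<in>U. \<phi> differentiable (at u) \<and> (\<forall>i. partial_deriv i \<phi> u = (h u $ i)\<^sup>2))"

text \<open>Positive definiteness of the metric forces every \<open>h\<^sub>i\<close> to be nowhere zero on \<open>U\<close>.\<close>

definition flat_egoroff ::
  "(real^'n::finite) set \<Rightarrow> (real^'n \<Rightarrow> real^'n) \<Rightarrow> (real^'n \<Rightarrow> real) \<Rightarrow> bool" where
  "flat_egoroff U h \<phi> \<longleftrightarrow>
     smooth_on U h \<and> flat_metric U (diag_metric h) \<and> has_potential U h \<phi>"

definition rotation_coeffs :: "(real^'n::finite \<Rightarrow> real^'n) \<Rightarrow> real^'n \<Rightarrow> real^'n^'n" where
  "rotation_coeffs h u =
     (\<chi> i j. if i = j then 0 else partial_deriv j (\<lambda>x. h x $ i) u / h u $ j)"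


section \<open>Extended frames\<close>

text \<open>The spectral parameter is written \<open>z\<close>, since the Greek letter is the binder symbol.\<close>

abbreviation cvec :: "real^'n::finite \<Rightarrow> complex^'n" where
  "cvec x \<equiv> (\<chi> i. complex_of_real (x $ i))"

abbreviation cmat :: "real^'n::finite^'m::finite \<Rightarrow> complex^'n^'m" where
  "cmat A \<equiv> map_matrix complex_of_real A"

definition upper_block ::
  "complex^'n::finite^'n \<Rightarrow> complex^'n \<Rightarrow> complex \<Rightarrow> complex^('n option)^('n option)" where
  "upper_block A b d = (\<chi> i j. case i of
       Some i' \<Rightarrow> (case j of Some j' \<Rightarrow> A $ i' $ j' | None \<Rightarrow> b $ i')
     | None \<Rightarrow> (case j of Some j' \<Rightarrow> 0 | None \<Rightarrow> d))"

text \<open>Matrix-valued 1-forms are written as linear functions of the tangent vector \<open>v\<close>; thus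
  \<open>delta v\<close> is the value of \<open>\<delta> = diag(du\<^sub>1, \<dots>, du\<^sub>n)\<close> on \<open>v\<close>.\<close>

definition delta :: "real^'n::finite \<Rightarrow> complex^'n^'n" where
  "delta v = (\<chi> i j. if i = j then complex_of_real (v $ i) else 0)"

definition frame_form ::
  "real^'n::finite \<Rightarrow> real^'n^'n \<Rightarrow> complex \<Rightarrow> real^'n \<Rightarrow> complex^('n option)^('n option)" where
  "frame_form h \<beta> z v =
     upper_block (mat (\<i> * z) ** delta v + (delta v ** cmat \<beta> - cmat \<beta> ** delta v))
                 (delta v *v cvec h) 0"

text \<open>\<open>F\<^sup>-\<^sup>1 dF\<close> equals the form with data \<open>h\<close>, \<open>\<beta>\<close>.\<close>

definition frame_equation ::
  "(real^'n::finite) set \<Rightarrow> (real^'n \<Rightarrow> real^'n) \<Rightarrow> (real^'n \<Rightarrow> real^'n^'n) \<Rightarrow>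
   (real^'n \<Rightarrow> complex \<Rightarrow> complex^('n option)^('n option)) \<Rightarrow> bool" where
  "frame_equation U h \<beta> F \<longleftrightarrow>
     (\<forall>u\<in>U. \<forall>z. invertible (F u z) \<and>
        ((\<lambda>x. F x z) has_derivative (\<lambda>v. F u z ** frame_form (h u) (\<beta> u) z v)) (at u))"

definition mat_holomorphic_on :: "(complex \<Rightarrow> complex^'m::finite^'m) \<Rightarrow> complex set \<Rightarrow> bool" where
  "mat_holomorphic_on M S \<longleftrightarrow> (\<forall>i j. (\<lambda>z. M z $ i $ j) holomorphic_on S)"

definition extended_frame ::
  "(real^'n::finite) set \<Rightarrow> (real^'n \<Rightarrow> real^'n) \<Rightarrow>
   (real^'n \<Rightarrow> complex \<Rightarrow> complex^('n option)^('n option)) \<Rightarrow> bool" where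
  "extended_frame U h F \<longleftrightarrow>
     (\<forall>u\<in>U. mat_holomorphic_on (F u) UNIV) \<and>
     (\<forall>z. F 0 z = mat 1) \<and>
     frame_equation U h (rotation_coeffs h) F"


section \<open>Flat Lagrangian immersions\<close>

abbreviation differential ::
  "(real^'n::finite \<Rightarrow> complex^'n) \<Rightarrow> real^'n \<Rightarrow> real^'n \<Rightarrow> complex^'n" where
  "differential f u \<equiv> frechet_derivative f (at u)"

text \<open>The inner product of \<open>complex^'n\<close> is that of \<open>\<real>\<^sup>2\<^sup>n\<close>.\<close>

definition first_fundamental_form ::
  "(real^'n::finite \<Rightarrow> complex^'n) \<Rightarrow> real^'n \<Rightarrow> real^'n^'n" where
  "first_fundamental_form f u = (\<chi> i j. partial_deriv i f u \<bullet> partial_deriv j f u)"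

text \<open>The normal component of the second derivative of \<open>f\<close>.\<close>

definition second_fundamental_form ::
  "(real^'n::finite \<Rightarrow> complex^'n) \<Rightarrow> real^'n \<Rightarrow> real^'n \<Rightarrow> real^'n \<Rightarrow> complex^'n" where
  "second_fundamental_form f u v w =
     (THE N. (\<forall>x. differential f u x \<bullet> N = 0) \<and>
             frechet_derivative (\<lambda>y. differential f y w) (at u) v - N \<in> range (differential f u))"

definition immersion_on :: "(real^'n::finite) set \<Rightarrow> (real^'n \<Rightarrow> complex^'n) \<Rightarrow> bool" where
  "immersion_on U f \<longleftrightarrow> smooth_on U f \<and> (\<forall>u\<in>U. inj (differential f u))"

definition lagrangian_on :: "(real^'n::finite) set \<Rightarrow> (real^'n \<Rightarrow> complex^'n) \<Rightarrow> bool" where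
  "lagrangian_on U f \<longleftrightarrow>
     (\<forall>u\<in>U. \<forall>v w. Im (\<Sum>k\<in>UNIV. cnj (differential f u v $ k) * differential f u w $ k) = 0)"

definition flat_lagrangian_immersion ::
  "(real^'n::finite) set \<Rightarrow> (real^'n \<Rightarrow> complex^'n) \<Rightarrow> bool" where
  "flat_lagrangian_immersion U f \<longleftrightarrow>
     immersion_on U f \<and> lagrangian_on U f \<and> flat_metric U (first_fundamental_form f)"

definition flat_lagrangian_family ::
  "(real^'n::finite) set \<Rightarrow> (real^'n \<Rightarrow> real^'n) \<Rightarrow> (real^'n \<Rightarrow> complex \<Rightarrow> complex^'n) \<Rightarrow> bool" where
  "flat_lagrangian_family U h X \<longleftrightarrow>
     (\<forall>z::real. z \<noteq> 0 \<longrightarrow>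
        (let f = (\<lambda>u. X u (complex_of_real z)) in
           flat_lagrangian_immersion U f \<and>
           (\<forall>u\<in>U. first_fundamental_form f u = diag_metric h u) \<and>
           (\<forall>u\<in>U. \<forall>v w. second_fundamental_form f u v w =
              z *\<^sub>R (\<Sum>i\<in>UNIV. (v $ i * w $ i) *\<^sub>R (\<i> *s partial_deriv i f u)))))"


section \<open>Dressing\<close>

definition hermitian_projection :: "complex^'n::finite^'n \<Rightarrow> bool" where
  "hermitian_projection P \<longleftrightarrow> P ** P = P \<and> transpose (map_matrix cnj P) = P"

definition hermitian_projection_onto :: "(complex^'n::finite) set \<Rightarrow> complex^'n^'n" where
  "hermitian_projection_onto W = (THE P. hermitian_projection P \<and> range ((*v) P) = W)"

definition g_simple :: "complex \<Rightarrow> complex^'n::finite^'n \<Rightarrow> complex \<Rightarrow> complex^'n^'n" where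
  "g_simple w P z = P + mat ((z - cnj w) / (z - w)) ** (mat 1 - P)"

text \<open>\<open>g_ext \<alpha> P\<close> is \<open>g\<close> with subscripts \<open>\<i>\<alpha>\<close>, \<open>-\<i>\<alpha>\<close>, \<open>P'\<close>.\<close>

definition g_ext ::
  "real \<Rightarrow> complex^'n::finite^'n \<Rightarrow> complex \<Rightarrow> complex^('n option)^('n option)" where
  "g_ext \<alpha> P z = upper_block (g_simple (\<i> * of_real \<alpha>) P z) 0
                     ((z + \<i> * of_real \<alpha>) / (z - \<i> * of_real \<alpha>))"

text \<open>Holomorphic near \<open>\<infinity>\<close> with value \<open>C\<close> at \<open>\<infinity>\<close>, in the chart \<open>w = 1/z\<close>.\<close>

definition mat_holomorphic_near_infinity ::
  "(complex \<Rightarrow> complex^'m::finite^'m) \<Rightarrow> complex^'m^'m \<Rightarrow> bool" where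
  "mat_holomorphic_near_infinity M C \<longleftrightarrow>
     (\<exists>r>0. mat_holomorphic_on (\<lambda>w. if w = 0 then C else M (1 / w)) (ball 0 r))"

text \<open>\<open>F'\<close> is the result of the dressing action of \<open>G\<close> on \<open>F\<close>. Both \<open>G\<close> and \<open>g'\<close> are germs at
  \<open>\<infinity>\<close>, so the factorization \<open>G F = F' g'\<close> is an identity near \<open>\<infinity>\<close>.\<close>

definition dressing ::
  "(real^'n::finite) set \<Rightarrow> (complex \<Rightarrow> complex^('n option)^('n option)) \<Rightarrow>
   (real^'n \<Rightarrow> complex \<Rightarrow> complex^('n option)^('n option)) \<Rightarrow>
   (real^'n \<Rightarrow> complex \<Rightarrow> complex^('n option)^('n option)) \<Rightarrow> bool" where
  "dressing U G F F' \<longleftrightarrow>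
     (\<forall>u\<in>U. mat_holomorphic_on (F' u) UNIV \<and>
        (\<exists>g'. mat_holomorphic_near_infinity g' (mat 1) \<and>
              (\<forall>\<^sub>F z in at_infinity. G z ** F u z = F' u z ** g' z)))"

definition off_diagonal :: "complex^'n::finite^'n \<Rightarrow> complex^'n^'n" where
  "off_diagonal A = (\<chi> i j. if i = j then 0 else A $ i $ j)"

end

theory Submission
  imports Defs "HOL-Complex_Analysis.Cauchy_Integral_Formula"
begin

text \<open>
  Write \<open>w = \<i>\<alpha>\<close>, \<open>K = 2w/(z - w)\<close>, \<open>L = 2w/(z + w)\<close> and \<open>y = \<pi>t \<eta>\<close>. Dressing multiplies the
  frame on the left by a constant loop with a pole at \<open>w\<close> and must compensate on the right by a
  loop depending on \<open>u\<close>. Dividing out the scalar \<open>(z + w)/(z - w)\<close>, the result is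
  \<open>Et = (1 - L \<pi>) E (1 + K \<pi>t)\<close> and \<open>Xt = (1 - L \<pi>) (X + K E y)\<close>.
  Since \<open>K - L = K L\<close>, these are \<open>E + K (1 - \<pi>) E \<pi>t - L \<pi> E (1 - \<pi>t)\<close> and
  \<open>X + K (1 - \<pi>) E y - L \<pi> (X - E y)\<close>, so that only two pairs of residues have to vanish. At \<open>w\<close>
  they do because \<open>E(w)\<close> maps the image of \<open>\<pi>t\<close> into that of \<open>\<pi>\<close>; at \<open>- w\<close> they do for the same
  reason, transposed, because the transpose of \<open>E(- z)\<close> is the inverse of \<open>E(z)\<close>, and because
  \<open>X(- w) = E(- w) \<eta>\<close>. The transposed frame is the inverse because \<open>\<beta>\<close> is symmetric, which is the
  Egoroff condition. Hence \<open>Et\<close> and \<open>Xt\<close> are entire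
  (\<open>residues\<close>, \<open>Et_closed\<close>, \<open>Xt_closed\<close>); replacing the polar terms by difference quotients
  makes sense of the formulas at \<open>z = w\<close> and \<open>z = - w\<close>.

  The new frame equation is a gauge transformation by \<open>1 + K \<pi>t\<close>. It needs the derivative of the
  moving projection, \<open>d\<pi>t = \<alpha> (\<delta> \<pi>t + \<pi>t \<delta> - 2 \<pi>t \<delta> \<pi>t) + [\<pi>t, [\<delta>, \<beta>]]\<close> (\<open>P_derivative\<close>), and
  that of \<open>y\<close>; the rest is the relation \<open>\<i> z K = - 2\<alpha> - \<alpha> K\<close> (\<open>darboux_matrix_identity\<close>,
  \<open>darboux_vector_identity\<close>). At the two exceptional values of \<open>z\<close> the equation is obtained as a
  limit (\<open>frame_derivative_limit\<close>). The same derivatives give the potential and the rotation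
  coefficients. Uniqueness of the factorization is Liouville's theorem applied to the quotient of
  two solutions (\<open>entire_factor_trivial\<close>).

  For real \<open>z\<close> the matrix \<open>Et\<close> is unitary, again by the symmetry of the new rotation coefficients,
  and the geometry follows from \<open>dXt = Et \<delta> ht\<close> and \<open>dEt = Et (\<i> z \<delta> + [\<delta>, \<beta>t])\<close>: the
  term \<open>\<i> z \<delta>\<close> contributes the normal part of the second derivatives of \<open>Xt\<close>, the bracket and the
  derivative of \<open>ht\<close> the tangential part. For
  \<open>z = 0\<close> the normal part is absent, and an immersion whose second derivatives are tangential
  induces a flat metric (\<open>riemann_zero_of_tangential\<close>).
\<close>

section \<open>Matrix algebra\<close>

declare transpose_matrix_vector [simp del]

text \<open>Multiplication by a complex scalar. It replaces products with \<open>mat c\<close>, which would have to be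
  commuted through every expression.\<close>

definition smat :: "complex \<Rightarrow> complex^'n^'m \<Rightarrow> complex^'n^'m" where
  "smat c A = (\<chi> i j. c * A $ i $ j)"

lemma smat_nth [simp]: "smat c A $ i $ j = c * A $ i $ j"
  by (simp add: smat_def)

lemma mat_mult_eq_smat: "mat c ** A = smat c A" for A :: "complex^'n^'m"
  by (simp add: vec_eq_iff matrix_matrix_mult_def mat_def if_distribR if_distrib cong: if_cong)

lemma matrix_sub_ldistrib': "A ** (B - C) = A ** B - A ** C" for A :: "complex^'n^'m"
  by (simp add: vec_eq_iff matrix_matrix_mult_def algebra_simps sum_subtractf)

lemma matrix_sub_rdistrib': "(A - B) ** C = A ** C - B ** C" for A :: "complex^'n^'m"
  by (simp add: vec_eq_iff matrix_matrix_mult_def algebra_simps sum_subtractf)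

lemma matrix_add_rdistrib': "(A + B) ** C = A ** C + B ** C" for A :: "complex^'n^'m"
  by (simp add: vec_eq_iff matrix_matrix_mult_def algebra_simps sum.distrib)

lemma matrix_minus_left: "(- A) ** C = - (A ** C)" for A :: "complex^'n^'m"
  by (simp add: vec_eq_iff matrix_matrix_mult_def sum_negf)

lemma matrix_minus_right: "A ** (- C) = - (A ** C)" for A :: "complex^'n^'m"
  by (simp add: vec_eq_iff matrix_matrix_mult_def sum_negf)

lemma matrix_zero_left: "0 ** C = (0 :: complex^'n^'m)" 
  by (simp add: vec_eq_iff matrix_matrix_mult_def)

lemma matrix_zero_right: "A ** 0 = (0 :: complex^'n^'m)" 
  by (simp add: vec_eq_iff matrix_matrix_mult_def)

lemma smat_mult_left: "smat c A ** B = smat c (A ** B)"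
  by (simp add: vec_eq_iff matrix_matrix_mult_def sum_distrib_left mult_ac)

lemma smat_mult_right: "A ** smat c B = smat c (A ** B)"
  by (simp add: vec_eq_iff matrix_matrix_mult_def sum_distrib_left mult_ac)

lemma smat_add: "smat c (A + B) = smat c A + smat c B"
  by (simp add: vec_eq_iff algebra_simps)

lemma smat_diff: "smat c (A - B) = smat c A - smat c B"
  by (simp add: vec_eq_iff algebra_simps)

lemma smat_minus: "smat c (- A) = smat (- c) A"
  by (simp add: vec_eq_iff algebra_simps)

lemma smat_smat: "smat c (smat d A) = smat (c * d) A"
  by (simp add: vec_eq_iff algebra_simps)

lemma smat_one: "smat 1 A = A" by (simp add: vec_eq_iff)

lemma smat_zero: "smat 0 A = 0" by (simp add: vec_eq_iff)

lemma smat_zero_right: "smat c 0 = 0" by (simp add: vec_eq_iff)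

lemma matvec_minus_left: "(- A) *v x = - (A *v x)" for A :: "complex^'n^'m"
  by (simp add: vec_eq_iff matrix_vector_mult_def sum_negf)

lemma matvec_minus_right: "A *v (- x) = - (A *v x)" for A :: "complex^'n^'m"
  by (simp add: vec_eq_iff matrix_vector_mult_def sum_negf)

lemma smat_matvec: "smat c A *v x = c *s (A *v x)"
  by (simp add: vec_eq_iff matrix_vector_mult_def sum_distrib_left mult_ac)

lemma matvec_smult: "A *v (c *s x) = c *s (A *v x)" for A :: "complex^'n^'m"
  by (simp add: vec_eq_iff matrix_vector_mult_def sum_distrib_left mult_ac)

lemma smult_add: "c *s (x + y) = c *s x + c *s y" for x :: "complex^'n"
  by (simp add: vec_eq_iff algebra_simps)

lemma smult_diff: "c *s (x - y) = c *s x - c *s y" for x :: "complex^'n"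
  by (simp add: vec_eq_iff algebra_simps)

lemma smult_minus: "c *s (- y) = (- c) *s y" for y :: "complex^'n"
  by (simp add: vec_eq_iff algebra_simps)

lemma smult_smult: "c *s (d *s y) = (c * d) *s y" for y :: "complex^'n"
  by (simp add: vec_eq_iff algebra_simps)

text \<open>These rules expand an expression of the noncommutative algebra of matrices into a sum of scaled
  monomials. An identity between such expressions is then decided entrywise, by linear arithmetic
  in the entries of the monomials.\<close>

lemmas mat_simps = matrix_add_ldistrib matrix_add_rdistrib' matrix_sub_ldistrib'
  matrix_sub_rdistrib' matrix_minus_left matrix_minus_right matrix_zero_left matrix_zero_right
  smat_mult_left smat_mult_right smat_add smat_diff smat_minus smat_smat smat_one smat_zero
  smat_zero_right matrix_mul_assoc [symmetric] mat_mult_eq_smat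
  matrix_vector_mul_assoc [symmetric] matrix_vector_right_distrib matrix_vector_mult_diff_distrib
  matrix_vector_mult_add_rdistrib matrix_vector_mult_diff_rdistrib matvec_minus_left
  matvec_minus_right smat_matvec matvec_smult smult_add smult_diff smult_minus smult_smult

abbreviation cnjm :: "complex^'n^'m \<Rightarrow> complex^'n^'m" where "cnjm \<equiv> map_matrix cnj"

abbreviation cnjv :: "complex^'n \<Rightarrow> complex^'n" where "cnjv x \<equiv> (\<chi> i. cnj (x $ i))"

lemma map_matrix_nth [simp]: "map_matrix f A $ i $ j = f (A $ i $ j)"
  by (simp add: map_matrix_def)

lemma transpose_nth: "transpose A $ i $ j = A $ j $ i"
  by (simp add: transpose_def)

lemma transpose_add: "transpose (A + B) = transpose A + transpose B"
  by (simp add: vec_eq_iff transpose_nth)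

lemma transpose_diff: "transpose (A - B) = transpose A - transpose B"
  by (simp add: vec_eq_iff transpose_nth)

lemma transpose_minus: "transpose (- B) = - transpose B"
  by (simp add: vec_eq_iff transpose_nth)

lemma transpose_smat: "transpose (smat c B) = smat c (transpose B)"
  by (simp add: vec_eq_iff transpose_nth)

lemmas transpose_simps = transpose_add transpose_diff transpose_minus transpose_smat
  matrix_transpose_mul

lemma cnjm_mult: "cnjm (A ** B) = cnjm A ** cnjm B"
  by (simp add: vec_eq_iff matrix_matrix_mult_def)

lemma cnjm_add: "cnjm (A + B) = cnjm A + cnjm B" by (simp add: vec_eq_iff)

lemma cnjm_diff: "cnjm (A - B) = cnjm A - cnjm B" by (simp add: vec_eq_iff)

lemma cnjm_smat: "cnjm (smat c A) = smat (cnj c) (cnjm A)" by (simp add: vec_eq_iff)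

lemma cnjm_mat: "cnjm (mat c) = mat (cnj c)" by (simp add: vec_eq_iff mat_def)

lemma cnjm_transpose: "cnjm (transpose A) = transpose (cnjm A)"
  by (simp add: vec_eq_iff transpose_nth)

lemma cnjm_cnjm [simp]: "cnjm (cnjm A) = A" by (simp add: vec_eq_iff)

lemma cnjv_matvec: "cnjv (A *v x) = cnjm A *v cnjv x"
  by (simp add: vec_eq_iff matrix_vector_mult_def)

lemma cnjm_cmat [simp]: "cnjm (cmat A) = cmat A" by (simp add: vec_eq_iff)

lemmas cnjm_simps = cnjm_mult cnjm_add cnjm_diff cnjm_smat cnjm_mat cnjm_transpose

lemma bounded_bilinear_matrix_mult:
  "bounded_bilinear (\<lambda>(A :: 'a::{euclidean_space,real_algebra_1}^'n^'m) (B :: 'a^'p^'n). A ** B)"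
  unfolding bilinear_conv_bounded_bilinear [symmetric] bilinear_def
  by (intro conjI allI linearI)
    (simp_all add: vec_eq_iff matrix_matrix_mult_def algebra_simps sum.distrib scaleR_sum_right)

lemma bounded_bilinear_matrix_vector:
  "bounded_bilinear ((*v) :: 'a::{euclidean_space,real_algebra_1}^'n^'m \<Rightarrow> 'a^'n \<Rightarrow> _)"
  unfolding bilinear_conv_bounded_bilinear [symmetric] bilinear_def
  by (intro conjI allI linearI)
    (simp_all add: vec_eq_iff matrix_vector_mult_def algebra_simps sum.distrib scaleR_sum_right)

lemma bounded_linear_transpose: "bounded_linear (transpose :: complex^'n^'m \<Rightarrow> _)"
  unfolding linear_conv_bounded_linear [symmetric]
  by (rule linearI) (simp_all add: vec_eq_iff transpose_nth)

lemma bounded_linear_cnjm: "bounded_linear (cnjm :: complex^'n^'m \<Rightarrow> _)"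
  unfolding linear_conv_bounded_linear [symmetric]
  by (rule linearI) (simp_all add: vec_eq_iff)

lemma bounded_linear_cnjv: "bounded_linear (cnjv :: complex^'m \<Rightarrow> _)"
  unfolding linear_conv_bounded_linear [symmetric]
  by (rule linearI) (simp_all add: vec_eq_iff)

lemma bounded_linear_smat: "bounded_linear (smat c :: complex^'n^'m \<Rightarrow> _)"
  unfolding linear_conv_bounded_linear [symmetric]
  by (rule linearI) (simp_all add: vec_eq_iff algebra_simps)

lemma bounded_linear_delta: "bounded_linear (delta :: real^'n \<Rightarrow> _)"
  unfolding linear_conv_bounded_linear [symmetric]
  by (rule linearI) (simp_all add: vec_eq_iff delta_def, simp add: scaleR_conv_of_real)

lemma bounded_linear_cvec: "bounded_linear (cvec :: real^'m \<Rightarrow> _)"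
  unfolding linear_conv_bounded_linear [symmetric]
  by (rule linearI) (simp_all add: vec_eq_iff, simp add: scaleR_conv_of_real)

lemma bounded_linear_cmat: "bounded_linear (cmat :: real^'n^'m \<Rightarrow> _)"
  unfolding linear_conv_bounded_linear [symmetric]
  by (rule linearI) (simp_all add: vec_eq_iff, simp add: scaleR_conv_of_real)

lemmas matrix_has_derivative =
  bounded_bilinear.FDERIV [OF bounded_bilinear_matrix_mult]

lemmas matvec_has_derivative =
  bounded_bilinear.FDERIV [OF bounded_bilinear_matrix_vector]

lemma transpose_delta [simp]: "transpose (delta v) = delta v"
  by (simp add: vec_eq_iff transpose_nth delta_def)

lemma cnjm_delta [simp]: "cnjm (delta v) = delta v"
  by (simp add: vec_eq_iff delta_def)

lemma delta_matvec: "(delta v *v x) $ i = of_real (v $ i) * x $ i"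
  by (simp add: delta_def matrix_vector_mult_def mult_delta_left)

lemma delta_mult_nth: "(delta v ** A) $ i $ j = of_real (v $ i) * A $ i $ j"
  by (simp add: delta_def matrix_matrix_mult_def mult_delta_left)

lemma mult_delta_nth: "(A ** delta v) $ i $ j = A $ i $ j * of_real (v $ j)"
  by (simp add: delta_def matrix_matrix_mult_def mult_delta_right)

lemma bounded_linear_smult: "bounded_linear (\<lambda>x :: complex^'n. c *s x)"
  unfolding linear_conv_bounded_linear [symmetric]
  by (rule linearI) (simp_all add: vec_eq_iff algebra_simps)

lemma matrix_inv_eq: 
  fixes A B :: "complex^'n^'n" assumes "A ** B = mat 1" shows "matrix_inv A = B"
proof -
  have "A ** matrix_inv A = mat 1 \<and> matrix_inv A ** A = mat 1"
    unfolding matrix_inv_def using assms matrix_left_right_inverse[of A B] by (metis (mono_tags, lifting) someI_ex)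
  then show ?thesis using assms by (metis matrix_mul_assoc matrix_mul_lid matrix_mul_rid)
qed

text \<open>The complex bilinear pairing, without conjugation: transposes, not adjoints, are the adjoints
  with respect to it.\<close>

definition dot :: "complex^'n \<Rightarrow> complex^'n \<Rightarrow> complex" where
  "dot x z = (\<Sum>i\<in>UNIV. x $ i * z $ i)"

lemma bounded_bilinear_dot: "bounded_bilinear (dot :: complex^'n \<Rightarrow> _)"
  unfolding bilinear_conv_bounded_bilinear [symmetric] bilinear_def
  by (intro conjI allI linearI)
    (simp_all add: dot_def algebra_simps sum.distrib scaleR_sum_right)

lemma dot_commute: "dot x z = dot z x" by (simp add: dot_def mult.commute)

lemma dot_add: "dot x (z + z') = dot x z + dot x z'" "dot (x + x') z = dot x z + dot x' z"
  by (simp_all add: dot_def algebra_simps sum.distrib)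

lemma dot_diff: "dot x (z - z') = dot x z - dot x z'" "dot (x - x') z = dot x z - dot x' z"
  by (simp_all add: dot_def algebra_simps sum_subtractf)

lemma dot_minus: "dot x (- z) = - dot x z" "dot (- x) z = - dot x z"
  by (simp_all add: dot_def sum_negf)

lemma dot_smult: "dot x (c *s z) = c * dot x z" "dot (c *s x) z = c * dot x z"
  by (simp_all add: dot_def sum_distrib_left mult_ac)

lemma dot_matvec: "dot (M *v x) z = dot x (transpose M *v z)"
proof -
  have "dot (M *v x) z = (\<Sum>i\<in>UNIV. \<Sum>j\<in>UNIV. M $ i $ j * x $ j * z $ i)"
    by (simp add: dot_def matrix_vector_mult_def sum_distrib_right)
  also have "\<dots> = (\<Sum>j\<in>UNIV. \<Sum>i\<in>UNIV. M $ i $ j * x $ j * z $ i)" by (rule sum.swap)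
  also have "\<dots> = dot x (transpose M *v z)"
    by (simp add: dot_def matrix_vector_mult_def transpose_nth sum_distrib_left mult_ac)
  finally show ?thesis .
qed

lemma matvec_delta_axis: "(M *v (delta (axis j 1) *v x)) $ i = M $ i $ j * x $ j"
proof -
  have "(M *v (delta (axis j 1) *v x)) $ i = (\<Sum>k\<in>UNIV. if k = j then M $ i $ j * x $ j else 0)"
  proof -
    have "M $ i $ k * (of_real (axis j 1 $ k) * x $ k) = (if k = j then M $ i $ j * x $ j else 0)" for k
      by (simp add: axis_def)
    then show ?thesis by (simp add: matrix_vector_mult_def[of M] delta_matvec)
  qed
  then show ?thesis by simp
qed

text \<open>The real vector field behind \<open>delta v *v cvec x\<close>. Keeping it folded shows which vectors are real.\<close>

definition hadamard :: "real^'n \<Rightarrow> real^'n \<Rightarrow> real^'n" where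
  "hadamard v x = (\<chi> i. v $ i * x $ i)"

lemma hadamard_nth: "hadamard v x $ i = v $ i * x $ i" by (simp add: hadamard_def)

lemma delta_cvec: "delta v *v cvec x = cvec (hadamard v x)"
  by (simp add: vec_eq_iff delta_matvec hadamard_nth)

section \<open>Smooth functions\<close>

lemma Ck_on_cong:
  assumes "open U"
  shows "(\<And>u. u \<in> U \<Longrightarrow> f u = g u) \<Longrightarrow> Ck_on k U f \<Longrightarrow> Ck_on k U g"
proof (induction k arbitrary: f g)
  case 0
  then show ?case by (simp add: continuous_on_eq)
next
  case (Suc k)
  have df: "(g has_derivative frechet_derivative f (at u)) (at u)" if "u \<in> U" for u
  proof (rule has_derivative_transform_within_open[OF _ assms that])
    have "f differentiable (at u within U)"
      using Suc.prems(2) that by (simp add: differentiable_on_def)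
    then show "(f has_derivative frechet_derivative f (at u)) (at u)"
      unfolding at_within_open[OF that assms] frechet_derivative_works .
  qed (use Suc.prems in auto)
  have "g differentiable_on U"
    unfolding differentiable_on_def
    using df by (blast intro: differentiableI differentiable_at_withinI)
  moreover have "Ck_on k U (\<lambda>u. frechet_derivative g (at u) v)" for v
    by (rule Suc.IH[of "\<lambda>u. frechet_derivative f (at u) v"])
      (use Suc.prems(2) frechet_derivative_at[OF df] in auto)
  ultimately show ?case by simp
qed

text \<open>The definition of \<open>Ck_on\<close> refers to the Frechet derivative chosen by \<open>frechet_derivative\<close>; with
  this rule any known derivative serves instead.\<close>

lemma Ck_on_SucI:
  assumes "open U" and df: "\<And>u. u \<in> U \<Longrightarrow> (f has_derivative f' u) (at u)"
    and "\<And>v. Ck_on k U (\<lambda>u. f' u v)"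
  shows "Ck_on (Suc k) U f"
proof -
  have "f differentiable_on U"
    unfolding differentiable_on_def
    using df by (blast intro: differentiableI differentiable_at_withinI)
  moreover have "Ck_on k U (\<lambda>u. frechet_derivative f (at u) v)" for v
    by (rule Ck_on_cong[OF assms(1) _ assms(3)[of v]]) (simp add: frechet_derivative_at[OF df, symmetric])
  ultimately show ?thesis by simp
qed

lemma Ck_on_SucD:
  assumes "open U" "Ck_on (Suc k) U f" "u \<in> U"
  shows "(f has_derivative frechet_derivative f (at u)) (at u)"
proof -
  have "f differentiable (at u within U)"
    using assms by (simp add: differentiable_on_def)
  then show ?thesis
    unfolding at_within_open[OF assms(3,1)] frechet_derivative_works .
qed

lemma Ck_on_Suc_imp: "open U \<Longrightarrow> Ck_on (Suc k) U f \<Longrightarrow> Ck_on k U f"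
proof (induction k arbitrary: f)
  case 0
  then show ?case by (simp add: differentiable_imp_continuous_on)
next
  case (Suc k)
  show ?case
    by (rule Ck_on_SucI[OF Suc.prems(1) Ck_on_SucD[OF Suc.prems]], assumption,
        rule Suc.IH[OF Suc.prems(1)]) (use Suc.prems(2) in simp)
qed

lemma Ck_on_const: "open U \<Longrightarrow> Ck_on k U (\<lambda>u. c)"
proof (induction k arbitrary: c)
  case (Suc k)
  show ?case by (rule Ck_on_SucI[where f' = "\<lambda>u v. 0"]) (use Suc in auto)
qed simp

lemma Ck_on_bounded_linear:
  assumes "bounded_linear L" "open U"
  shows "Ck_on k U f \<Longrightarrow> Ck_on k U (\<lambda>u. L (f u))"
proof (induction k arbitrary: f)
  case 0
  then show ?case using bounded_linear.continuous_on[OF assms(1)] by auto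
next
  case (Suc k)
  show ?case
    by (rule Ck_on_SucI[OF assms(2) bounded_linear.has_derivative[OF assms(1) Ck_on_SucD[OF assms(2) Suc.prems]]])
      (use Suc in auto)
qed

lemma Ck_on_add:
  assumes "open U"
  shows "Ck_on k U f \<Longrightarrow> Ck_on k U g \<Longrightarrow> Ck_on k U (\<lambda>u. f u + g u)"
proof (induction k arbitrary: f g)
  case 0
  then show ?case by (simp add: continuous_on_add)
next
  case (Suc k)
  show ?case
    by (rule Ck_on_SucI[OF assms has_derivative_add[OF Ck_on_SucD[OF assms Suc.prems(1)] Ck_on_SucD[OF assms Suc.prems(2)]]])
      (use Suc in auto)
qed

lemma Ck_on_bilinear:
  assumes "bounded_bilinear pr" "open U"
  shows "Ck_on k U f \<Longrightarrow> Ck_on k U g \<Longrightarrow> Ck_on k U (\<lambda>u. pr (f u) (g u))"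
proof (induction k arbitrary: f g)
  case 0
  then show ?case using bounded_bilinear.continuous_on[OF assms(1)] by auto
next
  case (Suc k)
  have "Ck_on k U f" "Ck_on k U g" using Suc.prems Ck_on_Suc_imp[OF assms(2)] by auto
  then show ?case
    by (intro Ck_on_SucI[OF assms(2) bounded_bilinear.FDERIV[OF assms(1) Ck_on_SucD[OF assms(2) Suc.prems(1)] Ck_on_SucD[OF assms(2) Suc.prems(2)]]] Ck_on_add assms(2) Suc.IH)
      (use Suc in auto)
qed

lemma Ck_on_inverse:
  fixes f :: "'a::real_normed_vector \<Rightarrow> real"
  assumes "open U" "\<And>u. u \<in> U \<Longrightarrow> f u \<noteq> 0"
  shows "Ck_on k U f \<Longrightarrow> Ck_on k U (\<lambda>u. inverse (f u))"
proof (induction k)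
  case 0
  then show ?case using assms by (auto intro: continuous_on_inverse)
next
  case (Suc k)
  have k: "Ck_on k U f" using Suc.prems Ck_on_Suc_imp[OF assms(1)] by auto
  note i = Suc.IH[OF k]
  note m = Ck_on_bilinear[OF bounded_bilinear_mult assms(1)]
  note b = Ck_on_bounded_linear[OF bounded_linear_minus[OF bounded_linear_ident] assms(1)]
  have d: "Ck_on k U (\<lambda>u. frechet_derivative f (at u) v)" for v
    using Suc.prems by simp
  show ?case
    by (rule Ck_on_SucI[OF assms(1) Deriv.has_derivative_inverse[OF assms(2) Ck_on_SucD[OF assms(1) Suc.prems]]],
        assumption, assumption, rule b[OF m[OF m[OF i d] i]])
qed

named_theorems smooth_intros

lemma smooth_onD: "smooth_on U f \<Longrightarrow> Ck_on k U f" by (simp add: smooth_on_def)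

lemma smooth_on_cong: "open U \<Longrightarrow> smooth_on U f \<Longrightarrow> (\<And>u. u \<in> U \<Longrightarrow> f u = g u) \<Longrightarrow> smooth_on U g"
  unfolding smooth_on_def using Ck_on_cong by blast

lemma smooth_on_const [smooth_intros]: "open U \<Longrightarrow> smooth_on U (\<lambda>u. c)"
  by (simp add: smooth_on_def Ck_on_const)

lemma smooth_on_bounded_linear: "bounded_linear L \<Longrightarrow> open U \<Longrightarrow> smooth_on U f \<Longrightarrow> smooth_on U (\<lambda>u. L (f u))"
  by (simp add: smooth_on_def Ck_on_bounded_linear)

lemma smooth_on_bilinear:
  "bounded_bilinear pr \<Longrightarrow> open U \<Longrightarrow> smooth_on U f \<Longrightarrow> smooth_on U g \<Longrightarrow> smooth_on U (\<lambda>u. pr (f u) (g u))"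
  by (simp add: smooth_on_def Ck_on_bilinear)

lemma smooth_on_add [smooth_intros]:
  "open U \<Longrightarrow> smooth_on U f \<Longrightarrow> smooth_on U g \<Longrightarrow> smooth_on U (\<lambda>u. f u + g u)"
  by (simp add: smooth_on_def Ck_on_add)

lemma smooth_on_inverse [smooth_intros]:
  "open U \<Longrightarrow> smooth_on U f \<Longrightarrow> (\<And>u. u \<in> U \<Longrightarrow> f u \<noteq> 0) \<Longrightarrow> smooth_on U (\<lambda>u. inverse (f u) :: real)"
  by (simp add: smooth_on_def Ck_on_inverse)

lemma smooth_on_diff [smooth_intros]:
  assumes "open U" "smooth_on U f" "smooth_on U g" shows "smooth_on U (\<lambda>u. f u - g u)"
  using smooth_on_add[OF assms(1,2) smooth_on_bounded_linear[OF bounded_linear_minus[OF bounded_linear_ident] assms(1,3)]]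
  by simp

lemma smooth_on_sum [smooth_intros]:
  assumes "open U" "\<And>i. i \<in> I \<Longrightarrow> smooth_on U (f i)" shows "smooth_on U (\<lambda>u. \<Sum>i\<in>I. f i u)"
  using assms(2)
proof (induction I rule: infinite_finite_induct)
  case (insert i I)
  then show ?case using smooth_on_add[OF assms(1), of "f i" "\<lambda>u. \<Sum>i\<in>I. f i u"] by auto
qed (simp_all add: smooth_on_const assms(1))

lemma smooth_on_vec:
  assumes "open U" "\<And>i. smooth_on U (\<lambda>u. f u i)"
  shows "smooth_on U (\<lambda>u. (\<chi> i. f u i) :: 'b::euclidean_space^'n::finite)"
proof -
  have "(\<chi> i. f u i) = (\<Sum>i\<in>UNIV. axis i (f u i))" for u
    by (simp add: vec_eq_iff axis_def if_distrib cong: if_cong)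
  moreover have "bounded_linear (axis i :: 'b \<Rightarrow> 'b^'n)" for i
    unfolding linear_conv_bounded_linear [symmetric]
    by (rule linearI) (simp_all add: vec_eq_iff axis_def)
  then have "smooth_on U (\<lambda>u. axis i (f u i) :: 'b^'n)" for i
    by (rule smooth_on_bounded_linear[OF _ assms])
  then have "smooth_on U (\<lambda>u. \<Sum>i\<in>UNIV. axis i (f u i) :: 'b^'n)"
    by (rule smooth_on_sum[OF assms(1)])
  ultimately show ?thesis by simp
qed

lemma smooth_on_nth: "open U \<Longrightarrow> smooth_on U f \<Longrightarrow> smooth_on U (\<lambda>u. f u $ i)"
  by (rule smooth_on_bounded_linear[OF bounded_linear_vec_nth])

lemma smooth_on_subset: "smooth_on U f \<Longrightarrow> open U \<Longrightarrow> V \<subseteq> U \<Longrightarrow> open V \<Longrightarrow> smooth_on V f"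
proof -
  have "Ck_on k U f \<Longrightarrow> V \<subseteq> U \<Longrightarrow> Ck_on k V f" for k
    by (induction k arbitrary: f) (auto intro: continuous_on_subset differentiable_on_subset)
  then show "smooth_on U f \<Longrightarrow> open U \<Longrightarrow> V \<subseteq> U \<Longrightarrow> open V \<Longrightarrow> smooth_on V f"
    by (auto simp: smooth_on_def)
qed

lemma smooth_on_has_derivative:
  "open U \<Longrightarrow> smooth_on U f \<Longrightarrow> u \<in> U \<Longrightarrow> (f has_derivative frechet_derivative f (at u)) (at u)"
  by (rule Ck_on_SucD[OF _ smooth_onD])

lemma smooth_on_frechet: "smooth_on U f \<Longrightarrow> smooth_on U (\<lambda>u. frechet_derivative f (at u) v)"
proof -
  assume a: "smooth_on U f"
  have "Ck_on (Suc k) U f" for k using a by (rule smooth_onD)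
  then show ?thesis by (simp add: smooth_on_def)
qed

lemma smooth_on_continuous: "smooth_on U f \<Longrightarrow> continuous_on U f"
  using smooth_onD[of U f 0] by simp

text \<open>Solutions of differential equations with smooth coefficients are smooth: if the derivative is as
  regular as the function itself, each \<open>C\<^sup>k\<close> step can be climbed.\<close>

lemma smooth_on_bootstrap:
  assumes "open U" "\<And>u. u \<in> U \<Longrightarrow> (f has_derivative f' u) (at u)"
    and "\<And>k v. Ck_on k U f \<Longrightarrow> Ck_on k U (\<lambda>u. f' u v)"
  shows "smooth_on U f"
proof -
  have "Ck_on k U f" for k
  proof (induction k)
    case 0
    show ?case
      using has_derivative_continuous[OF assms(2)] by (auto intro: continuous_at_imp_continuous_on)
  next
    case (Suc k)
    show ?case by (rule Ck_on_SucI[OF assms(1,2) assms(3)[OF Suc]])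
  qed
  then show ?thesis by (simp add: smooth_on_def)
qed

lemma Ck_on_diff:
  assumes "open U" "Ck_on k U f" "Ck_on k U g" shows "Ck_on k U (\<lambda>u. f u - g u)"
  using Ck_on_add[OF assms(1,2) Ck_on_bounded_linear[OF bounded_linear_minus[OF bounded_linear_ident] assms(1,3)]]
  by simp

lemmas Ck_matrix_intros = Ck_on_diff Ck_on_add Ck_on_const
  Ck_on_bilinear[OF bounded_bilinear_matrix_mult] Ck_on_bilinear[OF bounded_bilinear_matrix_vector]
  Ck_on_bounded_linear[OF bounded_linear_smat] Ck_on_bounded_linear[OF bounded_linear_smult]

section \<open>Symmetry of second derivatives\<close>

text \<open>Two applications of the mean value theorem to the second difference of \<open>f\<close> over a
  parallelogram. The difference is symmetric in \<open>v\<close> and \<open>w\<close>, while the mixed derivative on the right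
  is taken first along \<open>v\<close>; comparing the two orders gives the symmetry of second derivatives.\<close>

lemma second_difference_mvt:
  fixes f :: "'a::real_normed_vector \<Rightarrow> real"
  assumes U: "open U" and f: "smooth_on U f" and s: "s > 0"
    and sub: "\<And>a b. 0 \<le> a \<Longrightarrow> a \<le> s \<Longrightarrow> 0 \<le> b \<Longrightarrow> b \<le> s \<Longrightarrow> u + a *\<^sub>R v + b *\<^sub>R w \<in> U"
  obtains a b where "0 \<le> a" "a \<le> s" "0 \<le> b" "b \<le> s"
    "f (u + s *\<^sub>R v + s *\<^sub>R w) - f (u + s *\<^sub>R v) - f (u + s *\<^sub>R w) + f u
      = s * s * frechet_derivative (\<lambda>x. frechet_derivative f (at x) v) (at (u + a *\<^sub>R v + b *\<^sub>R w)) w"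
proof -
  define Dv where "Dv = (\<lambda>x. frechet_derivative f (at x) v)"
  have smooth_Dv: "smooth_on U Dv" unfolding Dv_def by (rule smooth_on_frechet[OF f])
  have line: "((\<lambda>a. g (p + a *\<^sub>R x)) has_real_derivative frechet_derivative g (at (p + a *\<^sub>R x)) x) (at a)"
    if "smooth_on U g" "p + a *\<^sub>R x \<in> U" for g :: "'a \<Rightarrow> real" and p x a
  proof -
    note d = smooth_on_has_derivative[OF U that]
    have "((\<lambda>a. p + a *\<^sub>R x) has_derivative (\<lambda>t. t *\<^sub>R x)) (at a)"
      by (auto intro!: derivative_eq_intros)
    from has_derivative_compose[OF this d]
    have "((\<lambda>a. g (p + a *\<^sub>R x)) has_derivative (\<lambda>t. frechet_derivative g (at (p + a *\<^sub>R x)) (t *\<^sub>R x))) (at a)" .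
    then show ?thesis
      unfolding has_field_derivative_def
      by (rule has_derivative_eq_rhs)
        (simp add: fun_eq_iff linear_cmul[OF has_derivative_linear[OF d]] mult.commute)
  qed
  have "((\<lambda>a. f (u + s *\<^sub>R w + a *\<^sub>R v) - f (u + a *\<^sub>R v)) has_real_derivative
      Dv (u + s *\<^sub>R w + a *\<^sub>R v) - Dv (u + a *\<^sub>R v)) (at a)" if "0 \<le> a" "a \<le> s" for a
    unfolding Dv_def
    by (intro DERIV_diff line f) (use sub[of a s] sub[of a 0] that s in \<open>auto simp: add_ac\<close>)
  from MVT2[OF s this] obtain a where a: "0 < a" "a < s"
    and eq1: "f (u + s *\<^sub>R w + s *\<^sub>R v) - f (u + s *\<^sub>R v) - (f (u + s *\<^sub>R w) - f u)
      = s * (Dv (u + s *\<^sub>R w + a *\<^sub>R v) - Dv (u + a *\<^sub>R v))" by auto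
  have "((\<lambda>b. Dv (u + a *\<^sub>R v + b *\<^sub>R w)) has_real_derivative
      frechet_derivative Dv (at (u + a *\<^sub>R v + b *\<^sub>R w)) w) (at b)" if "0 \<le> b" "b \<le> s" for b
    by (rule line[OF smooth_Dv]) (use sub[of a b] a that in auto)
  from MVT2[OF s this] obtain b where b: "0 < b" "b < s"
    and eq2: "Dv (u + a *\<^sub>R v + s *\<^sub>R w) - Dv (u + a *\<^sub>R v)
      = s * frechet_derivative Dv (at (u + a *\<^sub>R v + b *\<^sub>R w)) w" by auto
  show thesis
  proof (rule that[of a b])
    have "u + s *\<^sub>R w + a *\<^sub>R v = u + a *\<^sub>R v + s *\<^sub>R w" by simp
    then show "f (u + s *\<^sub>R v + s *\<^sub>R w) - f (u + s *\<^sub>R v) - f (u + s *\<^sub>R w) + f u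
      = s * s * frechet_derivative (\<lambda>x. frechet_derivative f (at x) v) (at (u + a *\<^sub>R v + b *\<^sub>R w)) w"
      using eq1 eq2 by (simp add: Dv_def[symmetric] add_ac mult.assoc)
  qed (use a b in auto)
qed

lemma symmetric_second_derivative_real:
  fixes f :: "'a::real_normed_vector \<Rightarrow> real"
  assumes U: "open U" and f: "smooth_on U f" and u: "u \<in> U"
  shows "frechet_derivative (\<lambda>x. frechet_derivative f (at x) v) (at u) w
       = frechet_derivative (\<lambda>x. frechet_derivative f (at x) w) (at u) v"
proof -
  define G where "G = (\<lambda>v w y. frechet_derivative (\<lambda>x. frechet_derivative f (at x) v) (at y) w)"
  have cont: "isCont (G v w) u" for v w
    using smooth_on_continuous[OF smooth_on_frechet[OF smooth_on_frechet[OF f]]] U u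
    unfolding G_def by (simp add: continuous_on_eq_continuous_at)
  have "\<bar>G v w u - G w v u\<bar> \<le> e" if e: "e > 0" for e
  proof -
    have "\<exists>d>0. \<forall>y. dist y u < d \<longrightarrow> dist (G v w y) (G v w u) < e / 2" for v w
      using cont[of v w] e unfolding continuous_at_eps_delta by (metis half_gt_zero)
    then obtain d1 d2 where d: "d1 > 0" "d2 > 0"
      and d1: "\<And>y. dist y u < d1 \<Longrightarrow> dist (G v w y) (G v w u) < e / 2"
      and d2: "\<And>y. dist y u < d2 \<Longrightarrow> dist (G w v y) (G w v u) < e / 2" by metis
    obtain d3 where d3: "d3 > 0" "ball u d3 \<subseteq> U" using U u by (meson open_contains_ball)
    define r where "r = min d1 (min d2 d3)"
    \<comment> \<open>The parallelogram spanned by \<open>s v\<close> and \<open>s w\<close> stays within distance \<open>r\<close> of \<open>u\<close>.\<close>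
    define s where "s = r / (norm v + norm w + 1)"
    have r: "r > 0" using d d3 by (simp add: r_def)
    have np: "norm v + norm w + 1 > 0" by (simp add: add_nonneg_pos)
    have s: "s > 0" using r np by (simp add: s_def)
    have small: "dist (u + a *\<^sub>R x + b *\<^sub>R y) u < r"
      if "0 \<le> a" "a \<le> s" "0 \<le> b" "b \<le> s" "norm x + norm y = norm v + norm w" for a b x y
    proof -
      have "dist (u + a *\<^sub>R x + b *\<^sub>R y) u \<le> norm (a *\<^sub>R x) + norm (b *\<^sub>R y)"
        unfolding dist_norm by (metis add.assoc add_diff_cancel_left' norm_triangle_ineq)
      also have "\<dots> \<le> s * norm x + s * norm y"
        using that by (intro add_mono) (auto intro: mult_right_mono)
      also have "\<dots> = s * (norm v + norm w)" using that(5) by (metis distrib_left)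
      also have "\<dots> < s * (norm v + norm w + 1)" using s by simp
      also have "\<dots> = r" using np by (simp add: s_def)
      finally show ?thesis .
    qed
    have inU: "x \<in> U" if "dist x u < r" for x
      using that d3 by (auto simp: r_def dist_commute)
    obtain a b where ab: "0 \<le> a" "a \<le> s" "0 \<le> b" "b \<le> s"
      "f (u + s *\<^sub>R v + s *\<^sub>R w) - f (u + s *\<^sub>R v) - f (u + s *\<^sub>R w) + f u = s * s * G v w (u + a *\<^sub>R v + b *\<^sub>R w)"
      unfolding G_def
      by (rule second_difference_mvt[OF U f s, of u v w]) (use small inU in auto)
    obtain a' b' where ab': "0 \<le> a'" "a' \<le> s" "0 \<le> b'" "b' \<le> s"
      "f (u + s *\<^sub>R w + s *\<^sub>R v) - f (u + s *\<^sub>R w) - f (u + s *\<^sub>R v) + f u = s * s * G w v (u + a' *\<^sub>R w + b' *\<^sub>R v)"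
      unfolding G_def
      by (rule second_difference_mvt[OF U f s, of u w v]) (use small inU in auto)
    have "s * s * G v w (u + a *\<^sub>R v + b *\<^sub>R w) = s * s * G w v (u + a' *\<^sub>R w + b' *\<^sub>R v)"
      unfolding ab(5)[symmetric] ab'(5)[symmetric] by (simp add: add_ac)
    then have "G v w (u + a *\<^sub>R v + b *\<^sub>R w) = G w v (u + a' *\<^sub>R w + b' *\<^sub>R v)" using s by simp
    moreover have "dist (G v w (u + a *\<^sub>R v + b *\<^sub>R w)) (G v w u) < e / 2"
      by (rule d1) (use small[OF ab(1-4), of v w] in \<open>auto simp: r_def\<close>)
    moreover have "dist (G w v (u + a' *\<^sub>R w + b' *\<^sub>R v)) (G w v u) < e / 2"
      by (rule d2) (use small[OF ab'(1-4), of w v] in \<open>auto simp: r_def\<close>)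
    ultimately show ?thesis by (simp add: dist_real_def abs_if split: if_splits)
  qed
  then have "\<bar>G v w u - G w v u\<bar> \<le> 0" by (rule field_le_epsilon) simp
  then show ?thesis by (simp add: G_def)
qed

lemma symmetric_second_derivative:
  fixes f :: "'a::real_normed_vector \<Rightarrow> 'b::euclidean_space"
  assumes U: "open U" and f: "smooth_on U f" and u: "u \<in> U"
  shows "frechet_derivative (\<lambda>x. frechet_derivative f (at x) v) (at u) w
       = frechet_derivative (\<lambda>x. frechet_derivative f (at x) w) (at u) v"
proof (rule euclidean_eqI)
  fix b :: 'b assume "b \<in> Basis"
  define g where "g = (\<lambda>x. f x \<bullet> b)"
  have g: "smooth_on U g"
    unfolding g_def by (rule smooth_on_bounded_linear[OF bounded_linear_inner_left U f])
  have d: "frechet_derivative (\<lambda>x. F x \<bullet> b) (at x) = (\<lambda>v. frechet_derivative F (at x) v \<bullet> b)"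
    if "smooth_on U F" "x \<in> U" for F x
    by (rule frechet_derivative_at[symmetric],
        rule bounded_linear.has_derivative[OF bounded_linear_inner_left smooth_on_has_derivative[OF U that]])
  have "frechet_derivative (\<lambda>x. frechet_derivative g (at x) v) (at u) w
      = frechet_derivative (\<lambda>x. frechet_derivative f (at x) v) (at u) w \<bullet> b" for v w
  proof -
    have "((\<lambda>x. frechet_derivative g (at x) v) has_derivative
       (\<lambda>w. frechet_derivative (\<lambda>x. frechet_derivative f (at x) v) (at u) w \<bullet> b)) (at u)"
      by (rule has_derivative_transform_within_open[OF
            bounded_linear.has_derivative[OF bounded_linear_inner_left smooth_on_has_derivative[OF U smooth_on_frechet[OF f] u]] U u])
        (simp add: g_def d[OF f])
    then show ?thesis by (simp add: frechet_derivative_at[symmetric])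
  qed
  with symmetric_second_derivative_real[OF U g u, of v w]
  show "frechet_derivative (\<lambda>x. frechet_derivative f (at x) v) (at u) w \<bullet> b
       = frechet_derivative (\<lambda>x. frechet_derivative f (at x) w) (at u) v \<bullet> b" by simp
qed

section \<open>Block matrices and the frame equation\<close>

lemma sum_UNIV_option: "(\<Sum>i\<in>UNIV. f i) = f None + (\<Sum>i\<in>UNIV. f (Some i))" for f :: "'n::finite option \<Rightarrow> 'b::comm_monoid_add"
proof -
  have "(\<Sum>i\<in>UNIV. f i) = f None + sum f (range Some)"
    by (simp add: UNIV_option_conv)
  then show ?thesis by (simp add: sum.reindex)
qed

lemma upper_block_nth [simp]:
  "upper_block A b d $ Some i $ Some j = A $ i $ j"
  "upper_block A b d $ Some i $ None = b $ i"
  "upper_block A b d $ None $ Some j = 0"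
  "upper_block A b d $ None $ None = d"
  by (simp_all add: upper_block_def)

lemma vec_eq_option_iff:
  fixes A B :: "complex^('n::finite option)^('n option)"
  shows "A = B \<longleftrightarrow> (\<forall>i j. (A $ Some i) $ Some j = (B $ Some i) $ Some j) \<and>
     (\<forall>i. (A $ Some i) $ None = (B $ Some i) $ None) \<and>
     (\<forall>j. (A $ None) $ Some j = (B $ None) $ Some j) \<and> (A $ None) $ None = (B $ None) $ None"
proof (safe)
  assume *: "\<forall>i j. A $ Some i $ Some j = B $ Some i $ Some j" "\<forall>i. A $ Some i $ None = B $ Some i $ None"
    "\<forall>j. A $ None $ Some j = B $ None $ Some j" "A $ None $ None = B $ None $ None"
  have "A $ i $ j = B $ i $ j" for i j
    by (cases i; cases j) (use * in \<open>simp_all\<close>)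
  then show "A = B" by (simp add: vec_eq_iff)
qed

lemma upper_block_eq_iff: "upper_block A b d = upper_block A' b' d' \<longleftrightarrow> A = A' \<and> b = b' \<and> d = d'"
  unfolding vec_eq_option_iff by (auto simp: vec_eq_iff)

lemma upper_block_mult:
  "upper_block A b d ** upper_block A' b' d' = upper_block (A ** A') (A *v b' + d' *s b) (d * d')"
  unfolding vec_eq_option_iff
  by (simp add: matrix_matrix_mult_def matrix_vector_mult_def sum_UNIV_option mult.commute)

lemma mat_1_upper_block: "mat 1 = upper_block (mat 1) 0 1"
  unfolding vec_eq_option_iff by (auto simp: mat_def)

lemma upper_block_split: "upper_block A b d = upper_block A 0 0 + upper_block 0 b 0 + upper_block 0 0 d"
  unfolding vec_eq_option_iff by simp

lemma bounded_linear_upper_block: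
  "bounded_linear (\<lambda>A. upper_block A 0 0)" "bounded_linear (\<lambda>b. upper_block 0 b 0)"
  "bounded_linear (\<lambda>M :: complex^('n option)^('n option). \<chi> i j :: 'n::finite. M $ Some i $ Some j)"
  "bounded_linear (\<lambda>M :: complex^('n option)^('n option). \<chi> i :: 'n. M $ Some i $ None)"
  unfolding linear_conv_bounded_linear [symmetric]
  by (rule linearI; auto simp: vec_eq_option_iff; simp add: vec_eq_iff)+

lemma upper_block_has_derivative:
  assumes "(E has_derivative E') F" "(X has_derivative X') F"
  shows "((\<lambda>x. upper_block (E x) (X x) d) has_derivative (\<lambda>v. upper_block (E' v) (X' v) 0)) F"
proof -
  have "((\<lambda>x. upper_block (E x) 0 0 + upper_block 0 (X x) 0 + upper_block 0 0 d) has_derivative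
      (\<lambda>v. upper_block (E' v) 0 0 + upper_block 0 (X' v) 0 + 0)) F"
    by (intro has_derivative_add has_derivative_const
        bounded_linear.has_derivative[OF bounded_linear_upper_block(1) assms(1)]
        bounded_linear.has_derivative[OF bounded_linear_upper_block(2) assms(2)])
  moreover have "upper_block (E' v) (X' v) 0 = upper_block (E' v) 0 0 + upper_block 0 (X' v) 0 + 0" for v
    unfolding vec_eq_option_iff by simp
  ultimately show ?thesis by (simp add: upper_block_split[symmetric])
qed

text \<open>The upper left block \<open>\<i> z \<delta> + [\<delta>, b]\<close> of \<open>frame_form\<close>.\<close>

definition connection_form :: "complex^'n::finite^'n \<Rightarrow> complex \<Rightarrow> real^'n \<Rightarrow> complex^'n^'n" where
  "connection_form b z v = smat (\<i> * z) (delta v) + (delta v ** b - b ** delta v)"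

lemma frame_form_eq: "frame_form h \<beta> z v = upper_block (connection_form (cmat \<beta>) z v) (delta v *v cvec h) 0"
  by (simp add: frame_form_def connection_form_def mat_mult_eq_smat)

text \<open>Reading off the blocks: the equation for \<open>E\<close> does not involve \<open>X\<close> or \<open>h\<close>, so its symmetries can be
  studied first.\<close>

lemma frame_derivative_iff:
  assumes F: "\<And>u z. F u z = upper_block (E u z) (X u z) 1"
  shows "((\<lambda>x. F x z) has_derivative (\<lambda>v. F u z ** frame_form h \<beta> z v)) (at u) \<longleftrightarrow>
     ((\<lambda>x. E x z) has_derivative (\<lambda>v. E u z ** connection_form (cmat \<beta>) z v)) (at u) \<and>
     ((\<lambda>x. X x z) has_derivative (\<lambda>v. E u z *v (delta v *v cvec h))) (at u)" (is "?l \<longleftrightarrow> ?r")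
proof
  have eq: "F u z ** frame_form h \<beta> z v
      = upper_block (E u z ** connection_form (cmat \<beta>) z v) (E u z *v (delta v *v cvec h)) 0" for v
    by (simp add: F frame_form_eq upper_block_mult)
  {
    assume l: ?l
    show ?r
      using bounded_linear.has_derivative[OF bounded_linear_upper_block(3) l]
        bounded_linear.has_derivative[OF bounded_linear_upper_block(4) l]
      by (simp add: eq) (simp add: F)
  next
    assume ?r
    then show ?l unfolding eq unfolding F by (intro upper_block_has_derivative) auto
  }
qed

lemma upper_block_inverse:
  assumes "A ** B = mat 1"
  shows "upper_block A x 1 ** upper_block B (- (B *v x)) 1 = mat 1"
  using assms by (simp add: upper_block_mult mat_1_upper_block matvec_minus_right matrix_vector_mul_assoc)

section \<open>Symmetries of frames\<close>

text \<open>The commutator of symmetric matrices is skew, so for symmetric \<open>b\<close> changing the sign of \<open>z\<close>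
  amounts to minus the transpose. This is the source of both symmetries of a frame.\<close>

lemma connection_form_transpose: "transpose b = b \<Longrightarrow> transpose (connection_form b (- z) v) = - connection_form b z v"
  by (simp add: connection_form_def transpose_simps) (simp add: vec_eq_iff)

lemma connection_form_cnjm: "cnjm b = b \<Longrightarrow> cnjm (connection_form b (cnj z) v) = connection_form b (- z) v"
  by (simp add: connection_form_def cnjm_simps)

text \<open>The original and the dressed frame both satisfy these assumptions, hence both have the symmetries
  derived from them.\<close>

locale flat_connection =
  fixes U :: "(real^'n::finite) set" and E :: "real^'n \<Rightarrow> complex \<Rightarrow> complex^'n^'n"
    and \<beta> :: "real^'n \<Rightarrow> real^'n^'n"
  assumes open_U: "open U" and conn_U: "connected U" and zero_U: "0 \<in> U"
    and E0: "E 0 z = mat 1"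
    and sym_\<beta>: "u \<in> U \<Longrightarrow> transpose (\<beta> u) = \<beta> u"
    and dE: "u \<in> U \<Longrightarrow> ((\<lambda>x. E x z) has_derivative (\<lambda>v. E u z ** connection_form (cmat (\<beta> u)) z v)) (at u)"
begin

lemma sym_c: "u \<in> U \<Longrightarrow> transpose (cmat (\<beta> u)) = cmat (\<beta> u)"
  using sym_\<beta>[of u] by (simp add: vec_eq_iff transpose_nth)

lemma constant_on_U:
  assumes "\<And>u. u \<in> U \<Longrightarrow> (f has_derivative (\<lambda>v. 0)) (at u)" "u \<in> U"
  shows "f u = f 0"
  by (rule has_derivative_zero_unique_connected[OF open_U conn_U assms(1) assms(2) zero_U])

text \<open>The product is constant in \<open>u\<close> because the two connection forms cancel, and it is the identity at
  \<open>0\<close>. Connectedness of the domain enters here.\<close>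

lemma transpose_inverse: assumes "u \<in> U" shows "E u z ** transpose (E u (- z)) = mat 1"
proof -
  have "((\<lambda>x. E x z ** transpose (E x (- z))) has_derivative (\<lambda>v. 0)) (at u)" if u: "u \<in> U" for u
    by (rule has_derivative_eq_rhs[OF matrix_has_derivative[OF dE[OF u]
            bounded_linear.has_derivative[OF bounded_linear_transpose dE[OF u]]]])
      (simp add: fun_eq_iff transpose_simps connection_form_transpose sym_c u mat_simps)
  from constant_on_U[OF this assms] show ?thesis by (simp add: E0)
qed

lemma transpose_inverse': "u \<in> U \<Longrightarrow> transpose (E u (- z)) ** E u z = mat 1"
  using transpose_inverse matrix_left_right_inverse by blast

lemma transpose_inverse2: "u \<in> U \<Longrightarrow> E u (- z) ** transpose (E u z) = mat 1"
  using transpose_inverse[of u "- z"] by simp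

lemma transpose_inverse2': "u \<in> U \<Longrightarrow> transpose (E u z) ** E u (- z) = mat 1"
  using transpose_inverse'[of u "- z"] by simp

lemma reality: assumes "u \<in> U" shows "cnjm (E u (cnj z)) = E u (- z)"
proof -
  have "((\<lambda>x. cnjm (E x (cnj z)) ** transpose (E x z)) has_derivative (\<lambda>v. 0)) (at u)" if u: "u \<in> U" for u
    by (rule has_derivative_eq_rhs[OF matrix_has_derivative[OF
          bounded_linear.has_derivative[OF bounded_linear_cnjm dE[OF u]]
            bounded_linear.has_derivative[OF bounded_linear_transpose dE[OF u]]]])
      (use connection_form_transpose[OF sym_c[OF u], of "- z"] in \<open>simp add: fun_eq_iff matrix_transpose_mul cnjm_mult connection_form_cnjm mat_simps\<close>)
  from constant_on_U[OF this assms] have "cnjm (E u (cnj z)) ** transpose (E u z) = mat 1"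
    by (simp add: E0 cnjm_mat)
  then have "cnjm (E u (cnj z)) ** (transpose (E u z) ** E u (- z)) = E u (- z)"
    by (simp add: matrix_mul_assoc)
  then show ?thesis using assms by (simp add: transpose_inverse2')
qed

end

section \<open>Limits of frames in the spectral parameter\<close>

lemma norm_smat: "norm (smat c A) = norm c * norm A" for A :: "complex^'n^'m"
proof -
  have "norm (smat c A $ i) = norm c * norm (A $ i)" for i
    by (simp add: norm_vec_def norm_mult L2_set_right_distrib)
  then show ?thesis by (simp add: norm_vec_def[where 'b='m] L2_set_right_distrib)
qed

text \<open>A Gronwall estimate on a ball so small that it follows from the mean value inequality at a point
  where the norm of \<open>f\<close> is largest.\<close>

lemma growth_bound:
  fixes f :: "'a::euclidean_space \<Rightarrow> 'b::real_normed_vector"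
  assumes r: "r > 0" and c: "0 \<le> c" "c * r \<le> 1/2" and k: "0 \<le> k"
    and d: "\<And>x. x \<in> cball u r \<Longrightarrow> (f has_derivative f' x) (at x)"
    and b: "\<And>x v. x \<in> cball u r \<Longrightarrow> norm (f' x v) \<le> (c * norm (f x) + k) * norm v"
    and x: "x \<in> cball u r"
  shows "norm (f x) \<le> 2 * (norm (f u) + k * r)"
proof -
  have "continuous_on (cball u r) (\<lambda>x. norm (f x))"
    by (intro continuous_on_norm continuous_at_imp_continuous_on ballI has_derivative_continuous[OF d])
  then obtain m where m: "m \<in> cball u r" "\<And>y. y \<in> cball u r \<Longrightarrow> norm (f y) \<le> norm (f m)"
    using continuous_attains_sup[of "cball u r" "\<lambda>x. norm (f x)"] r by auto
  have "norm (f m - f u) \<le> (c * norm (f m) + k) * norm (m - u)"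
  proof (rule differentiable_bound[of "cball u r"])
    fix x assume x: "x \<in> cball u r"
    show "(f has_derivative f' x) (at x within cball u r)"
      using d[OF x] by (rule has_derivative_at_withinI)
    show "onorm (f' x) \<le> c * norm (f m) + k"
    proof (rule onorm_le)
      fix v
      show "norm (f' x v) \<le> (c * norm (f m) + k) * norm v"
        using m(2)[OF x] c k
        by (intro order_trans[OF b[OF x, of v]] mult_right_mono add_mono mult_left_mono) auto
    qed
  qed (use m r in auto)
  also have "\<dots> \<le> (c * norm (f m) + k) * r"
    using m(1) c k by (intro mult_left_mono) (auto simp: dist_norm norm_minus_commute)
  also have "\<dots> = (c * r) * norm (f m) + k * r" by (simp add: algebra_simps)
  also have "\<dots> \<le> 1/2 * norm (f m) + k * r"
    using c r by (intro add_mono mult_right_mono) auto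
  finally have "norm (f m) \<le> 2 * (norm (f u) + k * r)"
    using norm_triangle_sub[of "f m" "f u"] by argo
  then show ?thesis using m(2)[OF x] by argo
qed

lemma linear_family_bound:
  fixes W :: "'a::topological_space \<Rightarrow> 'c::euclidean_space \<Rightarrow> 'b::real_normed_vector"
  assumes "compact S" "\<And>x. x \<in> S \<Longrightarrow> linear (W x)" "\<And>v. continuous_on S (\<lambda>x. W x v)"
  obtains C where "C \<ge> 0" "\<And>x v. x \<in> S \<Longrightarrow> norm (W x v) \<le> C * norm v"
proof -
  have "\<exists>B. \<forall>x\<in>S. norm (W x b) \<le> B" for b
    using compact_imp_bounded[OF compact_continuous_image[OF assms(3)[of b] assms(1)]]
    by (auto simp: bounded_iff)
  then obtain B where B: "\<And>b x. x \<in> S \<Longrightarrow> norm (W x b) \<le> B b" by metis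
  show thesis
  proof (rule that[of "\<Sum>b\<in>Basis. \<bar>B b\<bar>"])
    fix x v assume x: "x \<in> S"
    have "W x v = (\<Sum>b\<in>Basis. (v \<bullet> b) *\<^sub>R W x b)"
      by (subst euclidean_representation[of v, symmetric])
        (simp only: linear_sum[OF assms(2)[OF x]] linear_cmul[OF assms(2)[OF x]])
    also have "norm \<dots> \<le> (\<Sum>b\<in>Basis. norm v * \<bar>B b\<bar>)"
    proof (intro sum_norm_le)
      fix b :: 'c assume b: "b \<in> Basis"
      have "\<bar>v \<bullet> b\<bar> * norm (W x b) \<le> norm v * \<bar>B b\<bar>"
        using B[OF x, of b] Basis_le_norm[OF b, of v] by (intro mult_mono) auto
      then show "norm ((v \<bullet> b) *\<^sub>R W x b) \<le> norm v * \<bar>B b\<bar>" by simp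
    qed
    also have "\<dots> = (\<Sum>b\<in>Basis. \<bar>B b\<bar>) * norm v" by (simp add: sum_distrib_left mult.commute)
    finally show "norm (W x v) \<le> (\<Sum>b\<in>Basis. \<bar>B b\<bar>) * norm v" .
  qed (simp add: sum_nonneg)
qed

text \<open>The frame equation passes to a limit in the spectral parameter although the frame is only known to
  be continuous in \<open>z\<close> for each \<open>u\<close> separately. Let \<open>z\<close> run through a sequence tending to \<open>z0\<close>. The
  equation is linear, so \<open>growth_bound\<close> makes the frames bounded on a small ball; the difference of
  two of them satisfies the same equation up to a term proportional to the difference of the
  parameters, so they converge uniformly, and so do their derivatives.\<close>

lemma frame_derivative_limit:
  fixes F :: "'a::euclidean_space \<Rightarrow> complex \<Rightarrow> complex^'m^'m"
    and W :: "'a \<Rightarrow> 'a \<Rightarrow> complex^'m^'m" and D :: "'a \<Rightarrow> complex^'m^'m"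
  assumes U: "open U" and u: "u \<in> U" and \<rho>: "\<rho> > 0"
    and linW: "\<And>x. x \<in> U \<Longrightarrow> linear (W x)" and linD: "linear D"
    and contW: "\<And>v. continuous_on U (\<lambda>x. W x v)"
    and contF: "\<And>x. x \<in> U \<Longrightarrow> isCont (F x) z0"
    and d: "\<And>x z. x \<in> U \<Longrightarrow> z \<noteq> z0 \<Longrightarrow> norm (z - z0) < \<rho> \<Longrightarrow>
       ((\<lambda>x. F x z) has_derivative (\<lambda>v. F x z ** (W x v + smat z (D v)))) (at x)"
  shows "((\<lambda>x. F x z0) has_derivative (\<lambda>v. F u z0 ** (W u v + smat z0 (D v)))) (at u)"
proof -
  obtain K where K: "K > 0" "\<And>(A :: complex^'m^'m) (B :: complex^'m^'m). norm (A ** B) \<le> norm A * norm B * K"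
    using bounded_bilinear.pos_bounded[OF bounded_bilinear_matrix_mult[where 'a = complex]] by metis
  obtain r0 where r0: "r0 > 0" "cball u r0 \<subseteq> U" using U u open_contains_cball by blast
  obtain C0 where C0: "C0 \<ge> 0" "\<And>x v. x \<in> cball u r0 \<Longrightarrow> norm (W x v) \<le> C0 * norm v"
    by (rule linear_family_bound[of "cball u r0" W])
      (use linW r0(2) continuous_on_subset[OF contW r0(2)] in \<open>auto simp: subset_eq\<close>)
  obtain D1 where D1: "D1 \<ge> 0" "\<And>v. norm (D v) \<le> D1 * norm v"
    using linear_bounded_pos[OF linD] by (metis less_imp_le)
  define C where "C = C0 + (norm z0 + \<rho>) * D1"
  have C: "C \<ge> 0" using C0 D1 \<rho> by (simp add: C_def)
  have Wb: "norm (W x v + smat z (D v)) \<le> C * norm v" if "x \<in> cball u r0" "norm (z - z0) < \<rho>" for x z v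
  proof -
    have "norm z \<le> norm z0 + \<rho>" using that(2) norm_triangle_sub[of z z0] by simp
    then have "norm z * norm (D v) \<le> (norm z0 + \<rho>) * (D1 * norm v)"
      using D1(2)[of v] by (intro mult_mono) (auto simp: add_nonneg_nonneg \<rho> less_imp_le)
    then show ?thesis
      using C0(2)[OF that(1), of v] norm_triangle_ineq[of "W x v" "smat z (D v)"]
      by (simp add: norm_smat C_def algebra_simps)
  qed
  \<comment> \<open>This radius meets the smallness condition of \<open>growth_bound\<close>.\<close>
  define r where "r = min r0 (1 / (2 * (K * C + 1)))"
  have KC: "K * C \<ge> 0" using K C by simp
  have r: "r > 0" "r \<le> r0" using r0 KC by (simp_all add: r_def)
  have KCr: "K * C * r \<le> 1/2"
  proof -
    have "K * C * r \<le> (K * C + 1) * (1 / (2 * (K * C + 1)))"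
      using KC r by (intro mult_mono) (auto simp: r_def)
    also have "\<dots> = 1/2" using KC by simp
    finally show ?thesis .
  qed
  have sub: "x \<in> U" "x \<in> cball u r0" if "x \<in> cball u r" for x using that r r0 by auto
  \<comment> \<open>The shift by \<open>2\<close> keeps all members strictly inside the disc of radius \<open>\<rho>\<close>.\<close>
  define \<zeta> where "\<zeta> n = z0 + of_real (\<rho> / real (Suc (Suc n)))" for n
  have \<zeta>n: "\<zeta> n \<noteq> z0" "norm (\<zeta> n - z0) < \<rho>" for n
    using \<rho> unfolding \<zeta>_def add_diff_cancel_left' norm_of_real
    by (auto simp: field_simps add_pos_nonneg simp del: of_real_divide)
  have \<zeta>lim: "\<zeta> \<longlonglongrightarrow> z0"
  proof -
    have "(\<lambda>n. \<rho> / real (Suc (Suc n))) \<longlonglongrightarrow> 0"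
      by (rule LIMSEQ_Suc[OF LIMSEQ_Suc[OF lim_const_over_n]])
    then have "(\<lambda>n. z0 + of_real (\<rho> / real (Suc (Suc n)))) \<longlonglongrightarrow> z0 + of_real 0"
      by (intro tendsto_intros)
    then show ?thesis by (simp add: \<zeta>_def[abs_def])
  qed
  have Flim: "(\<lambda>n. F x (\<zeta> n)) \<longlonglongrightarrow> F x z0" if "x \<in> U" for x
    by (rule isCont_tendsto_compose[OF contF[OF that] \<zeta>lim])
  have dn: "((\<lambda>x. F x (\<zeta> n)) has_derivative (\<lambda>v. F x (\<zeta> n) ** (W x v + smat (\<zeta> n) (D v)))) (at x)"
    if "x \<in> cball u r" for x n by (rule d[OF sub(1)[OF that] \<zeta>n])
  have KB: "norm (A ** (W x v + smat (\<zeta> n) (D v))) \<le> K * C * norm A * norm v"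
    if "x \<in> cball u r" for A :: "complex^'m^'m" and x v n
  proof -
    have "norm (A ** (W x v + smat (\<zeta> n) (D v))) \<le> norm A * norm (W x v + smat (\<zeta> n) (D v)) * K" by (rule K)
    also have "\<dots> \<le> norm A * (C * norm v) * K"
      using Wb[OF sub(2)[OF that] \<zeta>n(2), of v] K by (intro mult_right_mono mult_left_mono) auto
    finally show ?thesis by (simp add: mult_ac)
  qed
  have KD: "norm (A ** smat c (D v)) \<le> K * D1 * norm A * norm c * norm v" for A :: "complex^'m^'m" and c v
  proof -
    have "norm (A ** smat c (D v)) \<le> norm A * norm (smat c (D v)) * K" by (rule K)
    also have "\<dots> \<le> norm A * (norm c * (D1 * norm v)) * K"
      unfolding norm_smat using D1 K by (intro mult_right_mono mult_left_mono) auto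
    finally show ?thesis by (simp add: mult_ac)
  qed
  obtain M0 where M0: "\<And>n. norm (F u (\<zeta> n)) \<le> M0"
    using Flim[OF u] by (metis Bseq_def convergentI convergent_imp_Bseq)
  define M where "M = 2 * M0"
  have Mb: "norm (F x (\<zeta> n)) \<le> M" if x: "x \<in> cball u r" for x n
  proof -
    have "norm (F x (\<zeta> n)) \<le> 2 * (norm (F u (\<zeta> n)) + 0 * r)"
      by (rule growth_bound[OF r(1) KC KCr order_refl dn _ x]) (use KB in \<open>auto\<close>)
    then show ?thesis using M0[of n] by (simp add: M_def)
  qed
  have M: "M \<ge> 0" using order_trans[OF norm_ge_zero Mb[of u 0]] r by simp
  have M': "norm (F x z0) \<le> M" if x: "x \<in> cball u r" for x
    by (rule tendsto_upperbound[OF tendsto_norm[OF Flim[OF sub(1)[OF x]]]]) (use Mb[OF x] in auto)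
  define k where "k = K * D1 * M"
  have k: "k \<ge> 0" using K D1 M by (simp add: k_def)
  have diff: "norm (F x (\<zeta> n) - F x (\<zeta> m)) \<le> 2 * (norm (F u (\<zeta> n) - F u (\<zeta> m)) + k * norm (\<zeta> n - \<zeta> m) * r)"
    if x: "x \<in> cball u r" for x n m
  proof (rule growth_bound[OF r(1) KC KCr _ has_derivative_diff[OF dn dn] _ x])
    fix x v assume x: "x \<in> cball u r"
    have "F x (\<zeta> n) ** (W x v + smat (\<zeta> n) (D v)) - F x (\<zeta> m) ** (W x v + smat (\<zeta> m) (D v))
        = (F x (\<zeta> n) - F x (\<zeta> m)) ** (W x v + smat (\<zeta> n) (D v)) + F x (\<zeta> m) ** smat (\<zeta> n - \<zeta> m) (D v)"
      by (simp add: mat_simps) (simp add: vec_eq_iff algebra_simps)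
    also have "norm \<dots> \<le> K * C * norm (F x (\<zeta> n) - F x (\<zeta> m)) * norm v
        + K * D1 * norm (F x (\<zeta> m)) * norm (\<zeta> n - \<zeta> m) * norm v"
      by (intro norm_triangle_le add_mono KB x KD)
    also have "\<dots> \<le> K * C * norm (F x (\<zeta> n) - F x (\<zeta> m)) * norm v + K * D1 * M * norm (\<zeta> n - \<zeta> m) * norm v"
      using K D1 Mb[OF x, of m] by (intro add_left_mono mult_right_mono mult_left_mono) auto
    finally show "norm (F x (\<zeta> n) ** (W x v + smat (\<zeta> n) (D v)) - F x (\<zeta> m) ** (W x v + smat (\<zeta> m) (D v)))
        \<le> (K * C * norm (F x (\<zeta> n) - F x (\<zeta> m)) + k * norm (\<zeta> n - \<zeta> m)) * norm v"
      by (simp add: k_def algebra_simps)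
  qed (use k in auto)
  define \<epsilon> where "\<epsilon> n = 2 * (norm (F u (\<zeta> n) - F u z0) + k * norm (\<zeta> n - z0) * r)" for n
  have diff': "norm (F x (\<zeta> n) - F x z0) \<le> \<epsilon> n" if x: "x \<in> cball u r" for x n
    unfolding \<epsilon>_def
  proof (rule LIMSEQ_le[OF _ _ exI[of _ 0], rotated 2])
    show "\<forall>m\<ge>0. norm (F x (\<zeta> n) - F x (\<zeta> m)) \<le> 2 * (norm (F u (\<zeta> n) - F u (\<zeta> m)) + k * norm (\<zeta> n - \<zeta> m) * r)"
      using diff[OF x] by blast
  qed (intro tendsto_intros Flim u sub x \<zeta>lim)+
  define err where "err n = K * C * \<epsilon> n + k * norm (\<zeta> n - z0)" for n
  have "(\<lambda>n. err n) \<longlonglongrightarrow> K * C * (2 * (norm (F u z0 - F u z0) + k * norm (z0 - z0) * r)) + k * norm (z0 - z0)"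
    unfolding err_def \<epsilon>_def by (intro tendsto_intros Flim u \<zeta>lim)
  then have err0: "err \<longlonglongrightarrow> 0" by simp
  have "\<exists>g. \<forall>x\<in>cball u r. (\<lambda>n. F x (\<zeta> n)) \<longlonglongrightarrow> g x \<and>
      (g has_derivative (\<lambda>v. F x z0 ** (W x v + smat z0 (D v)))) (at x within cball u r)"
  proof (rule has_derivative_sequence)
    fix e :: real assume "e > 0"
    with err0 have "\<forall>\<^sub>F n in sequentially. err n < e" by (rule order_tendstoD)
    then show "\<forall>\<^sub>F n in sequentially. \<forall>x\<in>cball u r. \<forall>v.
        norm (F x (\<zeta> n) ** (W x v + smat (\<zeta> n) (D v)) - F x z0 ** (W x v + smat z0 (D v))) \<le> e * norm v"
    proof (eventually_elim, intro ballI allI)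
      fix n x v assume n: "err n < e" and x: "x \<in> cball u r"
      have "F x (\<zeta> n) ** (W x v + smat (\<zeta> n) (D v)) - F x z0 ** (W x v + smat z0 (D v))
        = (F x (\<zeta> n) - F x z0) ** (W x v + smat (\<zeta> n) (D v)) + F x z0 ** smat (\<zeta> n - z0) (D v)"
        by (simp add: mat_simps) (simp add: vec_eq_iff algebra_simps)
      also have "norm \<dots> \<le> K * C * norm (F x (\<zeta> n) - F x z0) * norm v
        + K * D1 * norm (F x z0) * norm (\<zeta> n - z0) * norm v"
        by (intro norm_triangle_le add_mono KB x KD)
      also have "\<dots> \<le> K * C * \<epsilon> n * norm v + K * D1 * M * norm (\<zeta> n - z0) * norm v"
        using K D1 M'[OF x] KC diff'[OF x] by (intro add_mono mult_right_mono mult_left_mono) auto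
      also have "\<dots> = err n * norm v" by (simp add: err_def k_def algebra_simps)
      also have "\<dots> \<le> e * norm v" using n by (intro mult_right_mono) auto
      finally show "norm (F x (\<zeta> n) ** (W x v + smat (\<zeta> n) (D v)) - F x z0 ** (W x v + smat z0 (D v))) \<le> e * norm v" .
    qed
  qed (use dn r in \<open>auto intro: has_derivative_at_withinI Flim[OF u]\<close>)
  then obtain g where g: "\<And>x. x \<in> cball u r \<Longrightarrow> (\<lambda>n. F x (\<zeta> n)) \<longlonglongrightarrow> g x"
    "\<And>x. x \<in> cball u r \<Longrightarrow> (g has_derivative (\<lambda>v. F x z0 ** (W x v + smat z0 (D v)))) (at x within cball u r)"
    by blast
  have gF: "g x = F x z0" if "x \<in> cball u r" for x
    by (rule LIMSEQ_unique[OF g(1)[OF that] Flim[OF sub(1)[OF that]]])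
  have "at u within cball u r = at u" using r by (intro at_within_interior) (simp add: interior_cball)
  then have "(g has_derivative (\<lambda>v. F u z0 ** (W u v + smat z0 (D v)))) (at u)"
    using g(2)[of u] r by simp
  then show ?thesis
    by (rule has_derivative_transform_within_open[of _ _ _ _ "ball u r"]) (use r gF in auto)
qed

section \<open>Projections onto moving subspaces\<close>

definition adj :: "complex^'n^'m \<Rightarrow> complex^'m^'n" where "adj A = transpose (cnjm A)"

lemma adj_mult: "adj (A ** B) = adj B ** adj A" by (simp add: adj_def cnjm_mult matrix_transpose_mul)

lemma adj_adj [simp]: "adj (adj A) = A" by (simp add: adj_def cnjm_transpose)

lemma adj_diff: "adj (A - B) = adj A - adj B" by (simp add: adj_def cnjm_simps transpose_simps)

lemma adj_add: "adj (A + B) = adj A + adj B" by (simp add: adj_def cnjm_simps transpose_simps)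

lemma adj_mat_1 [simp]: "adj (mat 1) = mat 1" by (simp add: adj_def cnjm_mat)

lemma hermitian_projection_iff: "hermitian_projection P \<longleftrightarrow> P ** P = P \<and> adj P = P"
  by (simp add: hermitian_projection_def adj_def)

lemma inner_complex_vec: "x \<bullet> y = Re (\<Sum>k\<in>UNIV. cnj (x $ k) * y $ k)" for x y :: "complex^'n"
  by (simp add: inner_vec_def inner_complex_def)

lemma inner_adj: "x \<bullet> (adj M *v y) = (M *v x) \<bullet> y"
proof -
  have "(\<Sum>k\<in>UNIV. cnj (x $ k) * (adj M *v y) $ k) = (\<Sum>k\<in>UNIV. \<Sum>j\<in>UNIV. cnj (x $ k) * (cnj (M $ j $ k) * y $ j))"
    by (simp add: adj_def matrix_vector_mult_def transpose_nth sum_distrib_left)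
  also have "\<dots> = (\<Sum>j\<in>UNIV. \<Sum>k\<in>UNIV. cnj (x $ k) * (cnj (M $ j $ k) * y $ j))" by (rule sum.swap)
  also have "\<dots> = (\<Sum>j\<in>UNIV. cnj ((M *v x) $ j) * y $ j)"
    by (simp add: matrix_vector_mult_def sum_distrib_right sum_distrib_left mult_ac)
  finally show ?thesis by (simp add: inner_complex_vec)
qed

lemma hermitian_projection_fixes: "hermitian_projection P \<Longrightarrow> x \<in> range ((*v) P) \<longleftrightarrow> P *v x = x"
proof
  assume P: "hermitian_projection P" and "x \<in> range ((*v) P)"
  then obtain y where "x = P *v y" by blast
  then show "P *v x = x" using P by (simp add: hermitian_projection_def matrix_vector_mul_assoc)
next
  assume "P *v x = x"
  then show "x \<in> range ((*v) P)" by (metis rangeI)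
qed

lemma hermitian_projection_unique:
  assumes P: "hermitian_projection P" and Q: "hermitian_projection Q" and eq: "range ((*v) P) = range ((*v) Q)"
  shows "P = Q"
proof -
  have "P ** Q = Q" "Q ** P = P"
    unfolding matrix_eq
    using hermitian_projection_fixes[OF P] hermitian_projection_fixes[OF Q] eq
    by (metis matrix_vector_mul_assoc rangeI)+
  then show ?thesis using P Q adj_mult[of P Q] by (simp add: hermitian_projection_iff)
qed

text \<open>The orthogonal projection onto \<open>B (Im p)\<close> is \<open>B p S\<inverse> p B\<^sup>*\<close> for the Gram matrix
  \<open>S = p B\<^sup>* B p + (1 - p)\<close>, which is made invertible by the summand \<open>1 - p\<close> and commutes
  with \<open>p\<close>.\<close>

lemma hermitian_projection_exists:
  fixes A B :: "complex^'n::finite^'n"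
  assumes p: "hermitian_projection p" and AB: "A ** B = mat 1"
  shows "\<exists>P. hermitian_projection P \<and> range ((*v) P) = (*v) B ` range ((*v) p)"
proof -
  have pp: "p ** p = p" and ap: "adj p = p" using p by (auto simp: hermitian_projection_iff)
  have pp': "p ** (p ** M) = p ** M" for M by (simp add: matrix_mul_assoc pp)
  define S where "S = p ** adj B ** B ** p + (mat 1 - p)"
  have pS: "p ** S = p ** adj B ** B ** p" and Sp: "S ** p = p ** adj B ** B ** p"
    by (simp_all add: S_def mat_simps pp pp')
  have "\<exists>T. T ** S = mat 1"
    unfolding matrix_left_invertible_ker
  proof (intro allI impI)
    fix x assume Sx: "S *v x = 0"
    have "((B ** p) *v x) \<bullet> ((B ** p) *v x) = x \<bullet> (adj (B ** p) *v ((B ** p) *v x))"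
      by (rule inner_adj[symmetric])
    also have "adj (B ** p) *v ((B ** p) *v x) = p *v (S *v x)"
      by (simp add: adj_mult ap matrix_vector_mul_assoc matrix_mul_assoc pS)
    finally have "B *v (p *v x) = 0" using Sx by (simp add: matrix_vector_mul_assoc)
    then have "p *v x = 0"
      using AB by (metis matrix_vector_mul_assoc matrix_vector_mul_lid matrix_vector_mult_0_right)
    then show "x = 0"
      using Sx \<open>B *v (p *v x) = 0\<close> by (simp add: S_def mat_simps)
  qed
  then obtain T where T: "T ** S = mat 1" "S ** T = mat 1" using matrix_left_right_inverse by blast
  have aS: "adj S = S" by (simp add: S_def adj_add adj_diff adj_mult ap matrix_mul_assoc)
  have "adj T ** S = mat 1" by (metis T(2) aS adj_mult adj_mat_1)
  then have aT: "adj T = T" by (metis T(2) matrix_mul_assoc matrix_mul_lid matrix_mul_rid)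
  have pT: "p ** T = T ** p"
  proof -
    have "T ** (S ** p) ** T = T ** (p ** S) ** T" by (simp add: pS Sp)
    then show ?thesis using T by (metis matrix_mul_assoc matrix_mul_lid matrix_mul_rid)
  qed
  define P where "P = B ** p ** T ** p ** adj B"
  have PBp: "P ** (B ** p) = B ** p"
  proof -
    have "P ** (B ** p) = B ** p ** T ** (p ** S)" by (simp add: P_def pS matrix_mul_assoc)
    also have "\<dots> = B ** p ** p ** (T ** S)" using pT by (metis matrix_mul_assoc)
    finally show ?thesis by (simp add: T mat_simps pp pp')
  qed
  have "P ** P = P ** (B ** p) ** T ** p ** adj B" by (simp add: P_def matrix_mul_assoc)
  then have "P ** P = P" unfolding PBp by (simp add: P_def matrix_mul_assoc)
  moreover have "adj P = P" by (simp add: P_def adj_mult ap aT matrix_mul_assoc)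
  moreover have "range ((*v) P) = (*v) B ` range ((*v) p)"
  proof (safe)
    fix x
    have "P *v x = B *v (p *v ((T ** p ** adj B) *v x))" by (simp add: P_def matrix_vector_mul_assoc matrix_mul_assoc)
    then show "P *v x \<in> (*v) B ` range ((*v) p)" by blast
  next
    fix x
    have "B *v (p *v x) = P *v (B *v (p *v x))"
      using PBp by (simp add: matrix_vector_mul_assoc matrix_mul_assoc)
    then show "B *v (p *v x) \<in> range ((*v) P)" by (metis rangeI)
  qed
  ultimately show ?thesis by (auto simp: hermitian_projection_iff)
qed

lemma hermitian_projection_onto:
  assumes "hermitian_projection P" "range ((*v) P) = W"
  shows "hermitian_projection_onto W = P"
  unfolding hermitian_projection_onto_def
  by (rule the_equality) (use assms hermitian_projection_unique in auto)

lemma hermitian_projection_cnjm: "hermitian_projection P \<Longrightarrow> hermitian_projection (cnjm P)"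
  unfolding hermitian_projection_def by (metis cnjm_cnjm cnjm_mult cnjm_transpose)

text \<open>The two inclusions \<open>P (B p) = B p\<close> and \<open>p (A P) = A P\<close> say that \<open>B\<close> maps the image of \<open>p\<close> onto that
  of \<open>P\<close>; later arguments use them instead of the image of \<open>P\<close>. Reality holds because \<open>cnjm P\<close> projects onto the
  same subspace.\<close>

lemma transported_projection:
  fixes A B :: "complex^'n::finite^'n"
  assumes p: "hermitian_projection p" and AB: "A ** B = mat 1" and real: "cnjm p = p" "cnjm B = B"
  defines "P \<equiv> hermitian_projection_onto ((*v) B ` range ((*v) p))"
  shows "P ** P = P" "cnjm P = P" "transpose P = P" "P ** (B ** p) = B ** p" "p ** (A ** P) = A ** P"
proof -
  have pp: "p ** p = p" using p by (auto simp: hermitian_projection_iff)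
  obtain Q where "hermitian_projection Q" "range ((*v) Q) = (*v) B ` range ((*v) p)"
    using hermitian_projection_exists[OF p AB] by blast
  then have P: "hermitian_projection P" "range ((*v) P) = (*v) B ` range ((*v) p)"
    unfolding P_def by (simp_all add: hermitian_projection_onto)
  then show "P ** P = P" by (simp add: hermitian_projection_def)
  have B: "P *v (B *v (p *v x)) = B *v (p *v x)" for x
    using P hermitian_projection_fixes[OF P(1), of "B *v (p *v x)"] by auto
  then show PBp: "P ** (B ** p) = B ** p" by (simp add: matrix_eq mat_simps)
  have "\<exists>y. P *v x = B *v (p *v y)" for x using P(2) by (metis (no_types, lifting) imageE rangeI)
  then have "p *v (A *v (P *v x)) = A *v (P *v x)" for x
    by (metis AB pp matrix_vector_mul_assoc matrix_vector_mul_lid)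
  then show pAP: "p ** (A ** P) = A ** P" by (simp add: matrix_eq mat_simps)
  have cA: "cnjm A = A"
    using AB real by (metis cnjm_mat cnjm_mult complex_cnj_one matrix_left_right_inverse matrix_mul_assoc matrix_mul_lid matrix_mul_rid)
  have BA: "B ** A = mat 1" using AB matrix_left_right_inverse by blast
  have 1: "cnjm P ** (B ** p) = B ** p" using arg_cong[OF PBp, of cnjm] by (simp add: cnjm_mult real)
  have 2: "p ** (A ** cnjm P) = A ** cnjm P" using arg_cong[OF pAP, of cnjm] by (simp add: cnjm_mult real cA)
  have "cnjm P ** P = P"
  proof -
    have "P = B ** p ** (A ** P)" by (metis pAP BA matrix_mul_assoc matrix_mul_lid)
    then show ?thesis by (metis 1 matrix_mul_assoc)
  qed
  moreover have "P ** cnjm P = cnjm P"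
  proof -
    have "cnjm P = B ** p ** (A ** cnjm P)" by (metis 2 BA matrix_mul_assoc matrix_mul_lid)
    then show ?thesis by (metis PBp matrix_mul_assoc)
  qed
  moreover have "adj P = P" "adj (cnjm P) = cnjm P"
    using P(1) hermitian_projection_cnjm[OF P(1)] by (auto simp: hermitian_projection_iff)
  ultimately show c: "cnjm P = P" by (metis adj_mult)
  then show "transpose P = P" using \<open>adj P = P\<close> by (simp add: adj_def)
qed

text \<open>The product rule at a zero of one factor needs only continuity of the other factor.\<close>

lemma has_derivative_product_vanishing:
  fixes a :: "'a::real_normed_vector \<Rightarrow> 'b::real_normed_vector"
  assumes bl: "bounded_bilinear pr" and a: "(a has_derivative a') (at u)" "a u = 0"
    and Q: "isCont Q u"
  shows "((\<lambda>x. pr (Q x) (a x)) has_derivative (\<lambda>v. pr (Q u) (a' v))) (at u)"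
proof -
  interpret bounded_bilinear pr by (rule bl)
  have "((\<lambda>x. pr (Q x - Q u) (a x)) has_derivative (\<lambda>v. 0)) (at u)"
  proof -
    obtain K where K: "K > 0" "\<And>x y. norm (pr x y) \<le> norm x * norm y * K" using pos_bounded by blast
    obtain L where L: "L > 0" "\<And>v. norm (a' v) \<le> norm v * L"
      using bounded_linear.pos_bounded[OF has_derivative_bounded_linear[OF a(1)]] by blast
    show ?thesis
      unfolding has_derivative_at_alt
    proof (intro conjI allI impI)
      fix e :: real assume e: "e > 0"
      \<comment> \<open>Here \<open>1 + L\<close> is a Lipschitz constant of \<open>a\<close> at its zero \<open>u\<close>.\<close>
      define e' where "e' = e / (K * (1 + L))"
      have e': "e' > 0" using e K L by (simp add: e'_def)
      obtain d1 where d1: "d1 > 0" "\<And>y. norm (y - u) < d1 \<Longrightarrow> norm (a y - a u - a' (y - u)) \<le> 1 * norm (y - u)"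
        using a(1) unfolding has_derivative_at_alt by (meson zero_less_one)
      obtain d2 where d2: "d2 > 0" "\<And>y. dist y u < d2 \<Longrightarrow> dist (Q y) (Q u) < e'"
        using Q e' unfolding continuous_at_eps_delta by blast
      show "\<exists>d>0. \<forall>y. norm (y - u) < d \<longrightarrow>
         norm (pr (Q y - Q u) (a y) - pr (Q u - Q u) (a u) - 0) \<le> e * norm (y - u)"
      proof (intro exI[of _ "min d1 d2"] conjI allI impI)
        fix y assume y: "norm (y - u) < min d1 d2"
        have "norm (a y) \<le> norm (a y - a' (y - u)) + norm (a' (y - u))" by (metis norm_triangle_sub add.commute)
        also have "\<dots> \<le> norm (y - u) + norm (y - u) * L"
          using d1(2)[of y] y a(2) L(2)[of "y - u"] by (intro add_mono) auto
        finally have 1: "norm (a y) \<le> norm (y - u) * (1 + L)" by (simp add: algebra_simps)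
        have "norm (pr (Q y - Q u) (a y)) \<le> norm (Q y - Q u) * norm (a y) * K" by (rule K)
        also have "\<dots> \<le> e' * (norm (y - u) * (1 + L)) * K"
          using 1 d2(2)[of y] y K L by (intro mult_right_mono mult_mono) (auto simp: dist_norm less_imp_le[OF e'])
        also have "\<dots> = e * norm (y - u)" using K L by (simp add: e'_def)
        finally show "norm (pr (Q y - Q u) (a y) - pr (Q u - Q u) (a u) - 0) \<le> e * norm (y - u)"
          by (simp add: zero_left)
      qed (use d1 d2 in auto)
    qed simp
  qed
  from has_derivative_add[OF this bounded_linear.has_derivative[OF bounded_linear_right[of "Q u"] a(1)]]
  show ?thesis by (simp add: diff_left)
qed

lemma norm_matrix_le:
  fixes A :: "complex^'n::finite^'m::finite"
  assumes "\<And>i j. norm (A $ i $ j) \<le> 1"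
  shows "norm A \<le> real CARD('m) * real CARD('n)"
proof -
  have "norm (A $ i) \<le> real CARD('n)" for i
    unfolding norm_vec_def[of "A $ i"]
    by (rule order_trans[OF L2_set_le_sum]) (use sum_bounded_above[of UNIV "\<lambda>j. norm (A $ i $ j)" 1] assms in auto)
  then show ?thesis
    unfolding norm_vec_def[of A]
    by (intro order_trans[OF L2_set_le_sum]) (use sum_bounded_above[of UNIV "\<lambda>j. norm (A $ j)" "real CARD('n)"] in auto)
qed

text \<open>The diagonal entries of \<open>P P\<^sup>* = P\<close> bound all entries by \<open>1\<close>.\<close>

lemma real_projection_bounded:
  fixes P :: "complex^'n::finite^'n"
  assumes "P ** P = P" "cnjm P = P" "transpose P = P"
  shows "norm P \<le> real CARD('n) * real CARD('n)"
proof (rule norm_matrix_le)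
  fix i j
  have e: "P $ k $ i = cnj (P $ i $ k)" for k
  proof -
    have "P $ k $ i = cnjm (transpose P) $ k $ i" by (simp only: assms)
    then show ?thesis by (simp add: transpose_nth)
  qed
  have "P $ i $ i = (\<Sum>k\<in>UNIV. P $ i $ k * P $ k $ i)"
  proof -
    have "P $ i $ i = (P ** P) $ i $ i" by (simp only: assms(1))
    then show ?thesis by (simp add: matrix_matrix_mult_def)
  qed
  also have "\<dots> = of_real (\<Sum>k\<in>UNIV. (norm (P $ i $ k))\<^sup>2)"
    unfolding e[of _] complex_norm_square[symmetric] of_real_sum ..
  finally have "norm (P $ i $ i) = norm (complex_of_real (\<Sum>k\<in>UNIV. (norm (P $ i $ k))\<^sup>2))"
    by (rule arg_cong)
  then have ii: "norm (P $ i $ i) = (\<Sum>k\<in>UNIV. (norm (P $ i $ k))\<^sup>2)"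
    unfolding norm_of_real by (simp add: sum_nonneg)
  have le: "(norm (P $ i $ k))\<^sup>2 \<le> norm (P $ i $ i)" for k
    unfolding ii by (rule member_le_sum) auto
  have "norm (P $ i $ i) \<le> 1"
  proof (rule ccontr)
    assume "\<not> norm (P $ i $ i) \<le> 1"
    then have "1 * norm (P $ i $ i) < norm (P $ i $ i) * norm (P $ i $ i)"
      by (intro mult_strict_right_mono) auto
    then show False using le[of i] by (simp add: power2_eq_square)
  qed
  then have "(norm (P $ i $ j))\<^sup>2 \<le> 1" using le[of j] by linarith
  then show "norm (P $ i $ j) \<le> 1" by (simp add: abs_square_le_1)
qed

text \<open>No inverse matrix has to be differentiated: with \<open>B = A\<inverse>\<close>,
  \<open>P x - P u = (1 - P x) (B x - B u) p A(u) P(u) - P x (A x - A u)\<^sup>t (1 - p) B(u)\<^sup>t (1 - P u)\<close>,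
  because \<open>P x B(x) p = B(x) p\<close> and \<open>P x A(x)\<^sup>t (1 - p) = 0\<close>. Projections are bounded, so this identity
  first gives continuity of \<open>P\<close> at \<open>u\<close>, and then \<open>has_derivative_product_vanishing\<close> its derivative.\<close>

lemma moving_projection_has_derivative:
  fixes A B P :: "'a::real_normed_vector \<Rightarrow> complex^'n::finite^'n"
  assumes U: "open U" "u \<in> U"
    and A: "(A has_derivative A') (at u)" and B: "(B has_derivative B') (at u)"
    and AB: "\<And>x. x \<in> U \<Longrightarrow> A x ** B x = mat 1"
    and p: "transpose p = p"
    and P: "\<And>x. x \<in> U \<Longrightarrow> P x ** P x = P x" "\<And>x. x \<in> U \<Longrightarrow> cnjm (P x) = P x"
      "\<And>x. x \<in> U \<Longrightarrow> transpose (P x) = P x" "\<And>x. x \<in> U \<Longrightarrow> P x ** (B x ** p) = B x ** p"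
      "\<And>x. x \<in> U \<Longrightarrow> p ** (A x ** P x) = A x ** P x"
  shows "(P has_derivative (\<lambda>v. (mat 1 - P u) ** (B' v ** (p ** (A u ** P u)))
      - P u ** (transpose (A' v) ** ((mat 1 - p) ** (transpose (B u) ** (mat 1 - P u)))))) (at u)"
proof -
  define a where "a x = transpose (A x - A u) ** ((mat 1 - p) ** (transpose (B u) ** (mat 1 - P u)))" for x
  define b where "b x = (B x - B u) ** (p ** (A u ** P u))" for x
  have BA: "B x ** A x = mat 1" if "x \<in> U" for x using AB[OF that] matrix_left_right_inverse by blast
  have tAB: "transpose (A u) ** transpose (B u) = mat 1"
    using BA[OF U(2)] by (metis matrix_transpose_mul transpose_mat)
  have PA: "P x ** (transpose (A x) ** p) = P x ** transpose (A x)" if "x \<in> U" for x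
    using arg_cong[OF P(5)[OF that], of transpose] by (simp add: matrix_transpose_mul p P(3)[OF that] matrix_mul_assoc)
  have PB: "p ** (transpose (B x) ** P x) = p ** transpose (B x)" if "x \<in> U" for x
    using arg_cong[OF P(4)[OF that], of transpose] by (simp add: matrix_transpose_mul p P(3)[OF that] matrix_mul_assoc)
  have decomp: "P x = P u + ((mat 1 - P x) ** b x - P x ** a x)" if x: "x \<in> U" for x
  proof -
    have 1: "P x ** (B x ** (p ** M)) = B x ** (p ** M)" for M
      using P(4)[OF x] by (metis matrix_mul_assoc)
    have 2: "B u ** (p ** (A u ** P u)) = P u"
      unfolding P(5)[OF U(2)] using BA[OF U(2)] by (simp add: matrix_mul_assoc)
    have 3: "P x ** (transpose (A x) ** (p ** M)) = P x ** (transpose (A x) ** M)" for M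
      using PA[OF x] by (metis matrix_mul_assoc)
    have 4: "p ** (transpose (B u) ** P u) = p ** transpose (B u)" by (rule PB[OF U(2)])
    have 5: "transpose (A u) ** (transpose (B u) ** M) = M" for M
      using tAB by (simp add: matrix_mul_assoc)
    \<comment> \<open>\<open>A(x)\<^sup>t Z\<close> is annihilated by \<open>P x\<close>, while \<open>A(u)\<^sup>t Z = 1 - P u\<close>.\<close>
    define Z where "Z = (mat 1 - p) ** (transpose (B u) ** (mat 1 - P u))"
    have "P x ** (transpose (A x) ** Z) = 0"
      unfolding Z_def by (simp add: mat_simps 3)
    moreover have "transpose (A u) ** Z = mat 1 - P u"
      unfolding Z_def by (simp add: mat_simps 4 5 tAB)
    moreover have "a x = transpose (A x) ** Z - transpose (A u) ** Z"
      by (simp only: a_def Z_def transpose_diff matrix_sub_rdistrib'[of "transpose (A x)"])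
    ultimately have "P x ** a x = P x ** P u - P x"
      by (simp add: matrix_sub_ldistrib')
    moreover have "(mat 1 - P x) ** b x = P x ** P u - P u"
      unfolding b_def by (simp add: mat_simps 1 2)
    ultimately show ?thesis by simp
  qed
  have da: "(a has_derivative (\<lambda>v. transpose (A' v) ** ((mat 1 - p) ** (transpose (B u) ** (mat 1 - P u))))) (at u)"
    unfolding a_def
    by (rule has_derivative_eq_rhs[OF bounded_linear.has_derivative[OF bounded_bilinear.bounded_linear_left[OF bounded_bilinear_matrix_mult]
          bounded_linear.has_derivative[OF bounded_linear_transpose has_derivative_diff[OF A has_derivative_const]]]]) simp
  have db: "(b has_derivative (\<lambda>v. B' v ** (p ** (A u ** P u)))) (at u)"
    unfolding b_def
    by (rule has_derivative_eq_rhs[OF bounded_linear.has_derivative[OF bounded_bilinear.bounded_linear_left[OF bounded_bilinear_matrix_mult]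
          has_derivative_diff[OF B has_derivative_const]]]) simp
  have a0: "a u = 0" and b0: "b u = 0" by (simp_all add: a_def b_def matrix_zero_left transpose_def vec_eq_iff[of _ 0] zero_vec_def[symmetric])
  have contP: "isCont P u"
  proof -
    obtain K where K: "K > 0" "\<And>(A :: complex^'n^'n) (B :: complex^'n^'n). norm (A ** B) \<le> norm A * norm B * K"
      using bounded_bilinear.pos_bounded[OF bounded_bilinear_matrix_mult[where 'a = complex]] by metis
    define C where "C = real CARD('n) * real CARD('n)"
    define C' where "C' = norm (mat 1 :: complex^'n^'n) + C"
    have C: "norm (P x) \<le> C" "norm (mat 1 - P x) \<le> C'" if "x \<in> U" for x
    proof -
      show "norm (P x) \<le> C" unfolding C_def by (intro real_projection_bounded P that)
      then show "norm (mat 1 - P x) \<le> C'"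
        unfolding C'_def using norm_triangle_ineq4[of "mat 1" "P x"] by linarith
    qed
    have "((\<lambda>x. P x - P u) \<longlongrightarrow> 0) (at u)"
    proof (rule Lim_null_comparison)
      show "\<forall>\<^sub>F x in at u. norm (P x - P u) \<le> C' * norm (b x) * K + C * norm (a x) * K"
        using eventually_at_in_open'[OF U]
      proof eventually_elim
        fix x assume x: "x \<in> U"
        have "norm (P x - P u) = norm ((mat 1 - P x) ** b x - P x ** a x)"
          using decomp[OF x] by (metis add_diff_cancel_left')
        also have "\<dots> \<le> norm (mat 1 - P x) * norm (b x) * K + norm (P x) * norm (a x) * K"
          by (rule order_trans[OF norm_triangle_ineq4 add_mono[OF K(2) K(2)]])
        also have "\<dots> \<le> C' * norm (b x) * K + C * norm (a x) * K"
          using C[OF x] K by (intro add_mono mult_right_mono) auto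
        finally show "norm (P x - P u) \<le> C' * norm (b x) * K + C * norm (a x) * K" .
      qed
      have "(a \<longlongrightarrow> a u) (at u)" "(b \<longlongrightarrow> b u) (at u)"
        using has_derivative_continuous[OF da] has_derivative_continuous[OF db] by (simp_all add: continuous_at)
      then have "((\<lambda>x. C' * norm (b x) * K + C * norm (a x) * K) \<longlongrightarrow> C' * norm (b u) * K + C * norm (a u) * K) (at u)"
        by (intro tendsto_intros)
      then show "((\<lambda>x. C' * norm (b x) * K + C * norm (a x) * K) \<longlongrightarrow> 0) (at u)" by (simp add: a0 b0)
    qed
    then show ?thesis unfolding isCont_def by (rule LIM_zero_cancel)
  qed
  have "((\<lambda>x. P u + ((mat 1 - P x) ** b x - P x ** a x)) has_derivative
      (\<lambda>v. 0 + ((mat 1 - P u) ** (B' v ** (p ** (A u ** P u)))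
      - P u ** (transpose (A' v) ** ((mat 1 - p) ** (transpose (B u) ** (mat 1 - P u))))))) (at u)"
    by (intro has_derivative_add has_derivative_const has_derivative_diff
        has_derivative_product_vanishing[OF bounded_bilinear_matrix_mult da a0]
        has_derivative_product_vanishing[OF bounded_bilinear_matrix_mult db b0] contP continuous_intros)
  then show ?thesis
    unfolding add_0 by (rule has_derivative_transform_within_open[OF _ U decomp[symmetric]])
qed

section \<open>Holomorphic matrix functions\<close>

lemma near_infinity_tendsto:
  assumes "mat_holomorphic_near_infinity M C"
  shows "(M \<longlongrightarrow> C) at_infinity"
proof (intro vec_tendstoI)
  fix i j
  define f where "f = (\<lambda>w. (if w = 0 then C else M (1 / w)) $ i $ j)"
  obtain r where "r > 0" "f holomorphic_on ball 0 r"
    using assms unfolding mat_holomorphic_near_infinity_def mat_holomorphic_on_def f_def by blast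
  then have "isCont f 0"
    using holomorphic_on_imp_continuous_on[of f "ball 0 r"] by (simp add: continuous_on_eq_continuous_at)
  then have "(f \<longlongrightarrow> C $ i $ j) (at 0)" by (simp add: isCont_def f_def)
  then have "((\<lambda>w. M (inverse w) $ i $ j) \<longlongrightarrow> C $ i $ j) (at 0)"
    by (rule Lim_transform_eventually)
      (auto simp: f_def inverse_eq_divide eventually_at_filter)
  then show "((\<lambda>z. M z $ i $ j) \<longlongrightarrow> C $ i $ j) at_infinity"
    by (simp add: lim_at_infinity_0 o_def)
qed

lemma mat_holomorphic_on_mult:
  "mat_holomorphic_on M S \<Longrightarrow> mat_holomorphic_on N S \<Longrightarrow> mat_holomorphic_on (\<lambda>z. M z ** N z) S"
  unfolding mat_holomorphic_on_def matrix_matrix_mult_def by (auto intro!: holomorphic_intros)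

text \<open>Near infinity \<open>M = g' - M (g - 1)\<close>. As \<open>g - 1\<close> is small there, \<open>M\<close> is bounded, and then the same
  identity shows that \<open>M\<close> tends to \<open>1\<close>; Liouville's theorem applies to its entries.\<close>

lemma entire_factor_trivial:
  fixes M g g' :: "complex \<Rightarrow> complex^'m::finite^'m"
  assumes M: "mat_holomorphic_on M UNIV"
    and g: "(g \<longlongrightarrow> mat 1) at_infinity" and g': "(g' \<longlongrightarrow> mat 1) at_infinity"
    and eq: "\<forall>\<^sub>F z in at_infinity. M z ** g z = g' z"
  shows "M z = mat 1"
proof -
  obtain K where K: "K > 0" "\<And>(A :: complex^'m^'m) (B :: complex^'m^'m). norm (A ** B) \<le> norm A * norm B * K"
    using bounded_bilinear.pos_bounded[OF bounded_bilinear_matrix_mult[where 'a = complex]] by metis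
  define e where "e z = norm (g z - mat 1) * K" for z
  have e: "(e \<longlongrightarrow> 0) at_infinity"
  proof -
    have "(e \<longlongrightarrow> norm (mat 1 - mat 1 :: complex^'m^'m) * K) at_infinity"
      unfolding e_def by (intro tendsto_intros g)
    then show ?thesis by simp
  qed
  have "\<forall>\<^sub>F z in at_infinity. e z < 1/2" by (rule order_tendstoD(2)[OF e]) simp
  with eq have "\<forall>\<^sub>F z in at_infinity. norm (M z - mat 1) \<le> norm (g' z - mat 1) + 2 * norm (g' z) * e z"
  proof eventually_elim
    case (elim z)
    define N where "N = M z ** (g z - mat 1)"
    have M: "M z = g' z - N"
      using elim(1) by (simp add: N_def matrix_sub_ldistrib')
    have b: "norm N \<le> norm (M z) * e z"
      using K(2)[of "M z" "g z - mat 1"] by (simp add: e_def N_def mult_ac)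
    also have "\<dots> \<le> norm (M z) * (1/2)" using elim(2) by (intro mult_left_mono) auto
    finally have "norm N \<le> norm (M z) / 2" by simp
    moreover have "norm (M z) \<le> norm (g' z) + norm N"
      unfolding M by (rule norm_triangle_ineq4)
    ultimately have "norm (M z) \<le> 2 * norm (g' z)" by simp
    then have "norm (M z) * e z \<le> 2 * norm (g' z) * e z"
      using K by (intro mult_right_mono) (auto simp: e_def)
    moreover have "norm (M z - mat 1) = norm ((g' z - mat 1) - N)" unfolding M by (simp add: algebra_simps)
    ultimately show ?case
      using b norm_triangle_ineq4[of "g' z - mat 1" N] by linarith
  qed
  moreover have "((\<lambda>z. norm (g' z - mat 1) + 2 * norm (g' z) * e z) \<longlongrightarrow> 0) at_infinity"
  proof -
    have "((\<lambda>z. norm (g' z - mat 1) + 2 * norm (g' z) * e z)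
        \<longlongrightarrow> norm (mat 1 - mat 1 :: complex^'m^'m) + 2 * norm (mat 1 :: complex^'m^'m) * 0) at_infinity"
      by (intro tendsto_intros g' e)
    then show ?thesis by simp
  qed
  ultimately have "((\<lambda>z. M z - mat 1) \<longlongrightarrow> 0) at_infinity"
    by (rule Lim_null_comparison)
  then have lim: "(M \<longlongrightarrow> mat 1) at_infinity" by (rule LIM_zero_cancel)
  have "M z $ i $ j = mat 1 $ i $ j" for i j
    by (rule Liouville_weak[of "\<lambda>z. M z $ i $ j"])
      (use M lim in \<open>auto simp: mat_holomorphic_on_def intro!: tendsto_vec_nth\<close>)
  then show ?thesis by (simp add: vec_eq_iff)
qed

text \<open>The entire function that extends the difference quotient over the removable singularity.\<close>

definition diff_quot :: "complex \<Rightarrow> (complex \<Rightarrow> complex) \<Rightarrow> complex \<Rightarrow> complex" where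
  "diff_quot a f z = (if z = a then deriv f a else (f z - f a) / (z - a))"

definition mat_diff_quot :: "complex \<Rightarrow> (complex \<Rightarrow> complex^'n^'m) \<Rightarrow> complex \<Rightarrow> complex^'n^'m" where
  "mat_diff_quot a M z = (\<chi> i j. diff_quot a (\<lambda>z. M z $ i $ j) z)"

definition vec_diff_quot :: "complex \<Rightarrow> (complex \<Rightarrow> complex^'m) \<Rightarrow> complex \<Rightarrow> complex^'m" where
  "vec_diff_quot a x z = (\<chi> i. diff_quot a (\<lambda>z. x z $ i) z)"

lemma diff_quot_holomorphic: "f holomorphic_on UNIV \<Longrightarrow> diff_quot a f holomorphic_on UNIV"
  unfolding diff_quot_def[abs_def] by (rule pole_lemma_open) auto

lemma mat_diff_quot_eq: "z \<noteq> a \<Longrightarrow> mat_diff_quot a M z = smat (1 / (z - a)) (M z - M a)"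
  by (simp add: mat_diff_quot_def diff_quot_def vec_eq_iff)

lemma vec_diff_quot_eq: "z \<noteq> a \<Longrightarrow> vec_diff_quot a M z = (1 / (z - a)) *s (M z - M a)"
  by (simp add: vec_diff_quot_def diff_quot_def vec_eq_iff diff_divide_distrib)

lemma mat_holomorphic_const: "mat_holomorphic_on (\<lambda>z. M) S" by (simp add: mat_holomorphic_on_def)

lemma mat_holomorphic_add: "mat_holomorphic_on M S \<Longrightarrow> mat_holomorphic_on N S \<Longrightarrow> mat_holomorphic_on (\<lambda>z. M z + N z) S"
  by (auto simp: mat_holomorphic_on_def intro!: holomorphic_intros)

lemma mat_holomorphic_diff: "mat_holomorphic_on M S \<Longrightarrow> mat_holomorphic_on N S \<Longrightarrow> mat_holomorphic_on (\<lambda>z. M z - N z) S"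
  by (auto simp: mat_holomorphic_on_def intro!: holomorphic_intros)

lemma mat_holomorphic_smat: "c holomorphic_on S \<Longrightarrow> mat_holomorphic_on M S \<Longrightarrow> mat_holomorphic_on (\<lambda>z. smat (c z) (M z)) S"
  by (auto simp: mat_holomorphic_on_def intro!: holomorphic_intros)

lemmas mat_holomorphic_intros = mat_holomorphic_const mat_holomorphic_add mat_holomorphic_diff
  mat_holomorphic_smat mat_holomorphic_on_mult holomorphic_on_const

lemma matvec_holomorphic:
  "(\<And>i j. (\<lambda>z. M z $ i $ j) holomorphic_on S) \<Longrightarrow> (\<And>i. (\<lambda>z. x z $ i) holomorphic_on S) \<Longrightarrow> (\<lambda>z. (M z *v x z) $ i) holomorphic_on S"
  by (simp add: matrix_vector_mult_def) (intro holomorphic_intros; simp)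

lemma mat_holomorphic_upper_block:
  assumes "mat_holomorphic_on A S" "\<And>i. (\<lambda>z. b z $ i) holomorphic_on S" "d holomorphic_on S"
  shows "mat_holomorphic_on (\<lambda>z. upper_block (A z) (b z) (d z)) S"
  unfolding mat_holomorphic_on_def
proof (intro allI)
  fix i j
  show "(\<lambda>z. upper_block (A z) (b z) (d z) $ i $ j) holomorphic_on S"
    by (cases i; cases j) (use assms in \<open>simp_all add: mat_holomorphic_on_def\<close>)
qed

lemma mat_holomorphic_isCont:
  assumes "mat_holomorphic_on M UNIV" shows "isCont M z"
proof -
  have "isCont (\<lambda>z. M z $ i $ j) z" for i j
    using assms holomorphic_on_imp_continuous_on[of "\<lambda>z. M z $ i $ j" UNIV]
    by (simp add: mat_holomorphic_on_def continuous_on_eq_continuous_at)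
  then show ?thesis unfolding isCont_def by (intro vec_tendstoI) 
qed

section \<open>Curvature of diagonal metrics\<close>

lemma partial_deriv_eq: "(f has_derivative f') (at u) \<Longrightarrow> partial_deriv i f u = f' (axis i 1)"
  by (simp add: partial_deriv_def frechet_derivative_at[symmetric])

lemma partial_deriv_cong:
  assumes V: "open V" "u \<in> V" and eq: "\<And>x. x \<in> V \<Longrightarrow> f x = g x"
  shows "partial_deriv i f u = partial_deriv i g u"
proof -
  have "(f has_derivative D) (at u) \<longleftrightarrow> (g has_derivative D) (at u)" for D
    using has_derivative_transform_within_open[OF _ V] eq by metis
  then show ?thesis by (simp add: partial_deriv_def frechet_derivative_def)
qed

lemma smooth_partial: "smooth_on V f \<Longrightarrow> smooth_on V (partial_deriv i f)"
  unfolding partial_deriv_def[abs_def] by (rule smooth_on_frechet)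

lemma diag_metric_nth: "diag_metric h u $ i $ j = (if i = j then (h u $ i)\<^sup>2 else 0)"
  by (simp add: diag_metric_def)

lemma diag_metric_inv:
  assumes nz: "\<And>i. h u $ i \<noteq> 0"
  shows "matrix_inv (diag_metric h u) $ k $ l = (if k = l then 1 / (h u $ k)\<^sup>2 else 0)"
proof -
  define D where "D = (\<chi> k l. if k = l then 1 / (h u $ k)\<^sup>2 else 0)"
  have 1: "diag_metric h u ** D = mat 1" "D ** diag_metric h u = mat 1"
    using nz by (simp_all add: vec_eq_iff matrix_matrix_mult_def diag_metric_def D_def mat_def mult_delta_left)
  then have ex: "\<exists>A'. diag_metric h u ** A' = mat 1 \<and> A' ** diag_metric h u = mat 1" by blast
  have "D = D ** (diag_metric h u ** matrix_inv (diag_metric h u))"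
    using someI_ex[OF ex] by (simp add: matrix_inv_def)
  then have D: "D = matrix_inv (diag_metric h u)" by (simp add: matrix_mul_assoc 1)
  show ?thesis unfolding D[symmetric] by (simp add: D_def)
qed

text \<open>If all second derivatives of \<open>f\<close> are tangential, their coefficients in the basis of first
  derivatives are the Christoffel symbols of the induced metric. Differentiating once more, the
  symmetry of the third derivatives of \<open>f\<close> is the vanishing of the curvature tensor.\<close>

lemma riemann_zero_of_tangential:
  fixes f :: "real^'n::finite \<Rightarrow> 'b::euclidean_space" and h :: "real^'n \<Rightarrow> real^'n"
  assumes V: "open V" and f: "smooth_on V f" and h: "smooth_on V h"
    and nz: "\<And>u i. u \<in> V \<Longrightarrow> h u $ i \<noteq> 0"
    and orth: "\<And>u i j. u \<in> V \<Longrightarrow> partial_deriv i f u \<bullet> partial_deriv j f u = diag_metric h u $ i $ j"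
    and tang: "\<And>u i j. u \<in> V \<Longrightarrow> \<exists>c. partial_deriv i (partial_deriv j f) u = (\<Sum>k\<in>UNIV. c k *\<^sub>R partial_deriv k f u)"
    and u: "u \<in> V"
  shows "riemann (diag_metric h) l k i j u = 0"
proof -
  define e where "e j = partial_deriv j f" for j
  define s where "s i j = partial_deriv i (e j)" for i j
  define G where "G k i j x = s i j x \<bullet> e k x * inverse (h x $ k * h x $ k)" for k i j x
  have e: "smooth_on V (e j)" for j unfolding e_def by (rule smooth_partial[OF f])
  have s: "smooth_on V (s i j)" for i j unfolding s_def by (rule smooth_partial[OF e])
  have G: "smooth_on V (G k i j)" for k i j
    unfolding G_def[abs_def]
    by (intro smooth_on_bilinear[OF bounded_bilinear_mult] smooth_on_bilinear[OF bounded_bilinear_inner]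
        smooth_on_inverse smooth_on_nth V s e h) (simp add: nz)
  note ee = orth[folded e_def, unfolded diag_metric_nth]
  have der: "(g has_derivative frechet_derivative g (at x)) (at x)" if "smooth_on V g" "x \<in> V"
    for g :: "real^'n \<Rightarrow> 'c::real_normed_vector" and x
    by (rule smooth_on_has_derivative[OF V that])
  have s_sym: "s i j x = s j i x" if "x \<in> V" for i j x
    unfolding s_def e_def partial_deriv_def[abs_def]
    by (rule symmetric_second_derivative[OF V f that])
  have dg: "partial_deriv i (\<lambda>x. diag_metric h x $ j $ l) x = s i j x \<bullet> e l x + e j x \<bullet> s i l x"
    if x: "x \<in> V" for i j l x
  proof -
    have "partial_deriv i (\<lambda>x. diag_metric h x $ j $ l) x = partial_deriv i (\<lambda>x. e j x \<bullet> e l x) x"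
      by (rule partial_deriv_cong[OF V x]) (simp add: e_def orth)
    also have "\<dots> = e j x \<bullet> frechet_derivative (e l) (at x) (axis i 1) + frechet_derivative (e j) (at x) (axis i 1) \<bullet> e l x"
      by (rule partial_deriv_eq[OF has_derivative_inner[OF der[OF e x] der[OF e x]]])
    finally show ?thesis by (simp add: s_def partial_deriv_def)
  qed
  have chr: "christoffel (diag_metric h) k i j x = G k i j x" if x: "x \<in> V" for k i j x
  proof -
    have alg: "(1/2) * (1 / H\<^sup>2 * ((a + b) + (a + c) - (b + c))) = a * inverse (H * H)" for a b c H :: real
      by (simp add: power2_eq_square inverse_eq_divide)
    have "christoffel (diag_metric h) k i j x = (1/2) * (1 / (h x $ k)\<^sup>2 *
        (partial_deriv i (\<lambda>x. diag_metric h x $ j $ k) x + partial_deriv j (\<lambda>x. diag_metric h x $ i $ k) x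
          - partial_deriv k (\<lambda>x. diag_metric h x $ i $ j) x))"
      unfolding christoffel_def diag_metric_inv[of h x, OF nz[OF x]] by (simp add: mult_delta_left)
    also have "\<dots> = G k i j x"
      unfolding dg[OF x] G_def s_sym[OF x, of k i] s_sym[OF x, of k j] s_sym[OF x, of j i]
        inner_commute[of "s i k x" "e j x"]
      by (rule alg)
    finally show ?thesis .
  qed
  have expand: "s i j x = (\<Sum>k\<in>UNIV. G k i j x *\<^sub>R e k x)" if x: "x \<in> V" for i j x
  proof -
    obtain c where c: "s i j x = (\<Sum>k\<in>UNIV. c k *\<^sub>R e k x)"
      using tang[OF x, of i j] unfolding s_def e_def by blast
    have "G k i j x = c k" for k
    proof -
      have "s i j x \<bullet> e k x = (\<Sum>m\<in>UNIV. if m = k then c k * (h x $ k)\<^sup>2 else 0)"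
        unfolding c inner_sum_left by (intro sum.cong) (auto simp: ee[OF x])
      then show ?thesis using nz[OF x, of k] by (simp add: G_def power2_eq_square field_simps)
    qed
    then show ?thesis using c by simp
  qed
  have ds: "partial_deriv m (s i j) u = (\<Sum>k\<in>UNIV. partial_deriv m (G k i j) u *\<^sub>R e k u + G k i j u *\<^sub>R s m k u)" for m i j
  proof -
    have "partial_deriv m (s i j) u = partial_deriv m (\<lambda>x. \<Sum>k\<in>UNIV. G k i j x *\<^sub>R e k x) u"
      by (rule partial_deriv_cong[OF V u expand])
    also have "\<dots> = (\<Sum>k\<in>UNIV. G k i j u *\<^sub>R frechet_derivative (e k) (at u) (axis m 1)
         + frechet_derivative (G k i j) (at u) (axis m 1) *\<^sub>R e k u)"
      by (rule partial_deriv_eq[OF has_derivative_sum[OF has_derivative_scaleR[OF der[OF G u] der[OF e u]]]])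
    finally show ?thesis by (simp add: s_def partial_deriv_def add.commute)
  qed
  have coef: "partial_deriv m (s i j) u \<bullet> e l u
      = (partial_deriv m (G l i j) u + (\<Sum>k\<in>UNIV. G k i j u * G l m k u)) * (h u $ l)\<^sup>2" for m i j l
  proof -
    have "s m k u \<bullet> e l u = G l m k u * (h u $ l)\<^sup>2" for k
      using nz[OF u, of l] by (simp add: G_def power2_eq_square field_simps)
    moreover have "(\<Sum>k\<in>UNIV. (partial_deriv m (G k i j) u *\<^sub>R e k u) \<bullet> e l u) = partial_deriv m (G l i j) u * (h u $ l)\<^sup>2"
      by (simp add: ee[OF u] mult_delta_right)
    ultimately show ?thesis
      unfolding ds inner_sum_left inner_add_left sum.distrib
      by (simp add: algebra_simps sum_distrib_left)
  qed
  have "partial_deriv i (s j k) u = partial_deriv j (s i k) u"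
    unfolding s_def partial_deriv_def[abs_def]
    by (rule symmetric_second_derivative[OF V e u])
  then have "partial_deriv i (s j k) u \<bullet> e l u = partial_deriv j (s i k) u \<bullet> e l u" by simp
  then have "partial_deriv i (G l j k) u + (\<Sum>m\<in>UNIV. G m j k u * G l i m u)
      = partial_deriv j (G l i k) u + (\<Sum>m\<in>UNIV. G m i k u * G l j m u)"
    unfolding coef using nz[OF u, of l] by simp
  moreover have "partial_deriv i (christoffel (diag_metric h) l j k) u = partial_deriv i (G l j k) u" for i l j k
    by (rule partial_deriv_cong[OF V u chr])
  ultimately show ?thesis
    by (simp add: riemann_def chr[OF u] sum_subtractf mult.commute)
qed

lemma flat_metric_cong:
  assumes V: "open V" and eq: "\<And>u. u \<in> V \<Longrightarrow> g u = g' u" and g: "flat_metric V g"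
  shows "flat_metric V g'"
proof -
  have chr: "christoffel g k i j u = christoffel g' k i j u" if u: "u \<in> V" for k i j u
  proof -
    have "partial_deriv i (\<lambda>x. g x $ j $ l) u = partial_deriv i (\<lambda>x. g' x $ j $ l) u" for i j l
      by (rule partial_deriv_cong[OF V u]) (simp add: eq)
    then show ?thesis by (simp add: christoffel_def eq[OF u])
  qed
  have "riemann g l k i j u = riemann g' l k i j u" if u: "u \<in> V" for l k i j u
  proof -
    have "partial_deriv i (christoffel g l j k) u = partial_deriv i (christoffel g' l j k) u" for i l j k
      by (rule partial_deriv_cong[OF V u chr])
    then show ?thesis by (simp add: riemann_def chr[OF u])
  qed
  then show ?thesis
    using g smooth_on_cong[OF V _ eq] by (auto simp: flat_metric_def riemannian_metric_def eq)
qed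

lemma riemannian_diag_metric:
  assumes V: "open V" and h: "smooth_on V h" and nz: "\<And>u i. u \<in> V \<Longrightarrow> h u $ i \<noteq> 0"
  shows "riemannian_metric V (diag_metric h)"
  unfolding riemannian_metric_def
proof (intro conjI ballI allI impI)
  have "smooth_on V (\<lambda>u. if i = j then (h u $ i)\<^sup>2 else 0)" for i j
    unfolding power2_eq_square
    by (cases "i = j") (auto intro!: V smooth_on_const smooth_on_bilinear[OF bounded_bilinear_mult] smooth_on_nth h)
  then show "smooth_on V (diag_metric h)"
    unfolding diag_metric_def[abs_def] by (intro smooth_on_vec V)
next
  fix u assume "u \<in> V"
  show "transpose (diag_metric h u) = diag_metric h u"
    by (simp add: vec_eq_iff transpose_nth diag_metric_nth)
next
  fix u v assume u: "u \<in> V" and v: "v \<noteq> (0 :: real^'a)"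
  obtain k where k: "v $ k \<noteq> 0" using v by (auto simp: vec_eq_iff)
  have "v \<bullet> (diag_metric h u *v v) = (\<Sum>i\<in>UNIV. (v $ i * h u $ i)\<^sup>2)"
    by (simp add: inner_vec_def matrix_vector_mult_def diag_metric_nth mult_delta_left mult_delta_right power2_eq_square mult_ac)
  also have "\<dots> > 0"
    by (rule sum_pos2[of _ k]) (use k nz[OF u, of k] in auto)
  finally show "v \<bullet> (diag_metric h u *v v) > 0" .
qed

section \<open>Lagrangian immersions from unitary frames\<close>

text \<open>All that the geometry uses: the equations for the derivatives of \<open>M\<close> and \<open>f\<close>, with real \<open>h\<close>,
  \<open>\<beta>\<close> and spectral parameter \<open>r\<close>, and the unitarity of \<open>M\<close>.\<close>

locale unitary_frame =
  fixes V :: "(real^'n::finite) set" and h :: "real^'n \<Rightarrow> real^'n" and \<beta> :: "real^'n \<Rightarrow> real^'n^'n"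
    and M :: "real^'n \<Rightarrow> complex^'n^'n" and f :: "real^'n \<Rightarrow> complex^'n" and r :: real
  assumes open_V: "open V" and smooth_h: "smooth_on V h" and smooth_\<beta>: "smooth_on V \<beta>"
    and h_nz: "u \<in> V \<Longrightarrow> h u $ i \<noteq> 0"
    and unitary: "u \<in> V \<Longrightarrow> adj (M u) ** M u = mat 1"
    and dM: "u \<in> V \<Longrightarrow> (M has_derivative (\<lambda>v. M u ** connection_form (cmat (\<beta> u)) (of_real r) v)) (at u)"
    and df: "u \<in> V \<Longrightarrow> (f has_derivative (\<lambda>v. M u *v (delta v *v cvec (h u)))) (at u)"
begin

lemma smooth_M: "smooth_on V M"
proof (rule smooth_on_bootstrap[OF open_V dM])
  show "Ck_on k V (\<lambda>u. M u ** connection_form (cmat (\<beta> u)) (of_real r) v)" if "Ck_on k V M" for k v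
    unfolding connection_form_def
    by (intro Ck_matrix_intros open_V that Ck_on_bounded_linear[OF bounded_linear_cmat] smooth_onD[OF smooth_\<beta>])
qed

lemma smooth_f: "smooth_on V f"
proof (rule smooth_on_bootstrap[OF open_V df])
  show "Ck_on k V (\<lambda>u. M u *v (delta v *v cvec (h u)))" for k v
    by (intro Ck_matrix_intros open_V smooth_onD[OF smooth_M]
        Ck_on_bounded_linear[OF bounded_linear_cvec] smooth_onD[OF smooth_h])
qed

lemma differential_f: "u \<in> V \<Longrightarrow> differential f u = (\<lambda>v. M u *v (delta v *v cvec (h u)))"
  using frechet_derivative_at[OF df] by metis

lemma partial_f: "u \<in> V \<Longrightarrow> partial_deriv i f u = M u *v (delta (axis i 1) *v cvec (h u))"
  by (simp add: partial_deriv_def differential_f)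

lemma hermitian_product: assumes "u \<in> V"
  shows "(\<Sum>k\<in>UNIV. cnj ((M u *v x) $ k) * (M u *v z) $ k) = (\<Sum>k\<in>UNIV. cnj (x $ k) * z $ k)"
proof -
  have "dot (cnjv (M u *v x)) (M u *v z) = dot (cnjv x) (adj (M u) *v (M u *v z))"
    by (simp only: cnjv_matvec dot_matvec adj_def)
  also have "\<dots> = dot (cnjv x) z" by (simp add: matrix_vector_mul_assoc unitary[OF assms])
  finally show ?thesis by (simp add: dot_def)
qed

lemma inner_M: "u \<in> V \<Longrightarrow> (M u *v x) \<bullet> (M u *v z) = x \<bullet> z"
  by (simp only: inner_complex_vec hermitian_product)

lemma inner_partial: assumes "u \<in> V"
  shows "partial_deriv i f u \<bullet> partial_deriv j f u = diag_metric h u $ i $ j"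
  unfolding partial_f[OF assms] inner_M[OF assms] delta_cvec
proof -
  have "hadamard (axis i 1) (h u) $ k * hadamard (axis j 1) (h u) $ k
      = (if k = i then if i = j then (h u $ i)\<^sup>2 else 0 else 0)" for k
    by (auto simp: hadamard_nth axis_def power2_eq_square)
  then have "(\<Sum>k\<in>UNIV. hadamard (axis i 1) (h u) $ k * hadamard (axis j 1) (h u) $ k)
      = (if i = j then (h u $ i)\<^sup>2 else 0)" by simp
  then show "cvec (hadamard (axis i 1) (h u)) \<bullet> cvec (hadamard (axis j 1) (h u)) = diag_metric h u $ i $ j"
    by (simp add: inner_complex_vec diag_metric_nth flip: of_real_mult of_real_sum)
qed

lemma first_form: "u \<in> V \<Longrightarrow> first_fundamental_form f u = diag_metric h u"
  by (simp add: vec_eq_iff first_fundamental_form_def inner_partial)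

text \<open>The first summand will be normal to the immersion, being \<open>\<i>\<close> times a tangent vector; the second is
  \<open>M\<close> applied to a real vector and thus tangent by \<open>tangent\<close>.\<close>

lemma second_derivative: assumes u: "u \<in> V"
  shows "frechet_derivative (\<lambda>x. differential f x v') (at u) v
     = M u *v ((\<i> * of_real r) *s (delta v *v (delta v' *v cvec (h u))))
     + M u *v cvec (hadamard v' (frechet_derivative h (at u) v)
        + (hadamard v (\<beta> u *v hadamard v' (h u)) - \<beta> u *v hadamard v (hadamard v' (h u))))"
proof -
  have "((\<lambda>x. M x *v (delta v' *v cvec (h x))) has_derivative
      (\<lambda>v. M u *v (delta v' *v cvec (frechet_derivative h (at u) v)) + (M u ** connection_form (cmat (\<beta> u)) (of_real r) v) *v (delta v' *v cvec (h u)))) (at u)"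
    by (intro matvec_has_derivative dM[OF u]
        bounded_linear.has_derivative[OF bounded_bilinear.bounded_linear_right[OF bounded_bilinear_matrix_vector]]
        bounded_linear.has_derivative[OF bounded_linear_cvec] smooth_on_has_derivative[OF open_V smooth_h u])
  then have "((\<lambda>x. differential f x v') has_derivative
      (\<lambda>v. M u *v (delta v' *v cvec (frechet_derivative h (at u) v)) + (M u ** connection_form (cmat (\<beta> u)) (of_real r) v) *v (delta v' *v cvec (h u)))) (at u)"
    by (rule has_derivative_transform_within_open[OF _ open_V u]) (simp add: differential_f)
  note eq = frechet_derivative_at[OF this, symmetric]
  have c: "cmat (\<beta> u) *v cvec x = cvec (\<beta> u *v x)" for x
    by (simp add: vec_eq_iff matrix_vector_mult_def)
  have a: "cvec x + cvec x' = cvec (x + x')" "cvec x - cvec x' = cvec (x - x')" for x x' :: "real^'n"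
    by (simp_all add: vec_eq_iff)
  have "connection_form (cmat (\<beta> u)) (of_real r) v *v (delta v' *v cvec (h u))
     = (\<i> * of_real r) *s (delta v *v (delta v' *v cvec (h u)))
      + (cvec (hadamard v (\<beta> u *v hadamard v' (h u))) - cvec (\<beta> u *v hadamard v (hadamard v' (h u))))"
    unfolding connection_form_def matrix_vector_mult_add_rdistrib matrix_vector_mult_diff_rdistrib smat_matvec
      matrix_vector_mul_assoc[symmetric] by (simp only: delta_cvec c)
  then show ?thesis
    unfolding eq
    by (simp only: matrix_vector_mul_assoc[symmetric] delta_cvec a[symmetric] matrix_vector_right_distrib
        matrix_vector_mult_diff_distrib) (simp add: algebra_simps)
qed

lemma tangent: assumes u: "u \<in> V"
  shows "M u *v cvec x = differential f u (\<chi> i. x $ i / h u $ i)"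
  unfolding differential_f[OF u] delta_cvec using h_nz[OF u] by (simp add: hadamard_nth)

lemma differential_sum: assumes u: "u \<in> V"
  shows "differential f u x = (\<Sum>k\<in>UNIV. (x $ k) *\<^sub>R partial_deriv k f u)"
proof -
  note lin = has_derivative_linear[OF smooth_on_has_derivative[OF open_V smooth_f u]]
  have "x = (\<Sum>k\<in>UNIV. (x $ k) *\<^sub>R axis k 1)"
    using basis_expansion[of x] by (simp add: scalar_mult_eq_scaleR)
  then have "differential f u x = differential f u (\<Sum>k\<in>UNIV. (x $ k) *\<^sub>R axis k 1)" by simp
  then show ?thesis by (simp add: linear_sum[OF lin] linear_cmul[OF lin] partial_deriv_def)
qed

text \<open>At spectral parameter \<open>0\<close> the normal part of the second derivatives is zero.\<close>

lemma flat_diag_metric: assumes r0: "r = 0"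
  shows "flat_metric V (diag_metric h)"
  unfolding flat_metric_def
proof (intro conjI ballI allI riemannian_diag_metric open_V smooth_h h_nz)
  fix u l k i j assume u: "u \<in> V"
  show "riemann (diag_metric h) l k i j u = 0"
  proof (rule riemann_zero_of_tangential[OF open_V smooth_f smooth_h h_nz inner_partial _ u])
    fix u i j assume u: "u \<in> V"
    have "partial_deriv i (partial_deriv j f) u = frechet_derivative (\<lambda>x. differential f x (axis j 1)) (at u) (axis i 1)"
      by (simp add: partial_deriv_def[abs_def])
    then show "\<exists>c. partial_deriv i (partial_deriv j f) u = (\<Sum>k\<in>UNIV. c k *\<^sub>R partial_deriv k f u)"
      unfolding second_derivative[OF u] tangent[OF u] differential_sum[OF u] r0 by auto
  qed
qed

lemma immersion: "immersion_on V f"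
  unfolding immersion_on_def
proof (intro conjI ballI smooth_f injI)
  fix u x z assume u: "u \<in> V" and eq: "differential f u x = differential f u z"
  have "delta x *v cvec (h u) = delta z *v cvec (h u)"
    using arg_cong[OF eq[unfolded differential_f[OF u]], of "\<lambda>x. adj (M u) *v x"]
    by (simp add: matrix_vector_mul_assoc matrix_mul_assoc unitary[OF u])
  then show "x = z" using h_nz[OF u] by (simp add: delta_cvec vec_eq_iff hadamard_nth)
qed

lemma lagrangian: "lagrangian_on V f"
  unfolding lagrangian_on_def
  by (intro ballI allI) (simp add: differential_f hermitian_product delta_cvec)

lemma second_form: assumes u: "u \<in> V"
  shows "second_fundamental_form f u v v' = r *\<^sub>R (\<Sum>i\<in>UNIV. (v $ i * v' $ i) *\<^sub>R (\<i> *s partial_deriv i f u))"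
proof -
  define N where "N = M u *v ((\<i> * of_real r) *s (delta v *v (delta v' *v cvec (h u))))"
  have N: "N = r *\<^sub>R (\<Sum>i\<in>UNIV. (v $ i * v' $ i) *\<^sub>R (\<i> *s partial_deriv i f u))"
  proof -
    have "delta v *v (delta v' *v cvec (h u)) = delta (\<chi> i. v $ i * v' $ i) *v cvec (h u)"
      by (simp add: vec_eq_iff delta_matvec)
    then have "N = (\<i> * of_real r) *s differential f u (\<chi> i. v $ i * v' $ i)"
      by (simp add: N_def differential_f[OF u] matvec_smult)
    also have "\<dots> = r *\<^sub>R (\<Sum>i\<in>UNIV. (v $ i * v' $ i) *\<^sub>R (\<i> *s partial_deriv i f u))"
      unfolding differential_sum[OF u]
      by (simp add: vec_eq_iff sum_distrib_left scaleR_conv_of_real[of _ "_ :: complex"] mult_ac)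
    finally show ?thesis .
  qed
  have normal: "differential f u x \<bullet> N = 0" for x
    unfolding differential_f[OF u] N_def inner_M[OF u]
    by (simp add: delta_cvec inner_complex_vec)
  have lin: "linear (differential f u)"
    by (rule has_derivative_linear[OF smooth_on_has_derivative[OF open_V smooth_f u]])
  obtain x0 where x0: "frechet_derivative (\<lambda>y. differential f y v') (at u) v - N = differential f u x0"
    unfolding second_derivative[OF u] tangent[OF u] N_def by auto
  have "second_fundamental_form f u v v' = N"
    unfolding second_fundamental_form_def
  proof (rule the_equality)
    show "(\<forall>x. differential f u x \<bullet> N = 0) \<and>
        frechet_derivative (\<lambda>y. differential f y v') (at u) v - N \<in> range (differential f u)"
      using normal x0 by auto
  next
    fix N' assume N': "(\<forall>x. differential f u x \<bullet> N' = 0) \<and>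
        frechet_derivative (\<lambda>y. differential f y v') (at u) v - N' \<in> range (differential f u)"
    then obtain x1 where x1: "frechet_derivative (\<lambda>y. differential f y v') (at u) v - N' = differential f u x1" by blast
    have "N' - N = differential f u (x0 - x1)"
      unfolding linear_diff[OF lin] x0[symmetric] x1[symmetric] by simp
    moreover have "differential f u (x0 - x1) \<bullet> (N' - N) = 0"
      using N' normal by (simp add: inner_diff_right)
    ultimately show "N' = N" by simp
  qed
  then show ?thesis using N by simp
qed

end

section \<open>The extended frame of a flat Egoroff metric\<close>

text \<open>Here \<open>p\<close> is the projection \<open>\<pi>\<close> of the dressing loop and \<open>P\<close> the projection \<open>\<pi>t\<close>
  transported by the frame.\<close>

locale egoroff_dressing =
  fixes U :: "(real^'n::finite) set"
    and h :: "real^'n \<Rightarrow> real^'n" and \<phi> :: "real^'n \<Rightarrow> real" and \<beta> :: "real^'n \<Rightarrow> real^'n^'n"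
    and E :: "real^'n \<Rightarrow> complex \<Rightarrow> complex^'n^'n" and X :: "real^'n \<Rightarrow> complex \<Rightarrow> complex^'n"
    and F :: "real^'n \<Rightarrow> complex \<Rightarrow> complex^('n option)^('n option)"
    and \<alpha> :: real and p :: "complex^'n^'n"
    and P :: "real^'n \<Rightarrow> complex^'n^'n" and \<eta> :: "real^'n \<Rightarrow> complex^'n"
  assumes open_U: "open U" and connected_U: "connected U" and zero_U: "0 \<in> U"
    and egoroff: "flat_egoroff U h \<phi>"
    and \<beta>_eq: "\<And>u. \<beta> u = rotation_coeffs h u"
    and ext_frame: "extended_frame U h F"
    and F_eq: "\<And>u z. F u z = upper_block (E u z) (X u z) 1"
    and \<alpha>_nz: "\<alpha> \<noteq> 0"
    and herm: "hermitian_projection p" and real_p: "map_matrix cnj p = p"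
    and P_eq: "\<And>u. P u = hermitian_projection_onto
                        ((*v) (matrix_inv (E u (\<i> * of_real \<alpha>))) ` range ((*v) p))"
    and \<eta>_eq: "\<And>u. \<eta> u = transpose (E u (\<i> * of_real \<alpha>)) *v X u (- \<i> * of_real \<alpha>)"
begin

lemma smooth_h: "smooth_on U h" using egoroff by (simp add: flat_egoroff_def)

lemma h_nz: assumes "u \<in> U" shows "h u $ i \<noteq> 0"
proof -
  have "axis i 1 \<bullet> (diag_metric h u *v axis i (1::real)) > 0"
    using egoroff assms by (simp add: flat_egoroff_def flat_metric_def riemannian_metric_def axis_eq_0_iff)
  then show ?thesis
    by (simp add: inner_axis' matrix_vector_mult_basis column_def diag_metric_def)
qed

lemma partial_h: "u \<in> U \<Longrightarrow> partial_deriv j (\<lambda>x. h x $ i) u = frechet_derivative h (at u) (axis j 1) $ i"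
  unfolding partial_deriv_def
  by (subst frechet_derivative_at[OF bounded_linear.has_derivative[OF bounded_linear_vec_nth smooth_on_has_derivative[OF open_U smooth_h]], symmetric]) auto

lemma smooth_\<beta>: "smooth_on U \<beta>"
proof -
  have "smooth_on U (\<lambda>u. if i = j then 0 else frechet_derivative h (at u) (axis j 1) $ i * inverse (h u $ j))" for i j
    by (cases "i = j") (auto intro!: smooth_intros open_U smooth_on_bilinear[OF bounded_bilinear_mult]
       smooth_on_nth smooth_on_frechet smooth_h simp: h_nz)
  then have "smooth_on U (\<lambda>u. \<chi> i j. if i = j then 0 else frechet_derivative h (at u) (axis j 1) $ i * inverse (h u $ j))"
    by (intro smooth_on_vec open_U)
  then show ?thesis
    by (rule smooth_on_cong[OF open_U])
      (auto simp: \<beta>_eq rotation_coeffs_def partial_h divide_inverse vec_eq_iff)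
qed

lemma \<phi>_derivative: "u \<in> U \<Longrightarrow> (\<phi> has_derivative (\<lambda>v. \<Sum>i\<in>UNIV. v $ i * (h u $ i)\<^sup>2)) (at u)"
proof -
  assume u: "u \<in> U"
  have d: "(\<phi> has_derivative frechet_derivative \<phi> (at u)) (at u)"
    and pd: "\<And>i. frechet_derivative \<phi> (at u) (axis i 1) = (h u $ i)\<^sup>2"
    using egoroff u by (auto simp: flat_egoroff_def has_potential_def frechet_derivative_works[symmetric] partial_deriv_def)
  have "frechet_derivative \<phi> (at u) v = (\<Sum>i\<in>UNIV. v $ i * (h u $ i)\<^sup>2)" for v
  proof -
    note lin = has_derivative_linear[OF d]
    have "v = (\<Sum>i\<in>UNIV. (v $ i) *\<^sub>R axis i 1)"
      using basis_expansion[of v] by (simp add: scalar_mult_eq_scaleR)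
    then have "frechet_derivative \<phi> (at u) v = frechet_derivative \<phi> (at u) (\<Sum>i\<in>UNIV. (v $ i) *\<^sub>R axis i 1)" by simp
    also have "\<dots> = (\<Sum>i\<in>UNIV. v $ i * (h u $ i)\<^sup>2)"
      by (simp add: linear_sum[OF lin] linear_cmul[OF lin] pd)
    finally show ?thesis .
  qed
  with d show ?thesis by (metis (no_types, lifting) ext)
qed

lemma smooth_\<phi>: "smooth_on U \<phi>"
  by (rule smooth_on_bootstrap[OF open_U \<phi>_derivative], assumption, rule smooth_onD, unfold power2_eq_square)
    (intro smooth_intros open_U smooth_on_bilinear[OF bounded_bilinear_mult] smooth_on_nth smooth_h)

text \<open>The second derivatives of the potential: \<open>\<partial>\<^sub>j (h\<^sub>i\<^sup>2) = \<partial>\<^sub>i (h\<^sub>j\<^sup>2)\<close>.\<close>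

lemma sym_\<beta>: assumes u: "u \<in> U" shows "transpose (\<beta> u) = \<beta> u"
proof -
  have d: "frechet_derivative (\<lambda>x. frechet_derivative \<phi> (at x) (axis i 1)) (at u) (axis j 1)
      = 2 * h u $ i * frechet_derivative h (at u) (axis j 1) $ i" for i j
  proof -
    have eq: "frechet_derivative \<phi> (at x) (axis i 1) = (h x $ i)\<^sup>2" if "x \<in> U" for x
      using egoroff that by (auto simp: flat_egoroff_def has_potential_def partial_deriv_def)
    have "((\<lambda>x. (h x $ i)\<^sup>2) has_derivative (\<lambda>v. 2 * h u $ i * frechet_derivative h (at u) v $ i)) (at u)"
      by (rule has_derivative_eq_rhs[OF has_derivative_power[OF
            bounded_linear.has_derivative[OF bounded_linear_vec_nth smooth_on_has_derivative[OF open_U smooth_h u]]]])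
        (simp add: fun_eq_iff mult_ac)
    then have "((\<lambda>x. frechet_derivative \<phi> (at x) (axis i 1)) has_derivative (\<lambda>v. 2 * h u $ i * frechet_derivative h (at u) v $ i)) (at u)"
      by (rule has_derivative_transform_within_open[OF _ open_U u]) (simp add: eq)
    then show ?thesis by (simp add: frechet_derivative_at[symmetric])
  qed
  have "h u $ i * frechet_derivative h (at u) (axis j 1) $ i = h u $ j * frechet_derivative h (at u) (axis i 1) $ j" for i j
    using symmetric_second_derivative[OF open_U smooth_\<phi> u, of "axis i 1" "axis j 1"] by (simp add: d)
  then show ?thesis
    by (auto simp: vec_eq_iff transpose_nth \<beta>_eq rotation_coeffs_def partial_h u frac_eq_eq h_nz mult.commute)
qed

abbreviation "C u v \<equiv> delta v ** cmat (\<beta> u) - cmat (\<beta> u) ** delta v"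

lemma E0: "E 0 z = mat 1" and X0: "X 0 z = 0"
proof -
  have "F 0 z = mat 1" using ext_frame by (simp add: extended_frame_def)
  then show "E 0 z = mat 1" "X 0 z = 0" by (simp_all add: F_eq mat_1_upper_block upper_block_eq_iff)
qed

lemma dE: "u \<in> U \<Longrightarrow> ((\<lambda>x. E x z) has_derivative (\<lambda>v. E u z ** connection_form (cmat (\<beta> u)) z v)) (at u)"
  and dX: "u \<in> U \<Longrightarrow> ((\<lambda>x. X x z) has_derivative (\<lambda>v. E u z *v (delta v *v cvec (h u)))) (at u)"
proof -
  have "((\<lambda>x. F x z) has_derivative (\<lambda>v. F u z ** frame_form (h u) (\<beta> u) z v)) (at u)" if "u \<in> U" for u z
    using ext_frame that by (simp add: extended_frame_def frame_equation_def \<beta>_eq)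
  note * = iffD1[OF frame_derivative_iff[of F E X, OF F_eq] this]
  show "((\<lambda>x. E x z) has_derivative (\<lambda>v. E u z ** connection_form (cmat (\<beta> u)) z v)) (at u)" if "u \<in> U" for z
    using *[OF that] by blast
  show "((\<lambda>x. X x z) has_derivative (\<lambda>v. E u z *v (delta v *v cvec (h u)))) (at u)" if "u \<in> U" for z
    using *[OF that] by blast
qed

lemma holo_E: "u \<in> U \<Longrightarrow> (\<lambda>z. E u z $ i $ j) holomorphic_on UNIV"
  and holo_X: "u \<in> U \<Longrightarrow> (\<lambda>z. X u z $ i) holomorphic_on UNIV"
proof -
  assume "u \<in> U"
  then have *: "(\<lambda>z. F u z $ i' $ j') holomorphic_on UNIV" for i' j'
    using ext_frame by (simp add: extended_frame_def mat_holomorphic_on_def)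
  show "(\<lambda>z. E u z $ i $ j) holomorphic_on UNIV" using *[of "Some i" "Some j"] by (simp add: F_eq)
  show "(\<lambda>z. X u z $ i) holomorphic_on UNIV" using *[of "Some i" None] by (simp add: F_eq)
qed

sublocale flat_connection U E \<beta>
  by unfold_locales (auto simp: open_U connected_U zero_U E0 sym_\<beta> dE)

lemma reality_X: assumes "u \<in> U" shows "cnjv (X u (cnj z)) = X u (- z)"
proof -
  have "((\<lambda>x. cnjv (X x (cnj z)) - X x (- z)) has_derivative (\<lambda>v. 0)) (at u)" if u: "u \<in> U" for u
    by (rule has_derivative_eq_rhs[OF has_derivative_diff[OF
          bounded_linear.has_derivative[OF bounded_linear_cnjv dX[OF u]] dX[OF u]]])
      (use reality[OF u] in \<open>simp add: fun_eq_iff cnjv_matvec\<close>)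
  from constant_on_U[OF this assms] show ?thesis by (simp add: X0 vec_eq_iff)
qed

text \<open>\<open>A\<close> is the frame at the pole \<open>w\<close> of the dressing loop, \<open>B\<close> its inverse, and \<open>\<Omega>\<close> the connection form
  there: \<open>dA = A \<Omega>\<close>.\<close>

abbreviation "w \<equiv> \<i> * complex_of_real \<alpha>"

abbreviation "A u \<equiv> E u w"

abbreviation "B u \<equiv> transpose (E u (- w))"

abbreviation "\<Omega> u v \<equiv> C u v - smat (of_real \<alpha>) (delta v)"

lemma connection_form_w: "connection_form (cmat (\<beta> u)) w v = \<Omega> u v" "connection_form (cmat (\<beta> u)) (- w) v = C u v + smat (of_real \<alpha>) (delta v)"
  by (simp_all add: connection_form_def vec_eq_iff)

lemma transpose_\<Omega>: "u \<in> U \<Longrightarrow> transpose (\<Omega> u v) = - C u v - smat (of_real \<alpha>) (delta v)"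
  by (simp add: transpose_simps sym_c)

lemma transpose_\<Omega>': "u \<in> U \<Longrightarrow> transpose (C u v + smat (of_real \<alpha>) (delta v)) = - \<Omega> u v"
  by (simp add: transpose_simps sym_c)

lemma AB: "u \<in> U \<Longrightarrow> A u ** B u = mat 1" by (rule transpose_inverse)

lemma BA: "u \<in> U \<Longrightarrow> B u ** A u = mat 1" by (rule transpose_inverse')

lemma tAB: "u \<in> U \<Longrightarrow> transpose (A u) ** E u (- w) = mat 1" by (rule transpose_inverse2')

lemma cnjm_A: "u \<in> U \<Longrightarrow> cnjm (A u) = A u" using reality[of u "- w"] by simp

lemma cnjm_B: "u \<in> U \<Longrightarrow> cnjm (B u) = B u" using reality[of u w] by (simp add: cnjm_transpose)

lemma P_eq': "u \<in> U \<Longrightarrow> P u = hermitian_projection_onto ((*v) (B u) ` range ((*v) p))"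
  unfolding P_eq by (simp add: matrix_inv_eq[OF AB])

lemma pp: "p ** p = p" using herm by (simp add: hermitian_projection_def)

lemma tp: "transpose p = p" using herm real_p by (simp add: hermitian_projection_def)

lemma projection_facts: assumes u: "u \<in> U"
  shows PP: "P u ** P u = P u" and cnjm_P: "cnjm (P u) = P u" and transpose_P: "transpose (P u) = P u"
    and PBp: "P u ** (B u ** p) = B u ** p" and pAP: "p ** (A u ** P u) = A u ** P u"
  using transported_projection[OF herm AB[OF u] real_p cnjm_B[OF u]] by (simp_all add: P_eq'[OF u])

lemma dA: "u \<in> U \<Longrightarrow> (A has_derivative (\<lambda>v. A u ** \<Omega> u v)) (at u)"
  using dE[of u w] by (simp add: connection_form_w)

lemma dB: assumes u: "u \<in> U" shows "(B has_derivative (\<lambda>v. - (\<Omega> u v ** B u))) (at u)"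
  using bounded_linear.has_derivative[OF bounded_linear_transpose dE[OF u, of "- w"]]
  unfolding connection_form_w matrix_transpose_mul transpose_\<Omega>'[OF u] matrix_minus_left .

definition dP where "dP u v = smat (of_real \<alpha>) (delta v ** P u + P u ** delta v)
   - smat (2 * of_real \<alpha>) (P u ** (delta v ** P u)) + P u ** C u v - C u v ** P u"

text \<open>By \<open>moving_projection_has_derivative\<close> the derivative is
  \<open>- (1 - P) \<Omega> P - P \<Omega>\<^sup>t (1 - P)\<close>, which expands to \<open>dP\<close>.\<close>

lemma P_derivative: assumes u: "u \<in> U" shows "(P has_derivative dP u) (at u)"
proof -
  have BM: "B u ** (A u ** M) = M" for M by (simp add: matrix_mul_assoc BA u)
  have 1: "B u ** (p ** (A u ** P u)) = P u" by (simp add: pAP[OF u] BM)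
  have 3: "p ** (E u (- w) ** P u) = p ** E u (- w)"
    using arg_cong[OF PBp[OF u], of transpose] by (simp add: matrix_transpose_mul tp transpose_P[OF u] matrix_mul_assoc)
  have 4: "transpose (A u) ** ((mat 1 - p) ** (transpose (B u) ** (mat 1 - P u))) = mat 1 - P u"
    using tAB[OF u] by (simp add: mat_simps 3) (simp add: matrix_mul_assoc)
  have PPM: "P u ** (P u ** M) = P u ** M" for M by (simp add: matrix_mul_assoc PP[OF u])
  show ?thesis
  proof (rule has_derivative_eq_rhs[OF moving_projection_has_derivative[where p = p, OF open_U u dA[OF u] dB[OF u]]])
    show "(\<lambda>v. (mat 1 - P u) ** (- (\<Omega> u v ** B u) ** (p ** (A u ** P u))) -
         P u ** (transpose (A u ** \<Omega> u v) ** ((mat 1 - p) ** (transpose (B u) ** (mat 1 - P u))))) = dP u"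
    proof
      fix v
      have "(mat 1 - P u) ** (- (\<Omega> u v ** B u) ** (p ** (A u ** P u))) = (mat 1 - P u) ** (- (\<Omega> u v ** P u))"
        by (simp only: matrix_minus_left matrix_mul_assoc[symmetric] 1)
      moreover have "transpose (A u ** \<Omega> u v) ** ((mat 1 - p) ** (transpose (B u) ** (mat 1 - P u)))
          = (- C u v - smat (of_real \<alpha>) (delta v)) ** (mat 1 - P u)"
        by (simp only: matrix_transpose_mul[of "A u"] transpose_\<Omega>[OF u] matrix_mul_assoc[symmetric] 4)
      ultimately show "(mat 1 - P u) ** (- (\<Omega> u v ** B u) ** (p ** (A u ** P u))) -
         P u ** (transpose (A u ** \<Omega> u v) ** ((mat 1 - p) ** (transpose (B u) ** (mat 1 - P u)))) = dP u v"
        unfolding dP_def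
        by (simp add: mat_simps PP[OF u] PPM) (simp add: vec_eq_iff algebra_simps)
    qed
  qed (use AB tp projection_facts in auto)
qed

lemma \<eta>_derivative: assumes u: "u \<in> U"
  shows "(\<eta> has_derivative (\<lambda>v. delta v *v cvec (h u) - (C u v + smat (of_real \<alpha>) (delta v)) *v \<eta> u)) (at u)"
proof -
  have "((\<lambda>u. transpose (A u) *v X u (- w)) has_derivative
     (\<lambda>v. transpose (A u) *v (E u (- w) *v (delta v *v cvec (h u))) + transpose (A u ** \<Omega> u v) *v X u (- w))) (at u)"
    by (rule matvec_has_derivative[OF bounded_linear.has_derivative[OF bounded_linear_transpose dA[OF u]] dX[OF u]])
  moreover have "transpose (A u) *v (E u (- w) *v x) = x" for x
    by (simp add: matrix_vector_mul_assoc tAB[OF u])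
  moreover have "transpose (A u ** \<Omega> u v) *v X u (- w) = - ((C u v + smat (of_real \<alpha>) (delta v)) *v \<eta> u)" for v
  proof -
    have "transpose (A u ** \<Omega> u v) *v X u (- w) = (- C u v - smat (of_real \<alpha>) (delta v)) *v \<eta> u"
      by (simp only: matrix_transpose_mul[of "A u"] transpose_\<Omega>[OF u] matrix_vector_mul_assoc[symmetric] \<eta>_eq) simp
    then show ?thesis by (simp add: mat_simps)
  qed
  moreover have "\<eta> = (\<lambda>u. transpose (A u) *v X u (- w))" by (simp add: fun_eq_iff \<eta>_eq)
  ultimately show ?thesis by simp
qed

definition y where "y u = P u *v \<eta> u"

definition dy where "dy u v = of_real \<alpha> *s (delta v *v y u) - (2 * of_real \<alpha>) *s (P u *v (delta v *v y u))
   - C u v *v y u + P u *v (delta v *v cvec (h u))"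

lemma Py: "u \<in> U \<Longrightarrow> P u *v y u = y u" by (simp add: y_def matrix_vector_mul_assoc PP)

lemma y_derivative: assumes u: "u \<in> U" shows "(y has_derivative dy u) (at u)"
proof -
  have "((\<lambda>u. P u *v \<eta> u) has_derivative (\<lambda>v. P u *v (delta v *v cvec (h u) - (C u v + smat (of_real \<alpha>) (delta v)) *v \<eta> u)
      + dP u v *v \<eta> u)) (at u)"
    by (rule matvec_has_derivative[OF P_derivative[OF u] \<eta>_derivative[OF u]])
  moreover have "P u *v (delta v *v cvec (h u) - (C u v + smat (of_real \<alpha>) (delta v)) *v \<eta> u) + dP u v *v \<eta> u = dy u v" for v
    unfolding dP_def dy_def y_def
    by (simp add: mat_simps)
  ultimately show ?thesis by (simp add: y_def[abs_def])
qed

end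

section \<open>The dressed metric, potential and rotation coefficients\<close>

context egoroff_dressing
begin

lemma smooth_cmat_\<beta>: "smooth_on U (\<lambda>u. cmat (\<beta> u))"
  by (rule smooth_on_bounded_linear[OF bounded_linear_cmat open_U smooth_\<beta>])

lemma smooth_cvec_h: "smooth_on U (\<lambda>u. cvec (h u))"
  by (rule smooth_on_bounded_linear[OF bounded_linear_cvec open_U smooth_h])

lemma smooth_P: "smooth_on U P"
proof (rule smooth_on_bootstrap[OF open_U P_derivative])
  show "Ck_on k U (\<lambda>u. dP u v)" if "Ck_on k U P" for k v
    unfolding dP_def
    by (intro Ck_matrix_intros open_U that smooth_onD[OF smooth_cmat_\<beta>])
qed

lemma smooth_\<eta>: "smooth_on U \<eta>"
proof (rule smooth_on_bootstrap[OF open_U \<eta>_derivative])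
  show "Ck_on k U (\<lambda>u. delta v *v cvec (h u) - (C u v + smat (of_real \<alpha>) (delta v)) *v \<eta> u)"
    if "Ck_on k U \<eta>" for k v
    by (intro Ck_matrix_intros open_U that smooth_onD[OF smooth_cmat_\<beta>] smooth_onD[OF smooth_cvec_h])
qed

lemma smooth_y: "smooth_on U y"
  unfolding y_def[abs_def]
  by (rule smooth_on_bilinear[OF bounded_bilinear_matrix_vector open_U smooth_P smooth_\<eta>])

lemma cnjv_\<eta>: assumes "u \<in> U" shows "cnjv (\<eta> u) = \<eta> u"
proof -
  have "cnjv (\<eta> u) = cnjm (transpose (A u)) *v cnjv (X u (- w))" by (simp only: \<eta>_eq cnjv_matvec) simp
  also have "cnjm (transpose (A u)) = transpose (A u)" by (simp add: cnjm_transpose cnjm_A assms)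
  also have "cnjv (X u (- w)) = X u (- w)" using reality_X[OF assms, of w] by simp
  finally show ?thesis by (simp add: \<eta>_eq)
qed

lemma cnjv_y: "u \<in> U \<Longrightarrow> cnjv (y u) = y u"
  by (simp only: y_def cnjv_matvec cnjm_P cnjv_\<eta>)

lemma y_real: "u \<in> U \<Longrightarrow> of_real (Re (y u $ i)) = y u $ i"
  using cnjv_y[of u] by (simp add: vec_eq_iff complex_eq_iff)

lemma \<eta>_real: "u \<in> U \<Longrightarrow> of_real (Re (\<eta> u $ i)) = \<eta> u $ i"
  using cnjv_\<eta>[of u] by (simp add: vec_eq_iff complex_eq_iff)

lemma P_real: "u \<in> U \<Longrightarrow> of_real (Re (P u $ i $ j)) = P u $ i $ j"
  using cnjm_P[of u] by (simp add: vec_eq_iff complex_eq_iff)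

text \<open>Real parts turn the complex formulas into real data; \<open>P\<close>, \<open>\<eta>\<close> and \<open>y\<close> are real on \<open>U\<close>, so nothing is
  lost there.\<close>

definition ht where "ht u = (\<chi> i. h u $ i - 2 * \<alpha> * Re (y u $ i))"

definition \<beta>t where "\<beta>t u = (\<chi> i j. if i = j then 0 else \<beta> u $ i $ j - 2 * \<alpha> * Re (P u $ i $ j))"

definition \<phi>t where "\<phi>t u = \<phi> u - 2 * \<alpha> * Re (dot (\<eta> u) (y u))"

lemma cvec_ht: "u \<in> U \<Longrightarrow> cvec (ht u) = cvec (h u) - (2 * of_real \<alpha>) *s y u"
  by (simp add: vec_eq_iff ht_def y_real)

lemma \<beta>_diag: "\<beta> u $ i $ i = 0" by (simp add: \<beta>_eq rotation_coeffs_def)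

lemma cmat_\<beta>t: "u \<in> U \<Longrightarrow> cmat (\<beta>t u) = cmat (\<beta> u) - smat (2 * of_real \<alpha>) (off_diagonal (P u))"
  by (simp add: vec_eq_iff \<beta>t_def off_diagonal_def P_real \<beta>_diag)

lemma sym_\<beta>t: assumes "u \<in> U" shows "transpose (\<beta>t u) = \<beta>t u"
proof -
  have "P u $ i $ j = P u $ j $ i" for i j using transpose_P[OF assms] by (metis transpose_nth)
  moreover have "\<beta> u $ i $ j = \<beta> u $ j $ i" for i j using sym_\<beta>[OF assms] by (metis transpose_nth)
  ultimately show ?thesis by (simp add: vec_eq_iff transpose_nth \<beta>t_def)
qed

lemma connection_form_\<beta>t: assumes "u \<in> U"
  shows "connection_form (cmat (\<beta>t u)) z v = smat (\<i> * z) (delta v) + C u v - smat (2 * of_real \<alpha>) (delta v ** P u - P u ** delta v)"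
  unfolding connection_form_def vec_eq_iff
  by (simp add: delta_mult_nth mult_delta_nth) (auto simp: \<beta>t_def \<beta>_diag P_real[OF assms] algebra_simps)

lemma smooth_ht: "smooth_on U ht"
  unfolding ht_def[abs_def]
  by (intro smooth_on_vec open_U smooth_on_diff smooth_on_nth smooth_h
     smooth_on_bilinear[OF bounded_bilinear_mult] smooth_on_const
     smooth_on_bounded_linear[OF bounded_linear_Re] smooth_y)

lemma smooth_\<beta>t: "smooth_on U \<beta>t"
proof -
  have "smooth_on U (\<lambda>u. if i = j then 0 else \<beta> u $ i $ j - 2 * \<alpha> * Re (P u $ i $ j))" for i j
    by (cases "i = j") (auto intro!: open_U smooth_on_diff smooth_on_nth smooth_\<beta>
     smooth_on_bilinear[OF bounded_bilinear_mult] smooth_on_const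
     smooth_on_bounded_linear[OF bounded_linear_Re] smooth_P)
  then show ?thesis
    unfolding \<beta>t_def[abs_def] by (intro smooth_on_vec open_U)
qed

lemma dot_cvec_delta: "dot (cvec x) (delta v *v cvec x) = of_real (\<Sum>i\<in>UNIV. v $ i * (x $ i)\<^sup>2)"
  by (simp add: dot_def delta_matvec power2_eq_square mult_ac)

text \<open>By \<open>\<eta>_derivative\<close> and \<open>y_derivative\<close>, \<open>d(\<eta>\<^sup>t y) = 2 y\<^sup>t \<delta> h - 2\<alpha> y\<^sup>t \<delta> y\<close>: the terms with the
  skew matrix \<open>C\<close> and those with \<open>\<eta>\<^sup>t \<delta> y\<close> cancel. Completing the square gives
  \<open>d\<phi>t = (h - 2\<alpha>y)\<^sup>t \<delta> (h - 2\<alpha>y)\<close>.\<close>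

lemma \<phi>t_derivative: assumes u: "u \<in> U"
  shows "(\<phi>t has_derivative (\<lambda>v. \<Sum>i\<in>UNIV. v $ i * (ht u $ i)\<^sup>2)) (at u)"
proof -
  define d\<eta> where "d\<eta> v = delta v *v cvec (h u) - (C u v + smat (of_real \<alpha>) (delta v)) *v \<eta> u" for v
  have "((\<lambda>x. dot (\<eta> x) (y x)) has_derivative (\<lambda>v. dot (\<eta> u) (dy u v) + dot (d\<eta> v) (y u))) (at u)"
    unfolding d\<eta>_def by (rule bounded_bilinear.FDERIV[OF bounded_bilinear_dot \<eta>_derivative[OF u] y_derivative[OF u]])
  then have d: "(\<phi>t has_derivative (\<lambda>v. (\<Sum>i\<in>UNIV. v $ i * (h u $ i)\<^sup>2)
     - 2 * \<alpha> * Re (dot (\<eta> u) (dy u v) + dot (d\<eta> v) (y u)))) (at u)"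
    unfolding \<phi>t_def[abs_def]
    by (intro has_derivative_diff \<phi>_derivative[OF u] has_derivative_mult_right
        bounded_linear.has_derivative[OF bounded_linear_Re])
  have "(\<Sum>i\<in>UNIV. v $ i * (h u $ i)\<^sup>2) - 2 * \<alpha> * Re (dot (\<eta> u) (dy u v) + dot (d\<eta> v) (y u))
     = (\<Sum>i\<in>UNIV. v $ i * (ht u $ i)\<^sup>2)" for v
  proof -
    let ?a = "complex_of_real \<alpha>" and ?h = "cvec (h u)" and ?\<delta> = "delta v"
    have P: "dot (\<eta> u) (P u *v x) = dot (y u) x" for x
      using dot_matvec[of "P u" "\<eta> u" x] by (simp add: transpose_P[OF u] y_def)
    have C: "dot (C u v *v x) z = - dot x (C u v *v z)" for x z
    proof -
      have "transpose (C u v) = - C u v" by (simp add: transpose_simps sym_c[OF u])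
      then show ?thesis by (simp only: dot_matvec matvec_minus_left dot_minus)
    qed
    have D: "dot (?\<delta> *v x) z = dot x (?\<delta> *v z)" for x z
      using dot_matvec[of ?\<delta> x z] by simp
    have 1: "dot (\<eta> u) (dy u v) = ?a * dot (\<eta> u) (?\<delta> *v y u) - 2 * ?a * dot (y u) (?\<delta> *v y u)
        - dot (\<eta> u) (C u v *v y u) + dot (y u) (?\<delta> *v ?h)"
      unfolding dy_def by (simp only: dot_add dot_diff dot_smult P)
    have 2: "dot (d\<eta> v) (y u) = dot ?h (?\<delta> *v y u) + dot (\<eta> u) (C u v *v y u) - ?a * dot (\<eta> u) (?\<delta> *v y u)"
      unfolding d\<eta>_def by (simp only: matrix_vector_mult_add_rdistrib smat_matvec dot_add dot_diff dot_smult C D) simp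
    have 3: "dot (y u) (?\<delta> *v ?h) = dot ?h (?\<delta> *v y u)" using D[of "y u" ?h] by (simp add: dot_commute)
    have "complex_of_real (\<Sum>i\<in>UNIV. v $ i * (ht u $ i)\<^sup>2)
        = dot (?h - (2 * ?a) *s y u) (?\<delta> *v (?h - (2 * ?a) *s y u))"
      unfolding cvec_ht[OF u, symmetric] dot_cvec_delta ..
    also have "\<dots> = dot ?h (?\<delta> *v ?h) - 2 * ?a * (dot (\<eta> u) (dy u v) + dot (d\<eta> v) (y u))"
      unfolding 1 2 matrix_vector_mult_diff_distrib matvec_smult dot_diff dot_smult 3
      by (simp add: algebra_simps)
    also have "dot ?h (?\<delta> *v ?h) = of_real (\<Sum>i\<in>UNIV. v $ i * (h u $ i)\<^sup>2)" by (rule dot_cvec_delta)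
    finally have "Re (complex_of_real (\<Sum>i\<in>UNIV. v $ i * (ht u $ i)\<^sup>2))
        = Re (of_real (\<Sum>i\<in>UNIV. v $ i * (h u $ i)\<^sup>2) - 2 * ?a * (dot (\<eta> u) (dy u v) + dot (d\<eta> v) (y u)))"
      by (rule arg_cong)
    then show ?thesis by simp
  qed
  with d show ?thesis by (simp only:)
qed

lemma potential_t: "has_potential U ht \<phi>t"
  unfolding has_potential_def partial_deriv_def
proof (intro ballI conjI allI)
  fix u i assume u: "u \<in> U"
  show "\<phi>t differentiable at u" using \<phi>t_derivative[OF u] by (rule differentiableI)
  show "frechet_derivative \<phi>t (at u) (axis i 1) = (ht u $ i)\<^sup>2"
    unfolding frechet_derivative_at[OF \<phi>t_derivative[OF u], symmetric]
    by (simp add: axis_def if_distrib if_distribR cong: if_cong)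
qed

text \<open>In an off-diagonal entry the contributions of \<open>\<delta> y\<close> and \<open>\<delta> \<beta> y\<close> to the derivative of \<open>y\<close> vanish,
  and the remaining ones factor through \<open>ht\<close>.\<close>

lemma rotation_t: assumes u: "u \<in> U" and nz: "\<And>i. ht u $ i \<noteq> 0"
  shows "\<beta>t u = rotation_coeffs ht u"
proof -
  have pd: "partial_deriv j (\<lambda>x. ht x $ i) u = \<beta>t u $ i $ j * ht u $ j" if ij: "i \<noteq> j" for i j
  proof -
    have "((\<lambda>x. h x $ i - 2 * \<alpha> * Re (y x $ i)) has_derivative
       (\<lambda>v. frechet_derivative h (at u) v $ i - 2 * \<alpha> * Re (dy u v $ i))) (at u)"
      by (intro has_derivative_diff has_derivative_mult_right
          bounded_linear.has_derivative[OF bounded_linear_Re]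
          bounded_linear.has_derivative[OF bounded_linear_vec_nth]
          smooth_on_has_derivative[OF open_U smooth_h u] y_derivative[OF u])
    then have d: "partial_deriv j (\<lambda>x. ht x $ i) u
        = frechet_derivative h (at u) (axis j 1) $ i - 2 * \<alpha> * Re (dy u (axis j 1) $ i)"
      by (simp add: partial_deriv_def ht_def frechet_derivative_at[symmetric])
    have h: "frechet_derivative h (at u) (axis j 1) $ i = \<beta> u $ i $ j * h u $ j"
      using ij h_nz[OF u, of j] by (simp add: \<beta>_eq rotation_coeffs_def partial_h[OF u])
    have z: "(delta (axis j 1) *v x) $ i = 0" for x
      using ij by (simp add: delta_matvec axis_def)
    have "dy u (axis j 1) $ i = - 2 * of_real \<alpha> * (P u $ i $ j * y u $ j) + cmat (\<beta> u) $ i $ j * y u $ j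
         + P u $ i $ j * of_real (h u $ j)"
      unfolding dy_def by (simp add: mat_simps z matvec_delta_axis)
    also have "\<dots> = of_real (- 2 * \<alpha> * (Re (P u $ i $ j) * Re (y u $ j)) + \<beta> u $ i $ j * Re (y u $ j)
         + Re (P u $ i $ j) * h u $ j)"
      by (simp add: P_real[OF u] y_real[OF u])
    finally have e: "dy u (axis j 1) $ i = of_real (- 2 * \<alpha> * (Re (P u $ i $ j) * Re (y u $ j)) + \<beta> u $ i $ j * Re (y u $ j)
         + Re (P u $ i $ j) * h u $ j)" .
    show ?thesis
      unfolding d h e Re_complex_of_real using ij by (simp add: \<beta>t_def ht_def algebra_simps)
  qed
  show ?thesis
    unfolding rotation_coeffs_def vec_eq_iff by (auto simp: pd nz) (simp add: \<beta>t_def)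
qed

end

section \<open>The dressed frame\<close>

text \<open>The gauge transformation of \<open>s \<delta> + C\<close> by \<open>1 + K P\<close>: both sides differ by a multiple of \<open>[\<delta>, P]\<close> whose
  coefficient is zero by the assumption on \<open>K\<close>.\<close>

lemma darboux_matrix_identity:
  fixes \<delta> C P :: "complex^'n^'n"
  assumes P: "P ** P = P" and K: "K * s = - 2 * a - a * K"
  shows "(smat s \<delta> + C) ** (mat 1 + smat K P)
      + smat K (smat a (\<delta> ** P + P ** \<delta>) - smat (2 * a) (P ** (\<delta> ** P)) + P ** C - C ** P)
    = (mat 1 + smat K P) ** (smat s \<delta> + C - smat (2 * a) (\<delta> ** P - P ** \<delta>))" (is "?l = ?r")
proof -
  have PP: "P ** (P ** M) = P ** M" for M by (simp add: matrix_mul_assoc P)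
  have "?l - ?r = smat (K * s + 2 * a + a * K) (\<delta> ** P - P ** \<delta>)"
    by (simp add: mat_simps P PP) (simp add: vec_eq_iff algebra_simps)
  also have "K * s + 2 * a + a * K = 0" using K by simp
  finally show ?thesis by (simp add: smat_zero)
qed

text \<open>The same gauge transformation on the last column of the frame equation; the discrepancy is now a
  multiple of \<open>\<delta> y\<close>, with the same coefficient.\<close>

lemma darboux_vector_identity:
  fixes \<delta> C P :: "complex^'n^'n"
  assumes P: "P ** P = P" "P *v y = y" and K: "K * s = - 2 * a - a * K"
  shows "\<delta> *v h + K *s ((smat s \<delta> + C) *v y) 
      + K *s (a *s (\<delta> *v y) - (2 * a) *s (P *v (\<delta> *v y)) - C *v y + P *v (\<delta> *v h))
    = (mat 1 + smat K P) *v (\<delta> *v (h - (2 * a) *s y))" (is "?l = ?r")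
proof -
  have "?l - ?r = (K * s + 2 * a + a * K) *s (\<delta> *v y)"
    by (simp add: mat_simps P) (simp add: vec_eq_iff algebra_simps)
  also have "K * s + 2 * a + a * K = 0" using K by simp
  finally show ?thesis by simp
qed

context egoroff_dressing
begin

text \<open>The expanded forms of \<open>(1 - L p) E (1 + K P)\<close> and \<open>(1 - L p) (X + K E y)\<close>, with difference quotients
  in place of the polar terms. They are entire in \<open>z\<close>; \<open>Et_closed\<close> and \<open>Xt_closed\<close> recover the product
  forms away from the poles.\<close>

definition Et where
  "Et u z = E u z + smat (2 * w) ((mat 1 - p) ** (mat_diff_quot w (E u) z ** P u))
     - smat (2 * w) (p ** (mat_diff_quot (- w) (E u) z ** (mat 1 - P u)))"

definition Xt where
  "Xt u z = X u z + (2 * w) *s ((mat 1 - p) *v (mat_diff_quot w (E u) z *v y u))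
     - (2 * w) *s (p *v vec_diff_quot (- w) (\<lambda>z. X u z - E u z *v y u) z)"

definition Ft where "Ft u z = upper_block (Et u z) (Xt u z) 1"

definition K where "K z = 2 * w / (z - w)"

definition L where "L z = 2 * w / (z + w)"

lemma KL: "z \<noteq> w \<Longrightarrow> z \<noteq> - w \<Longrightarrow> K z - L z = K z * L z"
  unfolding K_def L_def by (auto simp: divide_simps add_eq_0_iff) (simp add: algebra_simps)

text \<open>These are the residues of the product forms of \<open>Et\<close> and \<open>Xt\<close> at \<open>w\<close> and \<open>- w\<close>. At \<open>w\<close> the frame
  maps the image of \<open>P\<close> into that of \<open>p\<close>; at \<open>- w\<close> one uses the transposed inclusion and, for \<open>X\<close>, that
  \<open>\<eta>\<close> is chosen such that \<open>E(- w) \<eta> = X(- w)\<close>.\<close>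

lemma residues: assumes u: "u \<in> U"
  shows "(mat 1 - p) ** (A u ** P u) = 0" "p ** (E u (- w) ** (mat 1 - P u)) = 0"
    "(mat 1 - p) *v (A u *v y u) = 0" "p *v (X u (- w) - E u (- w) *v y u) = 0"
proof -
  show 1: "(mat 1 - p) ** (A u ** P u) = 0" by (simp add: mat_simps pAP[OF u])
  show 2: "p ** (E u (- w) ** (mat 1 - P u)) = 0"
    using arg_cong[OF PBp[OF u], of transpose]
    by (simp add: mat_simps matrix_transpose_mul tp transpose_P[OF u])
  have "(mat 1 - p) *v (A u *v (P u *v y u)) = 0"
    using 1 by (metis matrix_vector_mul_assoc matrix_vector_mult_0)
  then show "(mat 1 - p) *v (A u *v y u) = 0" by (simp add: Py u)
  have "X u (- w) = E u (- w) *v \<eta> u"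
    by (simp add: \<eta>_eq matrix_vector_mul_assoc transpose_inverse2[OF u])
  then have "p *v (X u (- w) - E u (- w) *v y u) = (p ** (E u (- w) ** (mat 1 - P u))) *v \<eta> u"
    by (simp add: y_def mat_simps)
  then show "p *v (X u (- w) - E u (- w) *v y u) = 0" by (simp add: 2)
qed

lemma Et_closed: assumes u: "u \<in> U" and z: "z \<noteq> w" "z \<noteq> - w"
  shows "Et u z = (mat 1 - smat (L z) p) ** (E u z ** (mat 1 + smat (K z) (P u)))"
proof -
  have k: "2 * w * (1 / (z - w)) = K z" "2 * w * (1 / (z + w)) = L z" by (simp_all add: K_def L_def)
  have 1: "smat (2 * w) ((mat 1 - p) ** (mat_diff_quot w (E u) z ** P u)) = smat (K z) ((mat 1 - p) ** (E u z ** P u))"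
  proof -
    have "smat (2 * w) ((mat 1 - p) ** (mat_diff_quot w (E u) z ** P u))
      = smat (2 * w * (1 / (z - w))) ((mat 1 - p) ** (E u z ** P u) - (mat 1 - p) ** (A u ** P u))"
      unfolding mat_diff_quot_eq[OF z(1)]
      by (simp only: matrix_sub_ldistrib'[of "mat 1 - p"] matrix_sub_rdistrib'[of "E u z"] smat_mult_left smat_mult_right smat_smat)
    then show ?thesis unfolding k residues[OF u] by simp
  qed
  have 2: "smat (2 * w) (p ** (mat_diff_quot (- w) (E u) z ** (mat 1 - P u))) = smat (L z) (p ** (E u z ** (mat 1 - P u)))"
  proof -
    have "smat (2 * w) (p ** (mat_diff_quot (- w) (E u) z ** (mat 1 - P u)))
      = smat (2 * w * (1 / (z + w))) (p ** (E u z ** (mat 1 - P u)) - p ** (E u (- w) ** (mat 1 - P u)))"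
      unfolding mat_diff_quot_eq[OF z(2)]
      by (simp only: matrix_sub_ldistrib'[of p] matrix_sub_rdistrib'[of "E u z"] smat_mult_left smat_mult_right smat_smat
        diff_minus_eq_add)
    then show ?thesis unfolding k residues[OF u] by simp
  qed
  have "Et u z - (mat 1 - smat (L z) p) ** (E u z ** (mat 1 + smat (K z) (P u)))
    = smat (K z * L z - (K z - L z)) (p ** (E u z ** P u))"
    unfolding Et_def 1 2 by (simp add: mat_simps) (simp add: vec_eq_iff algebra_simps)
  also have "\<dots> = 0" unfolding KL[OF z] by (simp add: smat_zero)
  finally show ?thesis by simp
qed

lemma Xt_closed: assumes u: "u \<in> U" and z: "z \<noteq> w" "z \<noteq> - w"
  shows "Xt u z = (mat 1 - smat (L z) p) *v (X u z + K z *s (E u z *v y u))"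
proof -
  have k: "2 * w * (1 / (z - w)) = K z" "2 * w * (1 / (z + w)) = L z" by (simp_all add: K_def L_def)
  have 1: "(2 * w) *s ((mat 1 - p) *v (mat_diff_quot w (E u) z *v y u)) = K z *s ((mat 1 - p) *v (E u z *v y u))"
  proof -
    have "(2 * w) *s ((mat 1 - p) *v (mat_diff_quot w (E u) z *v y u))
      = (2 * w * (1 / (z - w))) *s ((mat 1 - p) *v (E u z *v y u) - (mat 1 - p) *v (A u *v y u))"
      unfolding mat_diff_quot_eq[OF z(1)]
      by (simp only: smat_matvec matvec_smult smult_smult matrix_vector_mult_diff_distrib[of "mat 1 - p"]
        matrix_vector_mult_diff_rdistrib[of "E u z"])
    then show ?thesis unfolding k residues[OF u] by simp
  qed
  have 2: "(2 * w) *s (p *v vec_diff_quot (- w) (\<lambda>z. X u z - E u z *v y u) z) = L z *s (p *v (X u z - E u z *v y u))"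
  proof -
    have "(2 * w) *s (p *v vec_diff_quot (- w) (\<lambda>z. X u z - E u z *v y u) z)
      = (2 * w * (1 / (z + w))) *s (p *v (X u z - E u z *v y u) - p *v (X u (- w) - E u (- w) *v y u))"
      unfolding vec_diff_quot_eq[OF z(2)]
      by (simp only: matvec_smult smult_smult matrix_vector_mult_diff_distrib[of p] diff_minus_eq_add)
    then show ?thesis unfolding k residues[OF u] by simp
  qed
  have "Xt u z - (mat 1 - smat (L z) p) *v (X u z + K z *s (E u z *v y u))
    = (K z * L z - (K z - L z)) *s (p *v (E u z *v y u))"
    unfolding Xt_def 1 2 by (simp add: mat_simps vec_eq_iff algebra_simps)
  also have "\<dots> = 0" unfolding KL[OF z] by simp
  finally show ?thesis by simp
qed

lemma K_relation: "z \<noteq> w \<Longrightarrow> K z * (\<i> * z) = - 2 * of_real \<alpha> - of_real \<alpha> * K z"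
  unfolding K_def by (simp add: divide_simps algebra_simps)

lemma Ft_derivative_regular: assumes u: "u \<in> U" and z: "z \<noteq> w" "z \<noteq> - w"
  shows "((\<lambda>x. Ft x z) has_derivative (\<lambda>v. Ft u z ** frame_form (ht u) (\<beta>t u) z v)) (at u)"
  unfolding frame_derivative_iff[of Ft Et Xt, OF Ft_def]
proof
  let ?N = "mat 1 - smat (L z) p"
  have "((\<lambda>x. ?N ** (E x z ** (mat 1 + smat (K z) (P x)))) has_derivative
     (\<lambda>v. ?N ** (E u z ** (0 + smat (K z) (dP u v)) + (E u z ** connection_form (cmat (\<beta> u)) z v) ** (mat 1 + smat (K z) (P u))))) (at u)"
    by (intro bounded_linear.has_derivative[OF bounded_bilinear.bounded_linear_right[OF bounded_bilinear_matrix_mult]]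
      matrix_has_derivative dE[OF u] has_derivative_add has_derivative_const
      bounded_linear.has_derivative[OF bounded_linear_smat] P_derivative[OF u])
  moreover have "?N ** (E u z ** (0 + smat (K z) (dP u v)) + (E u z ** connection_form (cmat (\<beta> u)) z v) ** (mat 1 + smat (K z) (P u)))
     = Et u z ** connection_form (cmat (\<beta>t u)) z v" for v
  proof -
    have "connection_form (cmat (\<beta> u)) z v ** (mat 1 + smat (K z) (P u)) + smat (K z) (dP u v)
       = (mat 1 + smat (K z) (P u)) ** connection_form (cmat (\<beta>t u)) z v"
      unfolding connection_form_\<beta>t[OF u] dP_def connection_form_def[of "cmat (\<beta> u)"]
      by (rule darboux_matrix_identity[OF PP[OF u] K_relation[OF z(1)]])
    moreover have "E u z ** (0 + smat (K z) (dP u v)) + (E u z ** connection_form (cmat (\<beta> u)) z v) ** (mat 1 + smat (K z) (P u))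
        = E u z ** (connection_form (cmat (\<beta> u)) z v ** (mat 1 + smat (K z) (P u)) + smat (K z) (dP u v))"
      by (simp only: add_0 matrix_mul_assoc [symmetric] matrix_add_ldistrib[of "E u z"] add.commute)
    ultimately show ?thesis
      unfolding Et_closed[OF u z] by (simp only: matrix_mul_assoc)
  qed
  ultimately have "((\<lambda>x. ?N ** (E x z ** (mat 1 + smat (K z) (P x)))) has_derivative (\<lambda>v. Et u z ** connection_form (cmat (\<beta>t u)) z v)) (at u)"
    by simp
  then show "((\<lambda>x. Et x z) has_derivative (\<lambda>v. Et u z ** connection_form (cmat (\<beta>t u)) z v)) (at u)"
    by (rule has_derivative_transform_within_open[OF _ open_U u]) (simp add: Et_closed z)
  have "((\<lambda>x. ?N *v (X x z + K z *s (E x z *v y x))) has_derivative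
     (\<lambda>v. ?N *v (E u z *v (delta v *v cvec (h u)) + K z *s (E u z *v dy u v + (E u z ** connection_form (cmat (\<beta> u)) z v) *v y u)))) (at u)"
    by (intro bounded_linear.has_derivative[OF bounded_bilinear.bounded_linear_right[OF bounded_bilinear_matrix_vector]]
      bounded_linear.has_derivative[OF bounded_linear_smult]
      matvec_has_derivative dE[OF u] dX[OF u] has_derivative_add y_derivative[OF u])
  moreover have "?N *v (E u z *v (delta v *v cvec (h u)) + K z *s (E u z *v dy u v + (E u z ** connection_form (cmat (\<beta> u)) z v) *v y u))
     = Et u z *v (delta v *v cvec (ht u))" for v
  proof -
    have "delta v *v cvec (h u) + K z *s (connection_form (cmat (\<beta> u)) z v *v y u) + K z *s dy u v
       = (mat 1 + smat (K z) (P u)) *v (delta v *v cvec (ht u))"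
      unfolding cvec_ht[OF u] dy_def connection_form_def
      by (rule darboux_vector_identity[OF PP[OF u] Py[OF u] K_relation[OF z(1)]])
    from arg_cong[OF this, of "\<lambda>x. ?N *v (E u z *v x)"]
    show ?thesis
      unfolding Et_closed[OF u z] matrix_vector_mul_assoc[symmetric]
      by (simp only: matrix_vector_right_distrib matvec_smult smult_add add_ac)
  qed
  ultimately have "((\<lambda>x. ?N *v (X x z + K z *s (E x z *v y x))) has_derivative (\<lambda>v. Et u z *v (delta v *v cvec (ht u)))) (at u)"
    by simp
  then show "((\<lambda>x. Xt x z) has_derivative (\<lambda>v. Et u z *v (delta v *v cvec (ht u)))) (at u)"
    by (rule has_derivative_transform_within_open[OF _ open_U u]) (simp add: Xt_closed z)
qed

lemma holo_Ft: assumes u: "u \<in> U" shows "mat_holomorphic_on (Ft u) UNIV"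
proof -
  have E: "mat_holomorphic_on (E u) UNIV" using holo_E[OF u] by (simp add: mat_holomorphic_on_def)
  have Q: "mat_holomorphic_on (mat_diff_quot a (E u)) UNIV" for a
    using diff_quot_holomorphic[OF holo_E[OF u]] by (simp add: mat_holomorphic_on_def mat_diff_quot_def)
  have Et: "mat_holomorphic_on (Et u) UNIV"
    unfolding Et_def[abs_def] by (intro mat_holomorphic_intros E Q)
  have Xy: "(\<lambda>z. (X u z - E u z *v y u) $ i) holomorphic_on UNIV" for i
    unfolding vector_minus_component
    by (intro holomorphic_intros holo_X[OF u] matvec_holomorphic holo_E[OF u])
  have R: "(\<lambda>z. vec_diff_quot (- w) (\<lambda>z. X u z - E u z *v y u) z $ i) holomorphic_on UNIV" for i
    unfolding vec_diff_quot_def using diff_quot_holomorphic[OF Xy] by simp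
  have "(\<lambda>z. Xt u z $ i) holomorphic_on UNIV" for i
    unfolding Xt_def vector_minus_component vector_add_component vector_smult_component
    by (intro holomorphic_intros holo_X[OF u] matvec_holomorphic R Q[unfolded mat_holomorphic_on_def, rule_format])
  then show ?thesis
    unfolding Ft_def[abs_def] by (intro mat_holomorphic_upper_block Et holomorphic_intros)
qed

text \<open>The poles \<open>w\<close> and \<open>- w\<close> have distance \<open>2 \<bar>\<alpha>\<bar>\<close>, so in the punctured disc of that radius around one of
  them the equation is already known.\<close>

lemma Ft_derivative: assumes u: "u \<in> U"
  shows "((\<lambda>x. Ft x z) has_derivative (\<lambda>v. Ft u z ** frame_form (ht u) (\<beta>t u) z v)) (at u)"
proof (cases "z = w \<or> z = - w")
  case False
  then show ?thesis using Ft_derivative_regular[OF u] by simp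
next
  case True
  define W where "W x v = upper_block (connection_form (cmat (\<beta>t x)) 0 v) (delta v *v cvec (ht x)) 0" for x v
  define D where "D v = upper_block (smat \<i> (delta v)) 0 0" for v :: "real^'n"
  have form: "frame_form (ht x) (\<beta>t x) z v = W x v + smat z (D v)" for x z v
    unfolding frame_form_eq W_def D_def vec_eq_option_iff by (simp add: connection_form_def)
  have linD: "linear D" and linW: "linear (W x)" for x
    unfolding D_def W_def connection_form_def
    by (rule linearI; simp add: vec_eq_option_iff linear_add[OF bounded_linear.linear[OF bounded_linear_delta]]
        linear_cmul[OF bounded_linear.linear[OF bounded_linear_delta]]
        matrix_add_rdistrib' matrix_add_ldistrib matrix_vector_mult_add_rdistrib
        bounded_bilinear.scaleR_left[OF bounded_bilinear_matrix_mult]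
        bounded_bilinear.scaleR_right[OF bounded_bilinear_matrix_mult]
        bounded_bilinear.scaleR_left[OF bounded_bilinear_matrix_vector] algebra_simps)+
  have contW: "continuous_on U (\<lambda>x. W x v)" for v
  proof -
    have "smooth_on U (\<lambda>x. connection_form (cmat (\<beta>t x)) 0 v)" "smooth_on U (\<lambda>x. delta v *v cvec (ht x))"
      unfolding connection_form_def smooth_on_def
      by (intro allI Ck_matrix_intros open_U Ck_on_bounded_linear[OF bounded_linear_cmat] smooth_onD[OF smooth_\<beta>t]
         Ck_on_bounded_linear[OF bounded_linear_cvec] smooth_onD[OF smooth_ht])+
    moreover have "W x v = upper_block (connection_form (cmat (\<beta>t x)) 0 v) 0 0
        + upper_block 0 (delta v *v cvec (ht x)) 0 + upper_block 0 0 0" for x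
      unfolding W_def by (rule upper_block_split)
    ultimately show ?thesis
      by (simp only:) (intro continuous_on_add continuous_on_const
          bounded_linear.continuous_on[OF bounded_linear_upper_block(1)]
          bounded_linear.continuous_on[OF bounded_linear_upper_block(2)] smooth_on_continuous)
  qed
  have far: "z' \<noteq> w \<and> z' \<noteq> - w" if "z' \<noteq> z" "norm (z' - z) < 2 * \<bar>\<alpha>\<bar>" for z'
  proof -
    have "norm (w - (- w)) = 2 * \<bar>\<alpha>\<bar>" "norm (- w - w) = 2 * \<bar>\<alpha>\<bar>"
      by (simp_all add: norm_mult mult_2[symmetric] del: mult_minus_right)
    then show ?thesis using that True by auto
  qed
  show ?thesis
    unfolding form
  proof (rule frame_derivative_limit[OF open_U u _ linW linD contW])
    show "0 < 2 * \<bar>\<alpha>\<bar>" using \<alpha>_nz by simp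
    show "isCont (Ft x) z" if "x \<in> U" for x by (rule mat_holomorphic_isCont[OF holo_Ft[OF that]])
    show "((\<lambda>x. Ft x z') has_derivative (\<lambda>v. Ft x z' ** (W x v + smat z' (D v)))) (at x)"
      if "x \<in> U" "z' \<noteq> z" "norm (z' - z) < 2 * \<bar>\<alpha>\<bar>" for x z'
      using Ft_derivative_regular[OF that(1)] far[OF that(2,3)] unfolding form by blast
  qed
qed

lemma dEt: "u \<in> U \<Longrightarrow> ((\<lambda>x. Et x z) has_derivative (\<lambda>v. Et u z ** connection_form (cmat (\<beta>t u)) z v)) (at u)"
  and dXt: "u \<in> U \<Longrightarrow> ((\<lambda>x. Xt x z) has_derivative (\<lambda>v. Et u z *v (delta v *v cvec (ht u)))) (at u)"
  using Ft_derivative[unfolded frame_derivative_iff[of Ft Et Xt, OF Ft_def]] by blast+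

lemma y0: "y 0 = 0" by (simp add: y_def \<eta>_eq X0)

lemma diff_quot_const: "diff_quot a (\<lambda>z. c) z = 0" by (simp add: diff_quot_def)

lemma Et0: "Et 0 z = mat 1" and Xt0: "Xt 0 z = 0"
proof -
  have Q: "mat_diff_quot a (E 0) z = 0" for a
    by (simp add: mat_diff_quot_def E0 diff_quot_const vec_eq_iff)
  have R: "vec_diff_quot a (\<lambda>z. X 0 z - E 0 z *v y 0) z = 0" for a
    by (simp add: vec_diff_quot_def X0 y0 diff_quot_const vec_eq_iff)
  show "Et 0 z = mat 1" "Xt 0 z = 0"
    unfolding Et_def Xt_def Q R by (simp_all add: E0 X0 y0 mat_simps)
qed

text \<open>The dressed frame is normalized at \<open>0\<close> and its rotation coefficients are symmetric, so it inherits
  the symmetries of the original one. In particular its inverse is entire in \<open>z\<close>.\<close>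

lemma flat_connection_t: "flat_connection U Et \<beta>t"
  by unfold_locales (auto simp: open_U connected_U zero_U Et0 sym_\<beta>t dEt)

lemmas Et_transpose_inverse = flat_connection.transpose_inverse[OF flat_connection_t]

lemmas Et_transpose_inverse' = flat_connection.transpose_inverse'[OF flat_connection_t]

lemmas Et_reality = flat_connection.reality[OF flat_connection_t]

definition Ft_inv where "Ft_inv u z = upper_block (transpose (Et u (- z))) (- (transpose (Et u (- z)) *v Xt u z)) 1"

lemma Ft_inverse: assumes "u \<in> U" shows "Ft u z ** Ft_inv u z = mat 1" "Ft_inv u z ** Ft u z = mat 1"
proof -
  show "Ft u z ** Ft_inv u z = mat 1"
    unfolding Ft_def Ft_inv_def by (rule upper_block_inverse[OF Et_transpose_inverse[OF assms]])
  then show "Ft_inv u z ** Ft u z = mat 1" by (simp add: matrix_left_right_inverse)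
qed

lemma frame_equation_t: "frame_equation U ht \<beta>t Ft"
  unfolding frame_equation_def
proof (intro ballI allI conjI)
  fix u z assume u: "u \<in> U"
  show "invertible (Ft u z)" unfolding invertible_def using Ft_inverse[OF u] by blast
  show "((\<lambda>x. Ft x z) has_derivative (\<lambda>v. Ft u z ** frame_form (ht u) (\<beta>t u) z v)) (at u)"
    by (rule Ft_derivative[OF u])
qed

lemma holo_Ft_inv: assumes u: "u \<in> U" shows "mat_holomorphic_on (Ft_inv u) UNIV"
proof -
  have F: "(\<lambda>z. Ft u z $ i $ j) holomorphic_on UNIV" for i j
    using holo_Ft[OF u] by (simp add: mat_holomorphic_on_def)
  have E: "(\<lambda>z. Et u z $ i $ j) holomorphic_on UNIV" for i j using F[of "Some i" "Some j"] by (simp add: Ft_def)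
  have X: "(\<lambda>z. Xt u z $ i) holomorphic_on UNIV" for i using F[of "Some i" None] by (simp add: Ft_def)
  have T: "(\<lambda>z. transpose (Et u (- z)) $ i $ j) holomorphic_on UNIV" for i j
    unfolding transpose_nth
    using holomorphic_on_compose[of uminus UNIV "\<lambda>z. Et u z $ j $ i"] holomorphic_on_subset[OF E[of j i]]
    by (simp add: o_def holomorphic_on_minus)
  have TX: "(\<lambda>z. (- (transpose (Et u (- z)) *v Xt u z)) $ i) holomorphic_on UNIV" for i
    unfolding vector_uminus_component by (intro holomorphic_on_minus matvec_holomorphic T X)
  show ?thesis
    unfolding Ft_inv_def[abs_def]
    by (rule mat_holomorphic_upper_block) (use T TX in \<open>simp_all add: mat_holomorphic_on_def\<close>)
qed

end

section \<open>The factorization\<close>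

context egoroff_dressing
begin

text \<open>The compensating factor on the right; its off-diagonal column \<open>- K y\<close> produces the term
  \<open>K E y\<close> in \<open>Xt\<close>.\<close>

definition gt where "gt u z = upper_block (g_simple w (P u) z) (- K z *s y u) ((z + w) / (z - w))"

lemma K_plus_1: "z \<noteq> w \<Longrightarrow> (z + w) / (z - w) = 1 + K z"
  by (simp add: K_def field_simps)

lemma g_simple_w: "z \<noteq> w \<Longrightarrow> g_simple w Q z = mat 1 + smat (K z) (mat 1 - Q)"
proof -
  assume z: "z \<noteq> w"
  have "g_simple w Q z = Q + smat (1 + K z) (mat 1 - Q)"
    using K_plus_1[OF z] by (simp add: g_simple_def mat_mult_eq_smat)
  then show ?thesis by (simp add: vec_eq_iff algebra_simps)
qed

lemma g_simple_minus_w: "z \<noteq> - w \<Longrightarrow> g_simple (- w) (mat 1 - Q) z = mat 1 - smat (L z) Q"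
proof -
  assume z: "z \<noteq> - w"
  then have "z + w \<noteq> 0" by (metis eq_neg_iff_add_eq_0)
  then have "(z - w) / (z + w) = 1 - L z" by (simp add: L_def field_simps)
  then have "g_simple (- w) (mat 1 - Q) z = mat 1 - Q + smat (1 - L z) Q"
    by (simp add: g_simple_def mat_mult_eq_smat)
  then show ?thesis by (simp add: vec_eq_iff algebra_simps)
qed

lemma factorization: assumes u: "u \<in> U" and z: "z \<noteq> w" "z \<noteq> - w"
  shows "g_ext \<alpha> p z ** F u z = Ft u z ** gt u z"
proof -
  have PPM: "P u ** (P u ** M) = P u ** M" for M by (simp add: matrix_mul_assoc PP[OF u])
  have KL': "L z + K z * L z = K z" using KL[OF z] by (metis add_diff_cancel_left' add.commute diff_add_cancel)
  have scal: "smat (1 + K z) (mat 1 - smat (L z) p) = mat 1 + smat (K z) (mat 1 - p)"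
  proof -
    have "smat (1 + K z) (mat 1 - smat (L z) p) = smat (1 + K z) (mat 1) - smat (L z + K z * L z) p"
      by (simp add: vec_eq_iff algebra_simps)
    also have "\<dots> = mat 1 + smat (K z) (mat 1 - p)" unfolding KL' by (simp add: vec_eq_iff algebra_simps)
    finally show ?thesis .
  qed
  \<comment> \<open>Up to the scalar \<open>1 + K = (z + w)/(z - w)\<close>, the two loops in \<open>P u\<close> are inverse to each other.\<close>
  have right: "(mat 1 + smat (K z) (P u)) ** (mat 1 + smat (K z) (mat 1 - P u)) = smat (1 + K z) (mat 1)"
    by (simp add: mat_simps PP[OF u]) (simp add: vec_eq_iff algebra_simps)
  let ?N = "mat 1 - smat (L z) p"
  have 1: "(mat 1 + smat (K z) (mat 1 - p)) ** E u z = Et u z ** (mat 1 + smat (K z) (mat 1 - P u))"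
  proof -
    have "Et u z ** (mat 1 + smat (K z) (mat 1 - P u))
        = ?N ** (E u z ** ((mat 1 + smat (K z) (P u)) ** (mat 1 + smat (K z) (mat 1 - P u))))"
      unfolding Et_closed[OF u z] by (simp only: matrix_mul_assoc)
    also have "\<dots> = smat (1 + K z) ?N ** E u z" unfolding right by (simp add: smat_mult_left smat_mult_right)
    finally show ?thesis unfolding scal ..
  qed
  have 2: "(mat 1 + smat (K z) (mat 1 - p)) *v X u z = Et u z *v (- K z *s y u) + (1 + K z) *s Xt u z"
  proof -
    have "(mat 1 + smat (K z) (P u)) *v (- K z *s y u) = - ((1 + K z) * K z) *s y u"
      by (simp add: mat_simps Py[OF u]) (simp add: vec_eq_iff algebra_simps)
    then have "Et u z *v (- K z *s y u) = ?N *v (E u z *v (- ((1 + K z) * K z) *s y u))"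
      unfolding Et_closed[OF u z] matrix_vector_mul_assoc[symmetric] by (rule arg_cong)
    then have "Et u z *v (- K z *s y u) + (1 + K z) *s Xt u z = (smat (1 + K z) ?N) *v X u z"
      unfolding Xt_closed[OF u z]
      by (simp only: smat_matvec matvec_smult matrix_vector_right_distrib smult_add smult_smult)
        (simp add: vec_eq_iff algebra_simps)
    then show ?thesis unfolding scal ..
  qed
  show ?thesis
    unfolding g_ext_def gt_def F_eq Ft_def upper_block_mult g_simple_w[OF z(1)] K_plus_1[OF z(1)] 1
    using 2 by (simp add: upper_block_eq_iff)
qed

text \<open>In the coordinate \<open>\<zeta> = 1/z\<close> the only singular function involved becomes
  \<open>K = 2 w \<zeta> / (1 - w \<zeta>)\<close>, which vanishes at \<open>\<zeta> = 0\<close>.\<close>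

lemma gt_near_infinity: "mat_holomorphic_near_infinity (gt u) (mat 1)"
  unfolding mat_holomorphic_near_infinity_def
proof (intro exI conjI)
  define r where "r = 1 / \<bar>\<alpha>\<bar>"
  show "r > 0" using \<alpha>_nz by (simp add: r_def)
  have nz: "1 - w * \<zeta> \<noteq> 0" if "\<zeta> \<in> ball 0 r" for \<zeta>
  proof
    assume "1 - w * \<zeta> = 0"
    then have "norm (w * \<zeta>) = 1" by simp
    moreover have "norm (w * \<zeta>) < 1"
      using that \<alpha>_nz by (simp add: r_def norm_mult field_simps)
    ultimately show False by simp
  qed
  define k where "k \<zeta> = 2 * w * \<zeta> / (1 - w * \<zeta>)" for \<zeta>
  have hk: "k holomorphic_on ball 0 r"
    unfolding k_def using nz by (intro holomorphic_intros)
  have hol: "mat_holomorphic_on (\<lambda>\<zeta>. upper_block (mat 1 + smat (k \<zeta>) (mat 1 - P u)) (- k \<zeta> *s y u) (1 + k \<zeta>)) (ball 0 r)"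
    unfolding vector_uminus_component vector_smult_component
    by (intro mat_holomorphic_upper_block mat_holomorphic_intros hk holomorphic_intros)
      (simp add: holomorphic_intros hk)
  have eq: "(if \<zeta> = 0 then mat 1 else gt u (1 / \<zeta>))
      = upper_block (mat 1 + smat (k \<zeta>) (mat 1 - P u)) (- k \<zeta> *s y u) (1 + k \<zeta>)" if "\<zeta> \<in> ball 0 r" for \<zeta>
  proof (cases "\<zeta> = 0")
    case True
    then show ?thesis by (simp add: k_def mat_1_upper_block smat_zero)
  next
    case False
    have ne: "1 / \<zeta> \<noteq> w" using nz[OF that] False by (auto simp: field_simps)
    have "K (1 / \<zeta>) = k \<zeta>" using False nz[OF that] ne by (simp add: K_def k_def field_simps)
    then show ?thesis using False by (simp add: gt_def g_simple_w[OF ne] K_plus_1[OF ne])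
  qed
  show "mat_holomorphic_on (\<lambda>\<zeta>. if \<zeta> = 0 then mat 1 else gt u (1 / \<zeta>)) (ball 0 r)"
    unfolding mat_holomorphic_on_def
  proof (intro allI)
    fix i j
    show "(\<lambda>\<zeta>. (if \<zeta> = 0 then mat 1 else gt u (1 / \<zeta>)) $ i $ j) holomorphic_on ball 0 r"
      by (rule holomorphic_transform[OF hol[unfolded mat_holomorphic_on_def, rule_format, of i j]])
        (simp only: eq)
  qed
qed

lemma eventually_regular: "\<forall>\<^sub>F z in at_infinity. z \<noteq> w \<and> z \<noteq> - w"
  unfolding eventually_at_infinity
  by (intro exI[of _ "\<bar>\<alpha>\<bar> + 1"]) (auto simp: norm_mult)

lemma dressing_t: "dressing U (g_ext \<alpha> p) F Ft"
  unfolding dressing_def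
proof (intro ballI conjI exI)
  fix u assume u: "u \<in> U"
  show "mat_holomorphic_on (Ft u) UNIV" by (rule holo_Ft[OF u])
  show "mat_holomorphic_near_infinity (gt u) (mat 1)" by (rule gt_near_infinity)
  show "\<forall>\<^sub>F z in at_infinity. g_ext \<alpha> p z ** F u z = Ft u z ** gt u z"
    using eventually_regular by eventually_elim (simp add: factorization u)
qed

lemma dressing_unique:
  assumes F': "dressing U (g_ext \<alpha> p) F F'" and u: "u \<in> U"
  shows "F' u z = Ft u z"
proof -
  obtain g' where hF': "mat_holomorphic_on (F' u) UNIV" and g': "mat_holomorphic_near_infinity g' (mat 1)"
    and eq: "\<forall>\<^sub>F z in at_infinity. g_ext \<alpha> p z ** F u z = F' u z ** g' z"
    using F' u unfolding dressing_def by blast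
  have "Ft_inv u z ** F' u z = mat 1"
  proof (rule entire_factor_trivial[of "\<lambda>z. Ft_inv u z ** F' u z" g' "gt u"])
    show "mat_holomorphic_on (\<lambda>z. Ft_inv u z ** F' u z) UNIV"
      by (rule mat_holomorphic_on_mult[OF holo_Ft_inv[OF u] hF'])
    show "(g' \<longlongrightarrow> mat 1) at_infinity" "(gt u \<longlongrightarrow> mat 1) at_infinity"
      by (rule near_infinity_tendsto g' gt_near_infinity)+
    show "\<forall>\<^sub>F z in at_infinity. (Ft_inv u z ** F' u z) ** g' z = gt u z"
      using eq eventually_regular
    proof eventually_elim
      case (elim z)
      then have "F' u z ** g' z = Ft u z ** gt u z" using factorization[OF u] by simp
      then have "Ft_inv u z ** (F' u z ** g' z) = Ft_inv u z ** (Ft u z ** gt u z)" by simp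
      then show ?case by (simp add: matrix_mul_assoc Ft_inverse[OF u])
    qed
  qed
  then have "Ft u z ** (Ft_inv u z ** F' u z) = Ft u z" by simp
  then show ?thesis by (simp add: matrix_mul_assoc Ft_inverse[OF u])
qed

end

section \<open>The dressed geometry\<close>

context egoroff_dressing
begin

text \<open>The set on which the dressed metric is positive definite.\<close>

definition V where "V = {u \<in> U. \<forall>i. ht u $ i \<noteq> 0}"

lemma V_subset: "V \<subseteq> U" by (auto simp: V_def)

lemma open_V: "open V"
proof -
  have "open (U \<inter> (\<lambda>u. ht u $ i) -` (- {0}))" for i
    by (rule continuous_open_preimage[OF smooth_on_continuous[OF smooth_on_nth[OF open_U smooth_ht]] open_U]) auto
  then have "open (\<Inter>i\<in>UNIV. U \<inter> (\<lambda>u. ht u $ i) -` (- {0}))" by (intro open_INT) auto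
  moreover have "(\<Inter>i\<in>UNIV. U \<inter> (\<lambda>u. ht u $ i) -` (- {0})) = V" by (auto simp: V_def)
  ultimately show ?thesis by simp
qed

lemma zero_V: "0 \<in> V"
  using zero_U h_nz[OF zero_U] by (simp add: V_def ht_def y0)

lemma rotation_V: "u \<in> V \<Longrightarrow> \<beta>t u = rotation_coeffs ht u"
  by (rule rotation_t) (auto simp: V_def)

lemma unitary_Et: assumes "u \<in> U" shows "adj (Et u (of_real r)) ** Et u (of_real r) = mat 1"
  using Et_reality[OF assms, of "of_real r"] Et_transpose_inverse'[OF assms] by (simp add: adj_def)

lemma unitary_frame_t: "unitary_frame V ht \<beta>t (\<lambda>u. Et u (of_real r)) (\<lambda>u. Xt u (of_real r)) r"
proof
  show "smooth_on V ht" "smooth_on V \<beta>t"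
    by (rule smooth_on_subset[OF _ open_U V_subset open_V] smooth_ht smooth_\<beta>t)+
qed (use V_subset open_V in \<open>auto intro!: unitary_Et dEt dXt simp: V_def\<close>)

lemma flat_metric_t: "flat_metric V (diag_metric ht)"
  by (rule unitary_frame.flat_diag_metric[OF unitary_frame_t refl])

lemma flat_egoroff_t: "flat_egoroff V ht \<phi>t"
  unfolding flat_egoroff_def
  using smooth_on_subset[OF smooth_ht open_U V_subset open_V] flat_metric_t potential_t V_subset
  by (auto simp: has_potential_def)

lemma extended_frame_t: "extended_frame V ht Ft"
  unfolding extended_frame_def
proof (intro conjI ballI allI)
  show "mat_holomorphic_on (Ft u) UNIV" if "u \<in> V" for u using holo_Ft that V_subset by blast
  show "Ft 0 z = mat 1" for z by (simp add: Ft_def Et0 Xt0 mat_1_upper_block)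
  show "frame_equation V ht (rotation_coeffs ht) Ft"
    using frame_equation_t V_subset unfolding frame_equation_def by (auto simp flip: rotation_V)
qed

lemma flat_lagrangian_family_t: "flat_lagrangian_family V ht Xt"
  unfolding flat_lagrangian_family_def Let_def
proof (intro allI impI)
  fix r :: real
  interpret unitary_frame V ht \<beta>t "\<lambda>u. Et u (of_real r)" "\<lambda>u. Xt u (of_real r)" r
    by (rule unitary_frame_t)
  have "flat_metric V (first_fundamental_form (\<lambda>u. Xt u (of_real r)))"
    by (rule flat_metric_cong[OF open_V _ flat_metric_t]) (simp add: first_form)
  then show "flat_lagrangian_immersion V (\<lambda>u. Xt u (of_real r)) \<and>
      (\<forall>u\<in>V. first_fundamental_form (\<lambda>u. Xt u (of_real r)) u = diag_metric ht u) \<and>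
      (\<forall>u\<in>V. \<forall>v w. second_fundamental_form (\<lambda>u. Xt u (of_real r)) u v w =
         r *\<^sub>R (\<Sum>i\<in>UNIV. (v $ i * w $ i) *\<^sub>R (\<i> *s partial_deriv i (\<lambda>u. Xt u (of_real r)) u)))"
    unfolding flat_lagrangian_immersion_def using immersion lagrangian first_form second_form by simp
qed

lemma Xt_formula:
  assumes "u \<in> U" "z \<noteq> w" "z \<noteq> - w"
  shows "Xt u z = g_simple (- w) (mat 1 - p) z *v (X u z + (2 * w / (z - w)) *s (E u z *v (P u *v \<eta> u)))"
  unfolding Xt_closed[OF assms] g_simple_minus_w[OF assms(3)] K_def y_def ..

lemma \<phi>t_formula: assumes u: "u \<in> U"
  shows "complex_of_real (\<phi>t u) = of_real (\<phi> u) - 2 * of_real \<alpha> * dot (\<eta> u) (y u)"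
proof -
  have "dot (\<eta> u) (y u) = of_real (\<Sum>i\<in>UNIV. Re (\<eta> u $ i) * Re (y u $ i))"
    by (simp add: dot_def \<eta>_real[OF u] y_real[OF u])
  then have "of_real (Re (dot (\<eta> u) (y u))) = dot (\<eta> u) (y u)" by (metis Re_complex_of_real)
  then show ?thesis by (simp add: \<phi>t_def)
qed

end

theorem theorem5p2:
  fixes U :: "(real^'n::finite) set"
    and h :: "real^'n \<Rightarrow> real^'n" and \<phi> :: "real^'n \<Rightarrow> real" and \<beta> :: "real^'n \<Rightarrow> real^'n^'n"
    and E :: "real^'n \<Rightarrow> complex \<Rightarrow> complex^'n^'n" and X :: "real^'n \<Rightarrow> complex \<Rightarrow> complex^'n"
    and F :: "real^'n \<Rightarrow> complex \<Rightarrow> complex^('n option)^('n option)"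
    and \<alpha> :: real and \<pi> :: "complex^'n^'n"
    and \<pi>t :: "real^'n \<Rightarrow> complex^'n^'n" and \<eta> :: "real^'n \<Rightarrow> complex^'n"
  assumes "open U" and "simply_connected U" and "0 \<in> U"
    and "flat_egoroff U h \<phi>"
    and "\<And>u. \<beta> u = rotation_coeffs h u"
    and "extended_frame U h F"
    and "\<And>u z. F u z = upper_block (E u z) (X u z) 1"
    and "\<alpha> \<noteq> 0"
    and "hermitian_projection \<pi>" and "map_matrix cnj \<pi> = \<pi>"
    and "\<And>u. \<pi>t u = hermitian_projection_onto
                        ((*v) (matrix_inv (E u (\<i> * of_real \<alpha>))) ` range ((*v) \<pi>))"
    and "\<And>u. \<eta> u = transpose (E u (\<i> * of_real \<alpha>)) *v X u (- \<i> * of_real \<alpha>)"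
  shows "\<exists>Ft Et Xt ht \<beta>t \<phi>t V.
     \<comment> \<open>the dressing action is defined, with result \<open>Ft\<close>\<close>
     dressing U (g_ext \<alpha> \<pi>) F Ft \<and>
     (\<forall>F'. dressing U (g_ext \<alpha> \<pi>) F F' \<longrightarrow> (\<forall>u\<in>U. \<forall>z. F' u z = Ft u z)) \<and>
     (\<forall>u\<in>U. \<forall>z. Ft u z = upper_block (Et u z) (Xt u z) 1) \<and>
     frame_equation U ht \<beta>t Ft \<and>
     \<comment> \<open>explicit formulas\<close>
     (\<forall>u\<in>U. \<forall>z. z \<noteq> \<i> * of_real \<alpha> \<and> z \<noteq> - \<i> * of_real \<alpha> \<longrightarrow>
        Xt u z = g_simple (- \<i> * of_real \<alpha>) (mat 1 - \<pi>) z *v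
          (X u z + (2 * \<i> * of_real \<alpha> / (z - \<i> * of_real \<alpha>)) *s (E u z *v (\<pi>t u *v \<eta> u)))) \<and>
     (\<forall>u\<in>U. cvec (ht u) = cvec (h u) - (2 * of_real \<alpha>) *s (\<pi>t u *v \<eta> u)) \<and>
     (\<forall>u\<in>U. cmat (\<beta>t u) = cmat (\<beta> u) - mat (2 * of_real \<alpha>) ** off_diagonal (\<pi>t u)) \<and>
     (\<forall>u\<in>U. complex_of_real (\<phi>t u) =
        of_real (\<phi> u) - 2 * of_real \<alpha> * (\<Sum>i\<in>UNIV. \<eta> u $ i * (\<pi>t u *v \<eta> u) $ i)) \<and>
     has_potential U ht \<phi>t \<and>
     \<comment> \<open>the new geometry, where the new metric is nondegenerate\<close>
     V = {u \<in> U. \<forall>i. ht u $ i \<noteq> 0} \<and> open V \<and> 0 \<in> V \<and>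
     flat_egoroff V ht \<phi>t \<and>
     (\<forall>u\<in>V. \<beta>t u = rotation_coeffs ht u) \<and>
     extended_frame V ht Ft \<and>
     flat_lagrangian_family V ht Xt"
proof -
  interpret egoroff_dressing U h \<phi> \<beta> E X F \<alpha> \<pi> \<pi>t \<eta>
    by unfold_locales (use assms simply_connected_imp_connected in auto)
  show ?thesis
  proof (intro exI[of _ Ft] exI[of _ Et] exI[of _ Xt] exI[of _ ht] exI[of _ \<beta>t] exI[of _ \<phi>t] exI[of _ V]
      conjI allI impI ballI)
    show "dressing U (g_ext \<alpha> \<pi>) F Ft" by (rule dressing_t)
    show "F' u z = Ft u z" if "dressing U (g_ext \<alpha> \<pi>) F F'" "u \<in> U" for F' u z
      using that by (rule dressing_unique)
    show "Ft u z = upper_block (Et u z) (Xt u z) 1" for u z by (rule Ft_def)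
    show "frame_equation U ht \<beta>t Ft" by (rule frame_equation_t)
    show "Xt u z = g_simple (- \<i> * of_real \<alpha>) (mat 1 - \<pi>) z *v
          (X u z + (2 * \<i> * of_real \<alpha> / (z - \<i> * of_real \<alpha>)) *s (E u z *v (\<pi>t u *v \<eta> u)))"
      if "u \<in> U" "z \<noteq> \<i> * of_real \<alpha> \<and> z \<noteq> - \<i> * of_real \<alpha>" for u z
      using Xt_formula[OF that(1), of z] that(2) by (simp add: mult.assoc)
    show "cvec (ht u) = cvec (h u) - (2 * of_real \<alpha>) *s (\<pi>t u *v \<eta> u)" if "u \<in> U" for u
      using cvec_ht[OF that] by (simp only: y_def)
    show "cmat (\<beta>t u) = cmat (\<beta> u) - mat (2 * of_real \<alpha>) ** off_diagonal (\<pi>t u)" if "u \<in> U" for u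
      using cmat_\<beta>t[OF that] by (simp only: mat_mult_eq_smat)
    show "complex_of_real (\<phi>t u) = of_real (\<phi> u) - 2 * of_real \<alpha> * (\<Sum>i\<in>UNIV. \<eta> u $ i * (\<pi>t u *v \<eta> u) $ i)"
      if "u \<in> U" for u
      using \<phi>t_formula[OF that] by (simp only: dot_def y_def)
    show "has_potential U ht \<phi>t" by (rule potential_t)
    show "V = {u \<in> U. \<forall>i. ht u $ i \<noteq> 0}" by (rule V_def)
    show "open V" "0 \<in> V" by (rule open_V zero_V)+
    show "flat_egoroff V ht \<phi>t" by (rule flat_egoroff_t)
    show "\<beta>t u = rotation_coeffs ht u" if "u \<in> V" for u using that by (rule rotation_V)
    show "extended_frame V ht Ft" by (rule extended_frame_t)
    show "flat_lagrangian_family V ht Xt" by (rule flat_lagrangian_family_t)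
  qed
qed

end
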